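(* Let $N\ge1$ be an integer and let $\mathcal{N}=[J^N]^\perp\subset H^2(\mathbb{D}^d)$, where $J$ is the ideal of all polynomials in $\mathbb{C}[z_1,\ldots,z_d]$ vanishing on the diagonal $\{(z,\ldots,z):z\in\mathbb{D}\}$. Then for all $f_1,f_2\in\mathbb{C}[z_1,\ldots,z_d]$, $$\operatorname{tr}[S_{f_1}^*,S_{f_2}]=\binom{d+N-2}{d-1}\,\langle (rf_2)',(rf_1)'\rangle_{L_a^2(\mathbb{D})}.$$
   Context: $d\ge 3$ is an integer. $H^2(\mathbb{D}^d)$ is the Hardy space over the unit polydisc, in which the monomials form an orthonormal basis. $J^N$ is the $N$-th power of the ideal $J$, $[J^N]$ its closure in $H^2(\mathbb{D}^d)$. For a polynomial $f$, $M_f$ is multiplication by $f$ on $H^2(\mathbb{D}^d)$ and $S_f=P_{\mathcal{N}}M_f|_{\mathcal{N}}$, with $P_{\mathcal{N}}$ the orthogonal projection onto $\mathcal{N}$. $[A,B]=AB-BA$. The restriction map $r$ is $(rf)(z)=f(z,\ldots,z)$, $z\in\mathbb{D}$, and $'$ is the complex derivative. $L_a^2(\mathbb{D})$ is the Bergman space of the disc with respect to normalized area measure (total mass $1$), so $\langle z^k,z^l\rangle=\delta_{kl}/(k+1)$. Writing $\operatorname{tr}T=c$ includes the assertion that $T$ is trace class. *)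

theory Defs
  imports "HOL-Analysis.Analysis" "HOL-Library.Poly_Mapping"
begin

section \<open>Polynomials in finitely many variables\<close>

text \<open>
  The index type \<open>'d\<close> plays the role of \<open>{1..d}\<close>, so \<open>d = CARD('d)\<close> and the whole type
  \<open>'d mpoly\<close> is the polynomial ring over the complex numbers in \<open>d\<close> variables.
  A multi-index is an element of \<open>'d \<Rightarrow>\<^sub>0 nat\<close>.
\<close>

type_synonym 'd mpoly = "('d \<Rightarrow>\<^sub>0 nat) \<Rightarrow>\<^sub>0 complex"

definition monom_fun :: "('d::finite \<Rightarrow>\<^sub>0 nat) \<Rightarrow> complex ^ 'd \<Rightarrow> complex" where
  "monom_fun \<alpha> z = (\<Prod>i\<in>UNIV. (z $ i) ^ Poly_Mapping.lookup \<alpha> i)"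

definition mpoly_eval :: "'d::finite mpoly \<Rightarrow> complex ^ 'd \<Rightarrow> complex" where
  "mpoly_eval p z = (\<Sum>\<alpha>\<in>Poly_Mapping.keys p. Poly_Mapping.lookup p \<alpha> * monom_fun \<alpha> z)"

definition diag_restrict :: "(complex ^ 'd \<Rightarrow> complex) \<Rightarrow> complex \<Rightarrow> complex" where
  "diag_restrict f w = f (\<chi> i. w)"

definition diag_ideal :: "'d::finite mpoly set" where
  "diag_ideal = {p. \<forall>w\<in>ball 0 1. diag_restrict (mpoly_eval p) w = 0}"

text \<open>
  For a commutative ring regarded as a module over itself, the span of a set is the ideal
  generated by it.
\<close>

definition ideal_power :: "'a::comm_ring_1 set \<Rightarrow> nat \<Rightarrow> 'a set" where
  "ideal_power I n = module.span (*) {\<Prod>k<n. g k | g. \<forall>k<n. g k \<in> I}"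


section \<open>The Hardy space over the polydisc\<close>

definition polydisc :: "(complex ^ 'd) set" where
  "polydisc = {z. \<forall>i. cmod (z $ i) < 1}"

text \<open>
  Functions on the polydisc are represented by functions on the whole space that vanish
  outside the polydisc. The coefficient family of an element of the Hardy space is unique,
  by the identity theorem for power series.
\<close>

definition hardy_expansion ::
  "(('d::finite \<Rightarrow>\<^sub>0 nat) \<Rightarrow> complex) \<Rightarrow> (complex ^ 'd \<Rightarrow> complex) \<Rightarrow> bool" where
  "hardy_expansion a f \<longleftrightarrow>
     (\<lambda>\<alpha>. (cmod (a \<alpha>))\<^sup>2) summable_on UNIV \<and>
     (\<forall>z\<in>polydisc. ((\<lambda>\<alpha>. a \<alpha> * monom_fun \<alpha> z) has_sum f z) UNIV) \<and>
     (\<forall>z. z \<notin> polydisc \<longrightarrow> f z = 0)"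

definition hardy :: "(complex ^ 'd::finite \<Rightarrow> complex) set" where
  "hardy = {f. \<exists>a. hardy_expansion a f}"

definition hardy_coeff :: "(complex ^ 'd::finite \<Rightarrow> complex) \<Rightarrow> ('d \<Rightarrow>\<^sub>0 nat) \<Rightarrow> complex" where
  "hardy_coeff f = (THE a. hardy_expansion a f)"

text \<open>The inner product is linear in the first argument.\<close>

definition hardy_inner ::
  "(complex ^ 'd::finite \<Rightarrow> complex) \<Rightarrow> (complex ^ 'd \<Rightarrow> complex) \<Rightarrow> complex" where
  "hardy_inner f g = (\<Sum>\<^sub>\<infinity>\<alpha>. hardy_coeff f \<alpha> * cnj (hardy_coeff g \<alpha>))"

definition hardy_norm :: "(complex ^ 'd::finite \<Rightarrow> complex) \<Rightarrow> real" where
  "hardy_norm f = sqrt (Re (hardy_inner f f))"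

definition hardy_of_mpoly :: "'d::finite mpoly \<Rightarrow> complex ^ 'd \<Rightarrow> complex" where
  "hardy_of_mpoly p z = (if z \<in> polydisc then mpoly_eval p z else 0)"

definition hardy_closure ::
  "(complex ^ 'd::finite \<Rightarrow> complex) set \<Rightarrow> (complex ^ 'd \<Rightarrow> complex) set" where
  "hardy_closure A = {f \<in> hardy. \<forall>\<epsilon>>0. \<exists>g\<in>A. hardy_norm (f - g) < \<epsilon>}"

definition hardy_orth_compl ::
  "(complex ^ 'd::finite \<Rightarrow> complex) set \<Rightarrow> (complex ^ 'd \<Rightarrow> complex) set" where
  "hardy_orth_compl A = {f \<in> hardy. \<forall>g\<in>A. hardy_inner f g = 0}"

definition quotient_module :: "nat \<Rightarrow> (complex ^ 'd::finite \<Rightarrow> complex) set" where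
  "quotient_module n =
     hardy_orth_compl (hardy_closure (hardy_of_mpoly ` ideal_power diag_ideal n))"


section \<open>Operators on closed subspaces of the Hardy space\<close>

text \<open>
  In the following, \<open>K\<close> is a closed subspace of the Hardy space. An operator on \<open>K\<close> is given
  by a function whose values outside \<open>K\<close> are irrelevant.
\<close>

definition hardy_proj ::
  "(complex ^ 'd::finite \<Rightarrow> complex) set \<Rightarrow> (complex ^ 'd \<Rightarrow> complex) \<Rightarrow> complex ^ 'd \<Rightarrow> complex"
  where
  "hardy_proj K f = (THE g. g \<in> K \<and> (\<forall>h\<in>K. hardy_inner (f - g) h = 0))"

definition mult_op ::
  "'d::finite mpoly \<Rightarrow> (complex ^ 'd \<Rightarrow> complex) \<Rightarrow> complex ^ 'd \<Rightarrow> complex" where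
  "mult_op p g z = mpoly_eval p z * g z"

definition compression ::
  "(complex ^ 'd::finite \<Rightarrow> complex) set \<Rightarrow> 'd mpoly \<Rightarrow>
     (complex ^ 'd \<Rightarrow> complex) \<Rightarrow> complex ^ 'd \<Rightarrow> complex" where
  "compression K p g = hardy_proj K (mult_op p g)"

definition adjoint_on ::
  "(complex ^ 'd::finite \<Rightarrow> complex) set \<Rightarrow>
     ((complex ^ 'd \<Rightarrow> complex) \<Rightarrow> complex ^ 'd \<Rightarrow> complex) \<Rightarrow>
     (complex ^ 'd \<Rightarrow> complex) \<Rightarrow> complex ^ 'd \<Rightarrow> complex" where
  "adjoint_on K T g = (THE h. h \<in> K \<and> (\<forall>k\<in>K. hardy_inner (T k) g = hardy_inner k h))"

definition commutator ::
  "(('a \<Rightarrow> complex) \<Rightarrow> 'a \<Rightarrow> complex) \<Rightarrow> (('a \<Rightarrow> complex) \<Rightarrow> 'a \<Rightarrow> complex) \<Rightarrow>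
     ('a \<Rightarrow> complex) \<Rightarrow> 'a \<Rightarrow> complex" where
  "commutator A B g = A (B g) - B (A g)"

definition orthonormal_basis ::
  "(complex ^ 'd::finite \<Rightarrow> complex) set \<Rightarrow> (complex ^ 'd \<Rightarrow> complex) set \<Rightarrow> bool" where
  "orthonormal_basis K E \<longleftrightarrow>
     E \<subseteq> K \<and>
     (\<forall>e\<in>E. \<forall>e'\<in>E. hardy_inner e e' = (if e = e' then 1 else 0)) \<and>
     (\<forall>f\<in>K. (\<forall>e\<in>E. hardy_inner f e = 0) \<longrightarrow> f = (\<lambda>z. 0))"

text \<open>
  Trace class operators are taken to be the nuclear operators of the Hilbert space \<open>K\<close>,
  i.e. norm-convergent sums of rank one operators \<open>f \<mapsto> \<langle>f, x\<^sub>n\<rangle> y\<^sub>n\<close> with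
  \<open>\<Sum>\<^sub>n \<parallel>x\<^sub>n\<parallel> \<parallel>y\<^sub>n\<parallel> < \<infinity>\<close>.
\<close>

definition trace_class_on ::
  "(complex ^ 'd::finite \<Rightarrow> complex) set \<Rightarrow>
     ((complex ^ 'd \<Rightarrow> complex) \<Rightarrow> complex ^ 'd \<Rightarrow> complex) \<Rightarrow> bool" where
  "trace_class_on K T \<longleftrightarrow>
     (\<forall>f\<in>K. T f \<in> K) \<and>
     (\<exists>x y :: nat \<Rightarrow> complex ^ 'd \<Rightarrow> complex.
        range x \<subseteq> K \<and> range y \<subseteq> K \<and>
        summable (\<lambda>n. hardy_norm (x n) * hardy_norm (y n)) \<and>
        (\<forall>f\<in>K. (\<lambda>m. hardy_norm (T f - (\<lambda>z. \<Sum>n<m. hardy_inner f (x n) * y n z)))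
                  \<longlonglongrightarrow> 0))"

definition has_trace_on ::
  "(complex ^ 'd::finite \<Rightarrow> complex) set \<Rightarrow>
     ((complex ^ 'd \<Rightarrow> complex) \<Rightarrow> complex ^ 'd \<Rightarrow> complex) \<Rightarrow> complex \<Rightarrow> bool" where
  "has_trace_on K T c \<longleftrightarrow>
     trace_class_on K T \<and>
     (\<forall>E. orthonormal_basis K E \<longrightarrow> ((\<lambda>e. hardy_inner (T e) e) has_sum c) E)"


section \<open>The Bergman space of the disc\<close>

definition bergman_inner :: "(complex \<Rightarrow> complex) \<Rightarrow> (complex \<Rightarrow> complex) \<Rightarrow> complex" where
  "bergman_inner g h =
     complex_of_real (1 / pi) * set_lebesgue_integral lborel (ball 0 1) (\<lambda>w. g w * cnj (h w))"

end

theory Submission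
  imports Defs "HOL-Library.Landau_Symbols" "HOL-Computational_Algebra.Formal_Power_Series"
begin

text \<open>
  Everything is graded by the total degree. Identify the Hardy space with the square-summable
  families \<open>a\<close> indexed by multi-indices, and let \<open>\<N>\<^sub>n\<close> be the part of the quotient module
  in degree \<open>n\<close>. For homogeneous \<open>q\<close>, the condition \<open>q \<in> J\<^sup>N\<close> says that \<open>q\<close> vanishes to order
  \<open>N\<close> at \<open>(1, \<dots>, 1)\<close> in the directions transversal to the diagonal. Hence, in every
  sufficiently high degree, \<open>\<N>\<^sub>n\<close> consists of the families \<open>\<alpha> \<mapsto> p \<alpha>\<close> on
  \<open>{\<alpha>. \<bar>\<alpha>\<bar> = n}\<close> with \<open>p\<close> a polynomial of degree less than \<open>N\<close>; as \<open>\<bar>\<alpha>\<bar>\<close> is constant there,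
  \<open>p\<close> can be taken homogeneous of degree \<open>N - 1\<close>. This gives the multiplicity
  \<open>R = (d + N - 2 choose d - 1)\<close> as the dimension of \<open>\<N>\<^sub>n\<close>
  (\<open>monom_vec_mem\<close>, \<open>annihilator_dependent\<close>, \<open>card_homog\<close>).

  In this picture the adjoint of multiplication by \<open>z\<^sup>\<beta>\<close> is the shift \<open>p \<mapsto> p (\<cdot> + \<beta>)\<close>. After
  rescaling \<open>\<alpha>\<close> by \<open>1/n\<close> the spaces \<open>\<N>\<^sub>n\<close> converge to the polynomials of degree less than
  \<open>N\<close> on a simplex and the shift is a perturbation of order \<open>1/n\<close> of the identity. More
  precisely, Gram-Schmidt in \<open>\<N>\<^sub>n\<close> can be carried out with coefficients of the form
  \<open>x + y/n + O(1/n\<^sup>2)\<close> (\<open>gram_schmidt_expands2\<close>), so that with respect to the resulting bases the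
  matrices of \<open>S\<close> for a monomial \<open>z\<^sup>\<beta>\<close> are \<open>1 + B\<^sub>\<beta>/n + O(1/n\<^sup>2)\<close>. In a commutator
  \<open>[S\<^sub>\<beta>\<^sup>*, S\<^sub>\<gamma>]\<close> the constant terms and the terms of order \<open>1/n\<close> cancel, the entries of its
  matrix are \<open>O(1/n\<^sup>2)\<close>, and since the blocks have bounded size the operator is nuclear
  (\<open>commutator_matrix_decay\<close>, \<open>commutator_matrix_summable\<close>).

  The trace of a nuclear operator can be computed in any orthonormal basis (\<open>nuclear_trace\<close>),
  in particular in the homogeneous one. If \<open>\<bar>\<beta>\<bar> \<noteq> \<bar>\<gamma>\<bar>\<close>, the diagonal vanishes. If
  \<open>\<bar>\<beta>\<bar> = \<bar>\<gamma>\<bar> = p\<close>, the trace of the \<open>n\<close>-th block is \<open>\<tau> n - \<tau> (n - p)\<close>, where \<open>\<tau> n\<close> is the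
  trace of \<open>S\<^sub>\<beta>\<^sup>* S\<^sub>\<gamma>\<close> on \<open>\<N>\<^sub>n\<close> and tends to \<open>R\<close>; so the sum telescopes to \<open>p R\<close>
  (\<open>commutator_matrix_trace\<close>). On the other side, the derivatives of \<open>w ^ p\<close> and \<open>w ^ q\<close> have
  the inner product \<open>p\<close> in the Bergman space if \<open>p = q\<close> and are orthogonal otherwise
  (\<open>bergman_inner_deriv_diag\<close>). Both sides are sesquilinear in the two polynomials.
\<close>

section \<open>Second-order expansions of sequences\<close>

text \<open>
  The sequence \<open>f\<close> is \<open>a + b / n + O(1 / n\<^sup>2)\<close>. The coefficient \<open>b\<close> is recorded because the
  decay of the commutators comes from a cancellation of the terms of order \<open>1 / n\<close>.
\<close>

definition expands2 :: "(nat \<Rightarrow> real) \<Rightarrow> real \<Rightarrow> real \<Rightarrow> bool" where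
  "expands2 f a b \<longleftrightarrow> (\<lambda>n. f n - a - b / real n) \<in> O(\<lambda>n. 1 / real n ^ 2)"

lemma expands2I:
  assumes "\<And>n. f n - a - b / real n = e n" "e \<in> O(\<lambda>n. 1 / real n ^ 2)"
  shows "expands2 f a b"
  using assms unfolding expands2_def by simp

lemma bigo_inverse_nat_const: "(\<lambda>n. c / real n) \<in> O(\<lambda>n. 1 / real n)"
  by (rule bigoI[of _ "\<bar>c\<bar>"]) simp

lemma expands2_first_order:
  assumes "expands2 f a b"
  shows "(\<lambda>n. f n - a) \<in> O(\<lambda>n. 1 / real n)"
proof -
  have "(\<lambda>n. 1 / real n ^ 2) \<in> O(\<lambda>n. 1 / real n)"
    by (rule bigoI[of _ 1], intro always_eventually allI) (simp add: divide_simps power2_eq_square)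
  hence "(\<lambda>n. f n - a - b / real n) \<in> O(\<lambda>n. 1 / real n)"
    using assms unfolding expands2_def by (rule landau_o.big_trans[rotated])
  from sum_in_bigo(1)[OF this bigo_inverse_nat_const[of b]] show ?thesis by simp
qed

lemma expands2_tendsto:
  assumes "expands2 f a b"
  shows "f \<longlonglongrightarrow> a"
proof -
  have "(\<lambda>n. 1 / real n) \<in> o(\<lambda>_. 1)"
    by (rule smalloI_tendsto) (auto simp: lim_1_over_n)
  hence "(\<lambda>n. f n - a) \<in> o(\<lambda>_. 1)"
    using expands2_first_order[OF assms] by (rule landau_o.big_small_trans[rotated])
  hence "(\<lambda>n. (f n - a) / 1) \<longlonglongrightarrow> 0"
    by (rule smalloD_tendsto)
  thus ?thesis using LIM_zero_cancel by force
qed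

lemma expands2_bounded:
  assumes "expands2 f a b"
  shows "f \<in> O(\<lambda>_. 1)"
  using expands2_tendsto[OF assms] by (intro bigoI_tendsto[where c = a]) auto

lemma expands2_const [simp]: "expands2 (\<lambda>_. c) c 0"
  by (simp add: expands2_def)

lemma expands2_inverse_nat: "expands2 (\<lambda>n. 1 / real n) 0 1"
  by (simp add: expands2_def)

lemma expands2_add:
  assumes "expands2 f a b" "expands2 g c d"
  shows "expands2 (\<lambda>n. f n + g n) (a + c) (b + d)"
proof -
  have "(\<lambda>n. (f n - a - b / real n) + (g n - c - d / real n)) \<in> O(\<lambda>n. 1 / real n ^ 2)"
    using assms unfolding expands2_def by (rule sum_in_bigo)
  thus ?thesis unfolding expands2_def by (simp add: algebra_simps add_divide_distrib)
qed

lemma expands2_mult: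
  assumes "expands2 f a b" "expands2 g c d"
  shows "expands2 (\<lambda>n. f n * g n) (a * c) (a * d + b * c)"
proof -
  have 1: "(\<lambda>n. (f n - a - b / real n) * g n) \<in> O(\<lambda>n. 1 / real n ^ 2 * 1)"
    using assms(1) expands2_bounded[OF assms(2)] unfolding expands2_def by (rule landau_o.big.mult)
  have 2: "(\<lambda>n. b / real n * (g n - c)) \<in> O(\<lambda>n. 1 / real n * (1 / real n))"
    using bigo_inverse_nat_const expands2_first_order[OF assms(2)] by (rule landau_o.big.mult)
  have 3: "(\<lambda>n. a * (g n - c - d / real n)) \<in> O(\<lambda>n. 1 / real n ^ 2)"
    using assms(2) unfolding expands2_def by simp
  have "(\<lambda>n. (f n - a - b / real n) * g n + b / real n * (g n - c) + a * (g n - c - d / real n))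
      \<in> O(\<lambda>n. 1 / real n ^ 2)"
    using sum_in_bigo(1)[OF sum_in_bigo(1)[OF 1[simplified] 2[folded power2_eq_square, unfolded power_one_over]] 3]
    by (simp add: power2_eq_square)
  thus ?thesis
    by (rule expands2I[rotated]) (simp add: algebra_simps add_divide_distrib diff_divide_distrib)
qed

lemma expands2_cmult: "expands2 f a b \<Longrightarrow> expands2 (\<lambda>n. c * f n) (c * a) (c * b)"
  using expands2_mult[OF expands2_const[of c], of f a b] by simp

lemma expands2_uminus: "expands2 f a b \<Longrightarrow> expands2 (\<lambda>n. - f n) (- a) (- b)"
  using expands2_cmult[of f a b "-1"] by simp

lemma expands2_diff: "expands2 f a b \<Longrightarrow> expands2 g c d \<Longrightarrow> expands2 (\<lambda>n. f n - g n) (a - c) (b - d)"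
  using expands2_add[of f a b "\<lambda>n. - g n" "-c" "-d"] expands2_uminus[of g c d] by simp

lemma expands2_sum:
  assumes "\<And>i. i \<in> A \<Longrightarrow> expands2 (f i) (a i) (b i)"
  shows "expands2 (\<lambda>n. \<Sum>i\<in>A. f i n) (\<Sum>i\<in>A. a i) (\<Sum>i\<in>A. b i)"
  using assms by (induction A rule: infinite_finite_induct) (auto intro: expands2_add)

lemma expands2_power:
  assumes "expands2 f a b"
  shows "\<exists>b'. expands2 (\<lambda>n. f n ^ k) (a ^ k) b'"
proof (induction k)
  case 0
  show ?case by (rule exI[of _ 0]) simp
next
  case (Suc k)
  thus ?case using expands2_mult[OF assms] by fastforce
qed

lemma expands2_cong:
  assumes "eventually (\<lambda>n. f n = g n) sequentially" "expands2 f a b"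
  shows "expands2 g a b"
proof -
  have "(\<lambda>n. f n - a - b / real n) \<in> O(\<lambda>n. 1 / real n ^ 2) \<longleftrightarrow>
        (\<lambda>n. g n - a - b / real n) \<in> O(\<lambda>n. 1 / real n ^ 2)"
    by (rule landau_o.big.in_cong) (use assms(1) in \<open>auto elim: eventually_mono\<close>)
  thus ?thesis using assms(2) unfolding expands2_def by simp
qed

lemma bigo_shift_square: "(\<lambda>n. 1 / real (n + s) ^ 2) \<in> O(\<lambda>n. 1 / real n ^ 2)"
proof (rule bigoI[of _ 1], rule eventually_mono[OF eventually_gt_at_top[of 0]])
  fix n :: nat assume "n > 0"
  thus "norm (1 / real (n + s) ^ 2) \<le> 1 * norm (1 / real n ^ 2)"
    by (auto intro!: divide_left_mono power_mono)
qed

lemma bigo_shift_square': "(\<lambda>n. 1 / real (n - s) ^ 2) \<in> O(\<lambda>n. 1 / real n ^ 2)"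
proof (rule bigoI[of _ "4"], rule eventually_mono[OF eventually_gt_at_top[of "2 * s"]])
  fix n :: nat assume n: "n > 2 * s"
  hence "real n \<le> 2 * real (n - s)" by (simp add: of_nat_diff)
  hence "real n ^ 2 \<le> (2 * real (n - s)) ^ 2" by (intro power_mono) auto
  hence "real n ^ 2 \<le> 4 * real (n - s) ^ 2" by (simp add: power2_eq_square)
  moreover have "real n ^ 2 > 0" "real (n - s) ^ 2 > 0" using n by auto
  ultimately show "norm (1 / real (n - s) ^ 2) \<le> 4 * norm (1 / real n ^ 2)"
    by (simp add: divide_simps)
qed

text \<open>
  A shift of the index leaves both coefficients alone, as \<open>1 / n - 1 / (n + s)\<close> is \<open>O(1 / n\<^sup>2)\<close>.
  This is why products of two expansions taken at different indices still cancel up to second order.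
\<close>

lemma expands2_shift:
  assumes "expands2 f a b"
  shows "expands2 (\<lambda>n. f (n + s)) a b"
proof -
  have "filterlim (\<lambda>n. n + s) at_top sequentially" by (rule filterlim_add_const_nat_at_top)
  hence "(\<lambda>n. f (n + s) - a - b / real (n + s)) \<in> O(\<lambda>n. 1 / real (n + s) ^ 2)"
    using assms unfolding expands2_def by (rule landau_o.big.compose[rotated])
  hence 1: "(\<lambda>n. f (n + s) - a - b / real (n + s)) \<in> O(\<lambda>n. 1 / real n ^ 2)"
    using bigo_shift_square by (rule landau_o.big_trans)
  have 2: "(\<lambda>n. b / real (n + s) - b / real n) \<in> O(\<lambda>n. 1 / real n ^ 2)"
  proof (rule bigoI[of _ "\<bar>b * s\<bar>"], rule eventually_mono[OF eventually_gt_at_top[of 0]])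
    fix n :: nat assume n: "n > 0"
    have "b / real (n + s) - b / real n = - (b * s) / (real n * real (n + s))"
      using n by (simp add: field_simps)
    hence "norm (b / real (n + s) - b / real n) = \<bar>b * s\<bar> / (real n * real (n + s))"
      using n by (simp add: abs_mult)
    also have "\<dots> \<le> \<bar>b * s\<bar> / (real n * real n)"
      using n by (intro divide_left_mono mult_left_mono) auto
    finally show "norm (b / real (n + s) - b / real n) \<le> \<bar>b * s\<bar> * norm (1 / real n ^ 2)"
      by (simp add: power2_eq_square)
  qed
  show ?thesis by (rule expands2I[OF _ sum_in_bigo(1)[OF 1 2]]) simp
qed

lemma expands2_shift_back:
  assumes "expands2 f a b"
  shows "expands2 (\<lambda>n. f (n - s)) a b"
proof -
  have "filterlim (\<lambda>n. n - s) at_top sequentially" by (rule filterlim_minus_const_nat_at_top)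
  hence "(\<lambda>n. f (n - s) - a - b / real (n - s)) \<in> O(\<lambda>n. 1 / real (n - s) ^ 2)"
    using assms unfolding expands2_def by (rule landau_o.big.compose[rotated])
  hence 1: "(\<lambda>n. f (n - s) - a - b / real (n - s)) \<in> O(\<lambda>n. 1 / real n ^ 2)"
    using bigo_shift_square' by (rule landau_o.big_trans)
  have 2: "(\<lambda>n. b / real (n - s) - b / real n) \<in> O(\<lambda>n. 1 / real n ^ 2)"
  proof (rule bigoI[of _ "\<bar>2 * b * s\<bar>"], rule eventually_mono[OF eventually_gt_at_top[of "2 * s"]])
    fix n :: nat assume n: "n > 2 * s"
    have "b / real (n - s) - b / real n = (b * s) / (real n * real (n - s))"
      using n by (simp add: field_simps of_nat_diff)
    hence "norm (b / real (n - s) - b / real n) = \<bar>b * s\<bar> / (real n * real (n - s))"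
      using n by (simp add: abs_mult)
    also have "\<dots> \<le> \<bar>b * s\<bar> / (real n * (real n / 2))"
      using n by (intro divide_left_mono mult_left_mono) (auto simp: of_nat_diff)
    finally show "norm (b / real (n - s) - b / real n) \<le> \<bar>2 * b * s\<bar> * norm (1 / real n ^ 2)"
      by (simp add: power2_eq_square abs_mult mult_ac)
  qed
  show ?thesis by (rule expands2I[OF _ sum_in_bigo(1)[OF 1 2]]) simp
qed

lemma bigo_inverse_lim:
  fixes f :: "nat \<Rightarrow> real"
  assumes "f \<longlonglongrightarrow> a" "a \<noteq> 0"
  shows "(\<lambda>n. 1 / f n) \<in> O(\<lambda>_. 1)"
  using tendsto_divide[OF tendsto_const[of "1::real"] assms] by (intro bigoI_tendsto[where c = "1/a"]) auto

text \<open>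
  The error is divided by \<open>sqrt (f n) + sqrt a\<close>, which is bounded away from \<open>0\<close>.
\<close>

lemma expands2_sqrt:
  assumes f: "expands2 f a b" and a: "a > 0"
  shows "expands2 (\<lambda>n. sqrt (f n)) (sqrt a) (b / (2 * sqrt a))"
proof -
  have lim: "(\<lambda>n. sqrt (f n)) \<longlonglongrightarrow> sqrt a"
    using expands2_tendsto[OF f] by (rule tendsto_real_sqrt)
  have "(\<lambda>n. sqrt (f n) + sqrt a) \<longlonglongrightarrow> sqrt a + sqrt a"
    by (intro tendsto_intros lim)
  hence inv: "(\<lambda>n. 1 / (sqrt (f n) + sqrt a)) \<in> O(\<lambda>_. 1)"
    using a by (intro bigo_inverse_lim) auto
  have pos: "eventually (\<lambda>n. f n > 0) sequentially"
    using expands2_tendsto[OF f] a by (rule order_tendstoD)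
  have "(\<lambda>n. (f n - a) * (1 / (sqrt (f n) + sqrt a))) \<in> O(\<lambda>n. 1 / real n * 1)"
    by (intro landau_o.big.mult expands2_first_order[OF f] inv)
  moreover have "eventually (\<lambda>n. (f n - a) * (1 / (sqrt (f n) + sqrt a)) = sqrt (f n) - sqrt a) sequentially"
    using pos
  proof eventually_elim
    case (elim n)
    have "sqrt (f n) + sqrt a > 0" using elim a by (intro add_pos_pos) auto
    thus ?case using elim a by (simp add: field_simps)
  qed
  ultimately have d: "(\<lambda>n. sqrt (f n) - sqrt a) \<in> O(\<lambda>n. 1 / real n)"
    using landau_o.big.in_cong by fastforce
  have "(\<lambda>n. (sqrt (f n) - sqrt a) * (b / (2 * sqrt a) / real n)) \<in> O(\<lambda>n. 1 / real n * (1 / real n))"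
    by (intro landau_o.big.mult d bigo_inverse_nat_const)
  hence "(\<lambda>n. (f n - a - b / real n) - (sqrt (f n) - sqrt a) * (b / (2 * sqrt a) / real n)) \<in> O(\<lambda>n. 1 / real n ^ 2)"
    by (intro sum_in_bigo(2) f[unfolded expands2_def]) (simp add: power2_eq_square)
  hence "(\<lambda>n. ((f n - a - b / real n) - (sqrt (f n) - sqrt a) * (b / (2 * sqrt a) / real n)) * (1 / (sqrt (f n) + sqrt a)))
     \<in> O(\<lambda>n. 1 / real n ^ 2 * 1)"
    using inv by (rule landau_o.big.mult)
  moreover have "eventually (\<lambda>n. ((f n - a - b / real n) - (sqrt (f n) - sqrt a) * (b / (2 * sqrt a) / real n)) * (1 / (sqrt (f n) + sqrt a))
      = sqrt (f n) - sqrt a - b / (2 * sqrt a) / real n) sequentially"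
    using pos
  proof eventually_elim
    case (elim n)
    define s where "s = sqrt (f n)"
    define r where "r = sqrt a"
    have sr: "s > 0" "r > 0" "f n = s * s" "a = r * r" using elim a by (auto simp: s_def r_def)
    define c where "c = b / (2 * r) / real n"
    have bc: "b / real n = 2 * r * c" using sr(2) by (simp add: c_def)
    have "s + r \<noteq> 0" using sr by simp
    hence "(s * s - r * r - 2 * r * c - (s - r) * c) * (1 / (s + r)) = s - r - c"
      by (simp add: divide_simps) (simp add: algebra_simps)
    hence "(f n - a - b / real n - (s - r) * c) * (1 / (s + r)) = s - r - c"
      using sr(3,4) bc by simp
    thus ?case unfolding c_def s_def r_def .
  qed
  ultimately show ?thesis
    unfolding expands2_def using landau_o.big.in_cong by fastforce
qed

lemma expands2_inverse:
  assumes f: "expands2 f a b" and a: "a \<noteq> 0"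
  shows "expands2 (\<lambda>n. 1 / f n) (1 / a) (- b / a ^ 2)"
proof -
  have inv: "(\<lambda>n. 1 / f n) \<in> O(\<lambda>_. 1)"
    using expands2_tendsto[OF f] a by (rule bigo_inverse_lim)
  have nz: "eventually (\<lambda>n. f n \<noteq> 0) sequentially"
    using expands2_tendsto[OF f] a by (rule tendsto_imp_eventually_ne)
  have "(\<lambda>n. (f n - a) * (b / a / real n)) \<in> O(\<lambda>n. 1 / real n * (1 / real n))"
    by (intro landau_o.big.mult expands2_first_order[OF f] bigo_inverse_nat_const)
  hence "(\<lambda>n. (f n - a) * (b / a / real n) - (f n - a - b / real n)) \<in> O(\<lambda>n. 1 / real n ^ 2)"
    by (intro sum_in_bigo(2) f[unfolded expands2_def]) (simp add: power2_eq_square)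
  hence "(\<lambda>n. ((f n - a) * (b / a / real n) - (f n - a - b / real n)) * (1 / f n)) \<in> O(\<lambda>n. 1 / real n ^ 2 * 1)"
    using inv by (rule landau_o.big.mult)
  hence "(\<lambda>n. (1 / a) * (((f n - a) * (b / a / real n) - (f n - a - b / real n)) * (1 / f n))) \<in> O(\<lambda>n. 1 / real n ^ 2)"
    by (subst landau_o.big.cmult_in_iff) (use a in auto)
  moreover have "eventually (\<lambda>n. (1 / a) * (((f n - a) * (b / a / real n) - (f n - a - b / real n)) * (1 / f n))
      = 1 / f n - 1 / a - (- b / a ^ 2) / real n) sequentially"
    using nz
  proof eventually_elim
    case (elim n)
    show ?case
    proof (cases "n = 0")
      case False
      thus ?thesis using elim a by (simp add: field_simps power2_eq_square)
    next
      case True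
      thus ?thesis using elim a by (simp add: field_simps)
    qed
  qed
  ultimately show ?thesis
    unfolding expands2_def using landau_o.big.in_cong by fastforce
qed

lemma expands2_zero_bound:
  assumes "expands2 f 0 0"
  shows "\<exists>K. \<forall>n. \<bar>f n\<bar> \<le> K / (real n + 1) ^ 2"
proof -
  have "f \<in> O(\<lambda>n. 1 / real n ^ 2)" using assms by (simp add: expands2_def)
  then obtain c where c: "c > 0" "eventually (\<lambda>n. \<bar>f n\<bar> \<le> c / real n ^ 2) sequentially"
    by (elim landau_o.bigE) auto
  then obtain n0 where n0: "\<And>n. n \<ge> n0 \<Longrightarrow> \<bar>f n\<bar> \<le> c / real n ^ 2"
    by (auto simp: eventually_sequentially)
  define K where "K = 4 * c + (\<Sum>n\<le>n0. \<bar>f n\<bar> * (real n + 1) ^ 2)"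
  have "\<bar>f n\<bar> \<le> K / (real n + 1) ^ 2" for n
  proof (cases "n \<le> n0")
    case True
    have "\<bar>f n\<bar> * (real n + 1) ^ 2 \<le> (\<Sum>n\<le>n0. \<bar>f n\<bar> * (real n + 1) ^ 2)"
      by (rule member_le_sum) (use True in auto)
    also have "\<dots> \<le> K" using c by (simp add: K_def)
    finally show ?thesis by (simp add: field_simps)
  next
    case False
    have "(real n + 1) ^ 2 \<le> (2 * real n) ^ 2" using False by (intro power_mono) auto
    hence 1: "(real n + 1) ^ 2 \<le> 4 * real n ^ 2" by (simp add: power2_eq_square)
    have "\<bar>f n\<bar> \<le> c / real n ^ 2" using False by (intro n0) auto
    also have "\<dots> \<le> 4 * c / (real n + 1) ^ 2"
    proof -
      have "real n ^ 2 > 0" "(real n + 1) ^ 2 > 0" using False by auto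
      thus ?thesis using 1 c by (simp add: divide_simps)
    qed
    also have "\<dots> \<le> K / (real n + 1) ^ 2"
      by (intro divide_right_mono) (auto simp: K_def intro!: sum_nonneg)
    finally show ?thesis .
  qed
  thus ?thesis by blast
qed

text \<open>
  Expansions are closed under the field operations and square roots used by Gram-Schmidt, provided
  that one never divides by a sequence tending to \<open>0\<close>; positive definiteness of the limit of the
  Gram matrices guarantees this. The row \<open>t n j\<close> lists the coefficients of the \<open>j\<close>-th vector of
  the orthonormalised family.
\<close>

lemma gram_schmidt_expands2:
  fixes g :: "nat \<Rightarrow> nat \<Rightarrow> nat \<Rightarrow> real" and G B :: "nat \<Rightarrow> nat \<Rightarrow> real"
  assumes g: "\<And>i j. i < r \<Longrightarrow> j < r \<Longrightarrow> expands2 (\<lambda>n. g n i j) (G i j) (B i j)"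
    and sym: "\<And>n i j. g n i j = g n j i"
    and pos: "\<And>c. (\<exists>i<r. c i \<noteq> 0) \<Longrightarrow> (\<Sum>i<r. \<Sum>j<r. c i * c j * G i j) > 0"
  shows "\<exists>t t0 t1. (\<forall>j l. expands2 (\<lambda>n. t n j l) (t0 j l) (t1 j l)) \<and>
     (\<forall>\<^sub>F n in sequentially. \<forall>j<r. \<forall>k<r.
        (\<Sum>a<r. \<Sum>b<r. t n j a * t n k b * g n a b) = (if j = k then 1 else 0))"
proof -
  define Q where "Q = (\<lambda>n c c'. (\<Sum>a<r. \<Sum>b<r. c a * c' b * g n a b))"
  define Q0 where "Q0 = (\<lambda>c c'. (\<Sum>a<r. \<Sum>b<r. c a * c' b * G a b))"
  have Qsym: "Q n c c' = Q n c' c" for n c c'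
    unfolding Q_def by (subst sum.swap) (simp add: sym mult_ac)
  have Qsub: "Q n (\<lambda>a. c a - d a) c' = Q n c c' - Q n d c'" for n c d c'
    unfolding Q_def by (simp add: algebra_simps sum_subtractf)
  have Qadd: "Q n (\<lambda>a. c a + d a) c' = Q n c c' + Q n d c'" for n c d c'
    unfolding Q_def by (simp add: algebra_simps sum.distrib)
  have Qscale: "Q n (\<lambda>a. x * c a) c' = x * Q n c c'" for n x c c'
    unfolding Q_def by (simp add: algebra_simps sum_distrib_left)
  have Qsum: "Q n (\<lambda>a. \<Sum>j\<in>A. x j * c j a) c' = (\<Sum>j\<in>A. x j * Q n (c j) c')" for n x c c' and A :: "nat set"
  proof (induction A rule: infinite_finite_induct)
    case (insert i A)
    thus ?case by (simp add: Qadd Qscale)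
  qed (auto simp: Q_def)
  have Qex: "\<exists>q. expands2 (\<lambda>n. Q n (c n) (c' n)) (Q0 c0 c0') q"
    if "\<And>a. expands2 (\<lambda>n. c n a) (c0 a) (c1 a)" "\<And>a. expands2 (\<lambda>n. c' n a) (c0' a) (c1' a)" for c c' c0 c1 c0' c1'
  proof -
    have "expands2 (\<lambda>n. Q n (c n) (c' n)) (Q0 c0 c0') (\<Sum>a<r. \<Sum>b<r.
            c0 a * c0' b * B a b + (c0 a * c1' b + c1 a * c0' b) * G a b)"
      unfolding Q_def Q0_def by (intro expands2_sum expands2_mult that g) auto
    thus ?thesis by blast
  qed
  have "m \<le> r \<Longrightarrow> \<exists>t t0 t1. (\<forall>j l. expands2 (\<lambda>n. t n j l) (t0 j l) (t1 j l)) \<and> (\<forall>n j l. l > j \<longrightarrow> t n j l = 0) \<and>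
     (\<forall>\<^sub>F n in sequentially. \<forall>j<m. \<forall>k<m. Q n (t n j) (t n k) = (if j = k then 1 else 0))" for m
  proof (induction m)
    case 0
    show ?case by (rule exI[of _ "\<lambda>_ _ _. 0"], rule exI[of _ "\<lambda>_ _. 0"], rule exI[of _ "\<lambda>_ _. 0"]) auto
  next
    case (Suc m)
    then obtain t t0 t1 where t: "\<And>j l. expands2 (\<lambda>n. t n j l) (t0 j l) (t1 j l)"
      "\<And>n j l. l > j \<Longrightarrow> t n j l = 0"
      "\<forall>\<^sub>F n in sequentially. \<forall>j<m. \<forall>k<m. Q n (t n j) (t n k) = (if j = k then 1 else 0)"
      by auto
    define e where "e = (\<lambda>l::nat. if l = m then 1 else (0::real))"
    define y where "y = (\<lambda>n l. e l - (\<Sum>j<m. Q n e (t n j) * t n j l))"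
    have e: "expands2 (\<lambda>n. e a) (e a) 0" for a by simp
    have "\<forall>j. \<exists>q. expands2 (\<lambda>n. Q n e (t n j)) (Q0 e (t0 j)) q"
    proof
      fix j
      show "\<exists>q. expands2 (\<lambda>n. Q n e (t n j)) (Q0 e (t0 j)) q"
        by (rule Qex[where c' = "\<lambda>n. t n j", OF e t(1)])
    qed
    then obtain q where q: "\<And>j. expands2 (\<lambda>n. Q n e (t n j)) (Q0 e (t0 j)) (q j)" by metis
    define y0 where "y0 = (\<lambda>l. e l - (\<Sum>j<m. Q0 e (t0 j) * t0 j l))"
    define y1 where "y1 = (\<lambda>l. 0 - (\<Sum>j<m. Q0 e (t0 j) * t1 j l + q j * t0 j l))"
    have y: "expands2 (\<lambda>n. y n l) (y0 l) (y1 l)" for l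
      unfolding y_def y0_def y1_def by (intro expands2_diff expands2_sum expands2_mult q t(1) e)
    have ym: "y n m = 1" "l > m \<Longrightarrow> y n l = 0" for n l
      unfolding y_def e_def by (auto simp: t(2))
    (* y is the component of the m-th vector orthogonal to its predecessors. Its own coefficient
       stays 1 in the limit because the matrices t are triangular, so its norm does not tend to 0. *)
    have "y0 m = 1" using expands2_tendsto[OF y[of m]] by (simp add: ym LIMSEQ_const_iff)
    hence Qpos: "Q0 y0 y0 > 0" unfolding Q0_def using Suc.prems by (intro pos exI[of _ m]) auto
    obtain z where z: "expands2 (\<lambda>n. Q n (y n) (y n)) (Q0 y0 y0) z" 
      using Qex[where c = y and c' = y, OF y y] by blast
    define w where "w = (\<lambda>n. 1 / sqrt (Q n (y n) (y n)))"
    obtain w0 w1 where w: "expands2 w w0 w1"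
      using expands2_inverse[OF expands2_sqrt[OF z Qpos]] Qpos unfolding w_def by auto
    define T where "T = (\<lambda>n j l. if j = m then w n * y n l else t n j l)"
    define T0 where "T0 = (\<lambda>j l. if j = m then w0 * y0 l else t0 j l)"
    define T1 where "T1 = (\<lambda>j l. if j = m then w0 * y1 l + w1 * y0 l else t1 j l)"
    have "expands2 (\<lambda>n. T n j l) (T0 j l) (T1 j l)" for j l
      unfolding T_def T0_def T1_def using expands2_mult[OF w y[of l]] t(1)[of j l] by auto
    moreover have "T n j l = 0" if "l > j" for n j l
      using that ym t(2) unfolding T_def by auto
    moreover have "\<forall>\<^sub>F n in sequentially. \<forall>j<Suc m. \<forall>k<Suc m. Q n (T n j) (T n k) = (if j = k then 1 else 0)"
      using t(3) order_tendstoD(1)[OF expands2_tendsto[OF z] Qpos]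
    proof eventually_elim
      case (elim n)
      have orth: "Q n (y n) (t n k) = 0" if "k < m" for k
      proof -
        have "Q n (y n) (t n k) = Q n e (t n k) - (\<Sum>j<m. Q n e (t n j) * Q n (t n j) (t n k))"
          unfolding y_def Qsub Qsum ..
        also have "(\<Sum>j<m. Q n e (t n j) * Q n (t n j) (t n k)) = (\<Sum>j<m. if j = k then Q n e (t n k) else 0)"
          using elim(1) that by (intro sum.cong) auto
        also have "\<dots> = Q n e (t n k)" using that by simp
        finally show ?thesis by simp
      qed
      have "w n * w n * Q n (y n) (y n) = 1" using elim(2) by (simp add: w_def)
      hence mm: "Q n (\<lambda>l. w n * y n l) (\<lambda>l. w n * y n l) = 1"
        unfolding Qscale Qsym[of n "y n" "\<lambda>l. w n * y n l"] by (simp add: mult.assoc)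
      show ?case
      proof (intro allI impI)
        fix j k assume jk: "j < Suc m" "k < Suc m"
        consider "j < m" "k < m" | "j = m" "k < m" | "j < m" "k = m" | "j = m" "k = m"
          using jk by linarith
        thus "Q n (T n j) (T n k) = (if j = k then 1 else 0)"
        proof cases
          case 1 thus ?thesis using elim(1) by (simp add: T_def)
        next
          case 2 thus ?thesis using orth by (simp add: T_def Qscale)
        next
          case 3
          have "Q n (T n j) (T n k) = Q n (T n k) (T n j)" by (rule Qsym)
          thus ?thesis using 3 orth by (simp add: T_def Qscale)
        next
          case 4 thus ?thesis using mm by (simp add: T_def)
        qed
      qed
    qed
    ultimately show ?case by blast
  qed
  from this[OF order_refl] show ?thesis unfolding Q_def by blast
qed

section \<open>Sums of polynomials over multi-indices of fixed degree\<close>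

definition tdeg :: "('d::finite \<Rightarrow>\<^sub>0 nat) \<Rightarrow> nat" where
  "tdeg \<alpha> = (\<Sum>i\<in>UNIV. Poly_Mapping.lookup \<alpha> i)"

definition homog :: "nat \<Rightarrow> ('d::finite \<Rightarrow>\<^sub>0 nat) set" where
  "homog n = {\<alpha>. tdeg \<alpha> = n}"

lemma mem_homog [simp]: "\<alpha> \<in> homog n \<longleftrightarrow> tdeg \<alpha> = n"
  by (simp add: homog_def)

lemma tdeg_zero [simp]: "tdeg 0 = 0"
  by (simp add: tdeg_def)

lemma tdeg_add [simp]: "tdeg (\<alpha> + \<beta>) = tdeg \<alpha> + tdeg \<beta>"
  by (simp add: tdeg_def lookup_add sum.distrib)

lemma lookup_le_tdeg: "Poly_Mapping.lookup \<alpha> i \<le> tdeg \<alpha>"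
  unfolding tdeg_def by (rule member_le_sum) auto

lemma finite_homog [simp]: "finite (homog n :: ('d::finite \<Rightarrow>\<^sub>0 nat) set)"
proof -
  have "Poly_Mapping.lookup ` (homog n :: ('d \<Rightarrow>\<^sub>0 nat) set) \<subseteq> PiE UNIV (\<lambda>_. {..n})"
  proof (rule image_subsetI)
    fix \<alpha> :: "'d \<Rightarrow>\<^sub>0 nat" assume "\<alpha> \<in> homog n"
    hence "Poly_Mapping.lookup \<alpha> i \<le> n" for i using lookup_le_tdeg[of \<alpha> i] by simp
    thus "Poly_Mapping.lookup \<alpha> \<in> PiE UNIV (\<lambda>_. {..n})" by (simp add: PiE_UNIV_domain)
  qed
  moreover have "finite (PiE (UNIV :: 'd set) (\<lambda>_. {..n}))"
    by (intro finite_PiE) auto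
  ultimately have "finite (Poly_Mapping.lookup ` (homog n :: ('d \<Rightarrow>\<^sub>0 nat) set))"
    by (rule finite_subset)
  moreover have "inj_on Poly_Mapping.lookup (homog n :: ('d \<Rightarrow>\<^sub>0 nat) set)"
    by (intro inj_onI poly_mapping_eqI) (rule fun_cong)
  ultimately show ?thesis by (rule finite_imageD)
qed

lemma lookup_Abs_finite [simp]:
  "Poly_Mapping.lookup (Abs_poly_mapping (f :: 'd::finite \<Rightarrow> nat)) = f"
  by (rule lookup_Abs_poly_mapping) (rule finite_subset[OF subset_UNIV], simp)

lemma count_Abs_multiset_finite [simp]:
  "count (Abs_multiset (f :: 'd::finite \<Rightarrow> nat)) = f"
  by (rule count_Abs_multiset) (rule finite_subset[OF subset_UNIV], simp)

text \<open>
  The sum runs over all ways of writing \<open>n\<close> as an ordered sum, as does the coefficient of a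
  product of power series.
\<close>

lemma homog_sum_prod_eq_fps_nth:
  fixes f :: "'d::finite \<Rightarrow> nat \<Rightarrow> real"
  shows "(\<Sum>\<alpha>\<in>homog n. \<Prod>i\<in>UNIV. f i (Poly_Mapping.lookup \<alpha> i)) = fps_nth (\<Prod>i\<in>UNIV. Abs_fps (f i)) n"
proof -
  have size: "size X = (\<Sum>i\<in>UNIV. count X i)" for X :: "'d multiset"
    unfolding size_multiset_overloaded_eq
    by (rule sum.mono_neutral_left) (auto simp: not_in_iff)
  show ?thesis
    unfolding fps_prod_nth'[OF finite]
    by (rule sum.reindex_bij_witness[of _ "\<lambda>X. Abs_poly_mapping (count X)"
          "\<lambda>\<alpha>. Abs_multiset (Poly_Mapping.lookup \<alpha>)"])
       (auto simp: multisets_of_size_def size tdeg_def intro!: poly_mapping_eqI multiset_eqI)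
qed

definition geometric :: "real fps" where
  "geometric = Abs_fps (\<lambda>_. 1)"

lemma fps_nth_geometric_power: "fps_nth (geometric ^ Suc j) n = of_nat ((n + j) choose j)"
proof (induction j arbitrary: n)
  case 0
  show ?case by (simp add: geometric_def)
next
  case (Suc j)
  have "fps_nth (geometric ^ Suc (Suc j)) n = (\<Sum>i=0..n. fps_nth (geometric ^ Suc j) i * fps_nth geometric (n - i))"
    by (subst power_Suc2) (simp only: fps_mult_nth)
  also have "\<dots> = of_nat (\<Sum>i\<le>n. (j + i) choose i)"
  proof -
    have "(i + j) choose j = (j + i) choose i" for i
      using binomial_symmetric[of j "i + j"] by (simp add: add.commute)
    thus ?thesis unfolding Suc by (simp add: geometric_def atLeast0AtMost)
  qed
  also have "(\<Sum>i\<le>n. (j + i) choose i) = (Suc (j + n)) choose n"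
    by (rule sum_choose_lower)
  also have "\<dots> = (n + Suc j) choose Suc j"
    by (subst binomial_symmetric) (auto simp: add_ac)
  finally show ?case .
qed

text \<open>
  The coefficients of \<open>geometric ^ Suc j\<close> are \<open>(n + j) choose j\<close>; hence \<open>geometric_span m\<close> holds of
  the generating functions of the polynomial sequences of degree less than \<open>m\<close>, written in a basis
  in which convolution is addition of exponents.
\<close>

inductive geometric_span :: "nat \<Rightarrow> real fps \<Rightarrow> bool" for m where
  zero: "geometric_span m 0"
| add: "geometric_span m F \<Longrightarrow> j < m \<Longrightarrow> geometric_span m (fps_const c * geometric ^ Suc j + F)"

lemma geometric_span_single: "j < m \<Longrightarrow> geometric_span m (fps_const c * geometric ^ Suc j)"
  using geometric_span.add[OF geometric_span.zero, of j m c] by simp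

lemma geometric_span_add: "geometric_span m F \<Longrightarrow> geometric_span m F' \<Longrightarrow> geometric_span m (F + F')"
  by (induction rule: geometric_span.induct) (auto simp: add.assoc simp del: power_Suc intro: geometric_span.add)

lemma geometric_span_mono: "geometric_span m F \<Longrightarrow> m \<le> m' \<Longrightarrow> geometric_span m' F"
  by (induction rule: geometric_span.induct) (auto simp del: power_Suc intro: geometric_span.intros)

lemma geometric_span_mult_single:
  "geometric_span m F \<Longrightarrow> geometric_span (m + Suc k) (fps_const c * geometric ^ Suc k * F)"
proof (induction rule: geometric_span.induct)
  case (add F j c')
  have "fps_const c * geometric ^ Suc k * (fps_const c' * geometric ^ Suc j + F)
      = fps_const (c * c') * geometric ^ Suc (Suc (k + j)) + fps_const c * geometric ^ Suc k * F"
    by (simp add: algebra_simps power_add flip: fps_const_mult)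
  thus ?case using add by (simp del: power_Suc add: geometric_span.add)
qed (simp add: geometric_span.zero)

lemma geometric_span_mult: "geometric_span m F \<Longrightarrow> geometric_span m' F' \<Longrightarrow> geometric_span (m + m') (F * F')"
proof (induction rule: geometric_span.induct)
  case (add F j c)
  have "geometric_span (m + m') (fps_const c * geometric ^ Suc j * F')"
    using geometric_span_mult_single[OF add.prems, of j c] by (rule geometric_span_mono) (use add in auto)
  thus ?case using add by (simp del: power_Suc add: distrib_right geometric_span_add)
qed (simp add: geometric_span.zero)

text \<open>
  Generating functions of polynomial sequences of degree at most \<open>m\<close> with leading coefficient
  \<open>a / m!\<close>.
\<close>

definition polyseq :: "nat \<Rightarrow> real \<Rightarrow> real fps \<Rightarrow> bool" where
  "polyseq m a F \<longleftrightarrow> (\<exists>R. geometric_span m R \<and> F = fps_const a * geometric ^ Suc m + R)"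

lemma polyseq_mult:
  assumes "polyseq m a F" "polyseq m' a' F'"
  shows "polyseq (m + m' + 1) (a * a') (F * F')"
proof -
  obtain R R' where R: "geometric_span m R" "F = fps_const a * geometric ^ Suc m + R"
      "geometric_span m' R'" "F' = fps_const a' * geometric ^ Suc m' + R'"
    using assms unfolding polyseq_def by blast
  have "F * F' = fps_const (a * a') * geometric ^ Suc (m + m' + 1) +
      (fps_const a * geometric ^ Suc m * R' + (fps_const a' * geometric ^ Suc m' * R + R * R'))"
    unfolding R by (simp add: algebra_simps power_add flip: fps_const_mult)
  moreover have "geometric_span (m + m' + 1) (fps_const a * geometric ^ Suc m * R')"
    using geometric_span_mult_single[OF R(3), of m a] by (simp del: power_Suc add: add_ac)
  moreover have "geometric_span (m + m' + 1) (fps_const a' * geometric ^ Suc m' * R)"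
    using geometric_span_mult_single[OF R(1), of m' a'] by (simp del: power_Suc add: add_ac)
  moreover have "geometric_span (m + m' + 1) (R * R')"
    using geometric_span_mult[OF R(1,3)] by (rule geometric_span_mono) auto
  ultimately show ?thesis unfolding polyseq_def by (blast intro: geometric_span_add)
qed

lemma polyseq_prod:
  assumes "finite A" "A \<noteq> {}" "\<And>i. i \<in> A \<Longrightarrow> polyseq (m i) (a i) (F i)"
  shows "polyseq ((\<Sum>i\<in>A. m i) + (card A - 1)) (\<Prod>i\<in>A. a i) (\<Prod>i\<in>A. F i)"
  using assms
proof (induction A rule: finite_ne_induct)
  case (insert i A)
  have eq: "m i + ((\<Sum>i\<in>A. m i) + (card A - 1)) + 1 = (\<Sum>i\<in>insert i A. m i) + (card (insert i A) - 1)"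
    using insert(1-3) by (cases "card A") auto
  have "polyseq (m i + ((\<Sum>i\<in>A. m i) + (card A - 1)) + 1) (a i * (\<Prod>i\<in>A. a i)) (F i * (\<Prod>i\<in>A. F i))"
    by (intro polyseq_mult insert) auto
  thus ?case unfolding eq using insert(1,3) by (simp only: prod.insert not_False_eq_True)
qed auto

definition index_mult :: "nat \<Rightarrow> real fps \<Rightarrow> real fps" where
  "index_mult b F = Abs_fps (\<lambda>n. real (n + b) * fps_nth F n)"

text \<open>
  This is \<open>(n + j + 1) * ((n + j) choose j) = (j + 1) * ((n + j + 1) choose (j + 1))\<close>.
\<close>

lemma index_mult_geometric_power:
  "index_mult b (fps_const c * geometric ^ Suc j) =
     fps_const (c * real (j + 1)) * geometric ^ Suc (Suc j) + fps_const (c * (real b - real (j + 1))) * geometric ^ Suc j"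
proof (rule fps_ext)
  fix n
  have "real (Suc (n + j)) * real ((n + j) choose j) = real (Suc (n + j) choose Suc j) * real (Suc j)"
    using Suc_times_binomial_eq[of "n + j" j] by (metis of_nat_mult)
  hence "real (Suc (n + j) choose Suc j) * (1 + real j) = (1 + real n + real j) * real ((n + j) choose j)"
    by (simp add: algebra_simps)
  hence *: "(1 + real j) * (c * real (Suc (n + j) choose Suc j)) = c * (1 + real n + real j) * real ((n + j) choose j)"
  proof -
    assume h: "real (Suc (n + j) choose Suc j) * (1 + real j) = (1 + real n + real j) * real ((n + j) choose j)"
    have "(1 + real j) * (c * real (Suc (n + j) choose Suc j)) = c * (real (Suc (n + j) choose Suc j) * (1 + real j))"
      by (simp only: mult_ac)
    thus ?thesis unfolding h by (simp only: mult_ac)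
  qed
  show "fps_nth (index_mult b (fps_const c * geometric ^ Suc j)) n = fps_nth
     (fps_const (c * real (j + 1)) * geometric ^ Suc (Suc j) + fps_const (c * (real b - real (j + 1))) * geometric ^ Suc j) n"
    unfolding index_mult_def fps_add_nth fps_nth_Abs_fps fps_mult_left_const_nth fps_nth_geometric_power
    using * by (simp add: algebra_simps del: binomial_Suc_Suc)
qed

lemma index_mult_add: "index_mult b (F + F') = index_mult b F + index_mult b F'"
  by (rule fps_ext) (simp add: index_mult_def algebra_simps)

lemma geometric_span_index_mult: "geometric_span m F \<Longrightarrow> geometric_span (Suc m) (index_mult b F)"
proof (induction rule: geometric_span.induct)
  case zero
  have "index_mult b 0 = 0" by (rule fps_ext) (simp add: index_mult_def)
  thus ?case by (simp add: geometric_span.zero)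
next
  case (add F j c)
  thus ?case unfolding index_mult_add index_mult_geometric_power
    by (intro geometric_span_add geometric_span_single) auto
qed

lemma polyseq_index_mult:
  assumes "polyseq m a F"
  shows "polyseq (Suc m) (a * real (Suc m)) (index_mult b F)"
proof -
  obtain R where R: "geometric_span m R" "F = fps_const a * geometric ^ Suc m + R"
    using assms unfolding polyseq_def by blast
  have "index_mult b F = fps_const (a * real (Suc m)) * geometric ^ Suc (Suc m) +
      (fps_const (a * (real b - real (m + 1))) * geometric ^ Suc m + index_mult b R)"
    unfolding R index_mult_add index_mult_geometric_power by (simp del: power_Suc add: add.assoc)
  thus ?thesis unfolding polyseq_def
    using geometric_span_add[OF geometric_span_single geometric_span_index_mult[OF R(1)]] by blast
qed

lemma polyseq_power_mult:
  "polyseq (k + l) (fact (k + l)) (Abs_fps (\<lambda>n. real (n + b) ^ k * real n ^ l))"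
proof (induction k)
  case 0
  show ?case
  proof (induction l)
    case 0
    have "polyseq 0 1 geometric" unfolding polyseq_def by (auto intro: geometric_span.zero)
    thus ?case by (simp add: geometric_def)
  next
    case (Suc l)
    have "index_mult 0 (Abs_fps (\<lambda>n. real (n + b) ^ 0 * real n ^ l)) = Abs_fps (\<lambda>n. real (n + b) ^ 0 * real n ^ Suc l)"
      by (rule fps_ext) (simp add: index_mult_def)
    thus ?case using polyseq_index_mult[OF Suc, of 0] by (simp add: mult.commute)
  qed
next
  case (Suc k)
  have "index_mult b (Abs_fps (\<lambda>n. real (n + b) ^ k * real n ^ l)) = Abs_fps (\<lambda>n. real (n + b) ^ Suc k * real n ^ l)"
    by (rule fps_ext) (simp add: index_mult_def)
  thus ?case using polyseq_index_mult[OF Suc, of b] by (simp add: mult.commute)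
qed

lemma expands2_binomial_scaled: "\<exists>b. expands2 (\<lambda>n. real ((n + j) choose j) / real n ^ j) (1 / fact j) b"
proof (induction j)
  case 0
  show ?case by (rule exI[of _ 0]) simp
next
  case (Suc j)
  then obtain b where b: "expands2 (\<lambda>n. real ((n + j) choose j) / real n ^ j) (1 / fact j) b" by blast
  have "expands2 (\<lambda>n. 1 / real (Suc j) * (1 + real (Suc j) * (1 / real n))) (1 / real (Suc j) * (1 + real (Suc j) * 0))
     (1 / real (Suc j) * (0 + real (Suc j) * 1))"
    by (intro expands2_cmult expands2_add expands2_const expands2_inverse_nat)
  from expands2_mult[OF b this] obtain b' where b': "expands2 (\<lambda>n. real ((n + j) choose j) / real n ^ j *
     (1 / real (Suc j) * (1 + real (Suc j) * (1 / real n)))) (1 / fact (Suc j)) b'"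
    by (auto simp: mult.commute)
  show ?case
  proof (rule exI, rule expands2_cong[OF _ b'], rule eventually_mono[OF eventually_gt_at_top[of 0]])
    fix n :: nat assume n: "n > 0"
    have "real (Suc (n + j)) * real ((n + j) choose j) = real (Suc (n + j) choose Suc j) * real (Suc j)"
      using Suc_times_binomial_eq[of "n + j" j] by (metis of_nat_mult)
    hence *: "real ((n + Suc j) choose Suc j) = (real n + real (Suc j)) * real ((n + j) choose j) / real (Suc j)"
      by (simp add: field_simps del: binomial_Suc_Suc)
    have "Y / y * (1 / s * (1 + s * (1 / x))) = ((x + s) * Y / s) / (x * y)"
      if "x \<noteq> 0" "s \<noteq> 0" "y \<noteq> 0" for Y s x y :: real
      using that by (simp add: field_simps)
    from this[of "real n" "real (Suc j)" "real n ^ j"] n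
    show "real ((n + j) choose j) / real n ^ j * (1 / real (Suc j) * (1 + real (Suc j) * (1 / real n)))
       = real ((n + Suc j) choose Suc j) / real n ^ Suc j"
      unfolding * by simp
  qed
qed

lemma geometric_span_expands2:
  "geometric_span m F \<Longrightarrow> \<exists>b. expands2 (\<lambda>n. fps_nth F n / real n ^ m) 0 b"
proof (induction rule: geometric_span.induct)
  case zero
  show ?case by (rule exI[of _ 0]) simp
next
  case (add F j c)
  from add obtain b where b: "expands2 (\<lambda>n. fps_nth F n / real n ^ m) 0 b" by blast
  obtain b1 where b1: "expands2 (\<lambda>n. real ((n + j) choose j) / real n ^ j) (1 / fact j) b1"
    using expands2_binomial_scaled by blast
  obtain k where k: "m = j + Suc k" using add(2) less_iff_Suc_add by auto
  obtain b2 where b2: "expands2 (\<lambda>n. (1 / real n) ^ Suc k) (0 ^ Suc k) b2" using expands2_power[OF expands2_inverse_nat] by blast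
  have "expands2 (\<lambda>n. c * (real ((n + j) choose j) / real n ^ j * (1 / real n) ^ Suc k) + fps_nth F n / real n ^ m)
     (c * (1 / fact j * 0 ^ Suc k) + 0) (c * (1 / fact j * b2 + b1 * 0 ^ Suc k) + b)"
    by (intro expands2_add expands2_cmult expands2_mult b b1 b2)
  moreover have "(\<lambda>n. c * (real ((n + j) choose j) / real n ^ j * (1 / real n) ^ Suc k) + fps_nth F n / real n ^ m)
    = (\<lambda>n. fps_nth (fps_const c * geometric ^ Suc j + F) n / real n ^ m)"
    unfolding fps_add_nth fps_mult_left_const_nth fps_nth_geometric_power k
    by (simp add: add_divide_distrib power_add power_divide mult_ac)
  ultimately show ?case by auto
qed

text \<open>
  The leading term of \<open>(n + j) choose j\<close> is \<open>n ^ j / j!\<close>, and a polynomial in \<open>n\<close> of degree \<open>m\<close>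
  divided by \<open>n ^ m\<close> is a polynomial in \<open>1 / n\<close>.
\<close>

lemma polyseq_expands2:
  assumes "polyseq m a F"
  shows "\<exists>b. expands2 (\<lambda>n. fps_nth F n / real n ^ m) (a / fact m) b"
proof -
  obtain R where R: "geometric_span m R" "F = fps_const a * geometric ^ Suc m + R"
    using assms unfolding polyseq_def by blast
  obtain b1 where b1: "expands2 (\<lambda>n. real ((n + m) choose m) / real n ^ m) (1 / fact m) b1"
    using expands2_binomial_scaled by blast
  obtain b2 where b2: "expands2 (\<lambda>n. fps_nth R n / real n ^ m) 0 b2" using geometric_span_expands2[OF R(1)] by blast
  have "expands2 (\<lambda>n. a * (real ((n + m) choose m) / real n ^ m) + fps_nth R n / real n ^ m)
     (a * (1 / fact m) + 0) (a * b1 + b2)"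
    by (intro expands2_add expands2_cmult b1 b2)
  moreover have "(\<lambda>n. a * (real ((n + m) choose m) / real n ^ m) + fps_nth R n / real n ^ m)
    = (\<lambda>n. fps_nth F n / real n ^ m)"
    unfolding R(2) fps_add_nth fps_mult_left_const_nth fps_nth_geometric_power
    by (simp add: add_divide_distrib)
  ultimately show ?thesis by auto
qed

definition monom_val :: "('d::finite \<Rightarrow>\<^sub>0 nat) \<Rightarrow> ('d \<Rightarrow>\<^sub>0 nat) \<Rightarrow> real" where
  "monom_val k \<alpha> = (\<Prod>i\<in>UNIV. real (Poly_Mapping.lookup \<alpha> i) ^ Poly_Mapping.lookup k i)"

text \<open>
  In each coordinate \<open>(n + \<beta>\<^sub>i) ^ k\<^sub>i * n ^ l\<^sub>i\<close> is a polynomial sequence with leading coefficient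
  \<open>1\<close>, that is, of type \<open>k\<^sub>i + l\<^sub>i\<close> and \<open>(k\<^sub>i + l\<^sub>i)!\<close> in the sense of \<open>polyseq\<close>. The limit is
  Dirichlet's integral of the monomial with exponent \<open>k + l\<close> over the simplex.
\<close>

lemma homog_sum_monom_val_expands2:
  fixes \<beta> k l :: "'d::finite \<Rightarrow>\<^sub>0 nat"
  defines "M \<equiv> tdeg k + tdeg l + (CARD('d) - 1)"
  shows "\<exists>b. expands2 (\<lambda>n. (\<Sum>\<alpha>\<in>homog n. monom_val k (\<alpha> + \<beta>) * monom_val l \<alpha>) / real n ^ M)
     ((\<Prod>i\<in>UNIV. fact (Poly_Mapping.lookup k i + Poly_Mapping.lookup l i)) / fact M) b"
proof -
  let ?L = Poly_Mapping.lookup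
  have eq: "(\<Sum>\<alpha>\<in>homog n. monom_val k (\<alpha> + \<beta>) * monom_val l \<alpha>) =
     fps_nth (\<Prod>i\<in>UNIV. Abs_fps (\<lambda>n. real (n + ?L \<beta> i) ^ ?L k i * real n ^ ?L l i)) n" for n
    unfolding homog_sum_prod_eq_fps_nth[symmetric] monom_val_def by (simp add: prod.distrib lookup_add)
  have "polyseq ((\<Sum>i\<in>UNIV. ?L k i + ?L l i) + (CARD('d) - 1)) (\<Prod>i\<in>UNIV. fact (?L k i + ?L l i))
     (\<Prod>i\<in>UNIV. Abs_fps (\<lambda>n. real (n + ?L \<beta> i) ^ ?L k i * real n ^ ?L l i))"
    by (intro polyseq_prod polyseq_power_mult) auto
  moreover have "(\<Sum>i\<in>UNIV. ?L k i + ?L l i) + (CARD('d) - 1) = M"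
    by (simp add: M_def tdeg_def sum.distrib)
  ultimately have "polyseq M (\<Prod>i\<in>UNIV. fact (?L k i + ?L l i))
     (\<Prod>i\<in>UNIV. Abs_fps (\<lambda>n. real (n + ?L \<beta> i) ^ ?L k i * real n ^ ?L l i))"
    by (simp only:)
  thus ?thesis unfolding eq by (rule polyseq_expands2)
qed

lemma card_homog: "card (homog n :: ('d::finite \<Rightarrow>\<^sub>0 nat) set) = (n + (CARD('d) - 1)) choose (CARD('d) - 1)"
proof -
  have "real (card (homog n :: ('d \<Rightarrow>\<^sub>0 nat) set)) = (\<Sum>\<alpha>\<in>(homog n :: ('d \<Rightarrow>\<^sub>0 nat) set). \<Prod>i\<in>(UNIV::'d set). 1)"
    by simp
  also have "\<dots> = fps_nth (geometric ^ CARD('d)) n"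
    by (subst homog_sum_prod_eq_fps_nth) (simp add: geometric_def)
  also have "CARD('d) = Suc (CARD('d) - 1)" using zero_less_card_finite[where 'a = 'd] by linarith
  finally show ?thesis unfolding fps_nth_geometric_power by (simp only: of_nat_eq_iff)
qed

text \<open>
  Vandermonde's identity, arranged so that the Gram matrix \<open>(k + l)!\<close> of the monomials with respect
  to the weight \<open>exp (- x)\<close> is visibly a product of a triangular matrix and its transpose.
\<close>

lemma fact_add_eq_sum_choose:
  "(fact (k + l) :: real) = (\<Sum>j\<le>k. (fact k * real (k choose j)) * (fact l * real (l choose j)))"
proof -
  have "real ((k + l) choose k) = (\<Sum>j\<le>k. real (k choose j) * real (l choose (k - j)))"
    unfolding vandermonde[symmetric] by simp
  also have "\<dots> = (\<Sum>j\<le>k. real (k choose (k - j)) * real (l choose (k - (k - j))))"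
    by (rule sum.reindex_bij_witness[of _ "\<lambda>j. k - j" "\<lambda>j. k - j"]) auto
  also have "\<dots> = (\<Sum>j\<le>k. real (k choose j) * real (l choose j))"
  proof (intro sum.cong refl)
    fix j assume "j \<in> {..k}"
    thus "real (k choose (k - j)) * real (l choose (k - (k - j))) = real (k choose j) * real (l choose j)"
      using binomial_symmetric[of j k] by simp
  qed
  finally have "real ((k + l) choose k) = (\<Sum>j\<le>k. real (k choose j) * real (l choose j))" .
  moreover have "(fact (k + l) :: real) = fact k * fact l * real ((k + l) choose k)"
  proof -
    have "fact k * fact l * ((k + l) choose k) = (fact (k + l) :: nat)"
      using binomial_fact_lemma[of k "k + l"] by simp
    hence "real (fact k * fact l * ((k + l) choose k)) = real (fact (k + l))" by simp
    thus ?thesis by simp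
  qed
  ultimately show ?thesis by (simp add: sum_distrib_left algebra_simps)
qed

text \<open>
  By \<open>fact_add_eq_sum_choose\<close> the quadratic form is a sum of squares indexed by \<open>j\<close>. For
  multi-indices \<open>k\<close>, \<open>j\<close> of the same degree, \<open>k choose j\<close> vanishes unless \<open>k = j\<close>, so the square
  for \<open>j = k\<close> isolates the coefficient \<open>c k\<close>. It is here that homogeneous polynomials are more
  convenient than polynomials of bounded degree in \<open>d - 1\<close> variables.
\<close>

lemma gram_limit_positive_definite:
  fixes c :: "('d::finite \<Rightarrow>\<^sub>0 nat) \<Rightarrow> real"
  assumes "\<exists>k\<in>homog m. c k \<noteq> 0"
  shows "(\<Sum>k\<in>homog m. \<Sum>l\<in>homog m. c k * c l *
     (\<Prod>i\<in>UNIV. fact (Poly_Mapping.lookup k i + Poly_Mapping.lookup l i))) > 0"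
proof -
  let ?L = Poly_Mapping.lookup
  define B where "B = (\<lambda>(k :: 'd \<Rightarrow>\<^sub>0 nat) (j :: 'd \<Rightarrow> nat). \<Prod>i\<in>UNIV. fact (?L k i) * real (?L k i choose j i))"
  define P where "P = PiE (UNIV :: 'd set) (\<lambda>_. {..m})"
  have fin: "finite P" unfolding P_def by (intro finite_PiE) auto
  have fact_eq: "(\<Prod>i\<in>UNIV. fact (?L k i + ?L l i)) = (\<Sum>j\<in>P. B k j * B l j)" if "tdeg k = m" for k l
  proof -
    have "(\<Prod>i\<in>UNIV. fact (?L k i + ?L l i)) = 
       (\<Prod>i\<in>UNIV. \<Sum>j\<le>m. (fact (?L k i) * real (?L k i choose j)) * (fact (?L l i) * real (?L l i choose j)))"
    proof (rule prod.cong)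
      fix i
      show "fact (?L k i + ?L l i) = (\<Sum>j\<le>m. (fact (?L k i) * real (?L k i choose j)) * (fact (?L l i) * real (?L l i choose j)))"
        unfolding fact_add_eq_sum_choose
        by (rule sum.mono_neutral_left) (use lookup_le_tdeg[of k i] that in auto)
    qed auto
    also have "\<dots> = (\<Sum>j\<in>P. B k j * B l j)"
      unfolding P_def B_def prod.distrib[symmetric] by (rule prod_sum_PiE) auto
    finally show ?thesis .
  qed
  have "(\<Sum>k\<in>homog m. \<Sum>l\<in>homog m. c k * c l * (\<Prod>i\<in>UNIV. fact (?L k i + ?L l i)))
     = (\<Sum>k\<in>homog m. \<Sum>l\<in>homog m. \<Sum>j\<in>P. (c k * B k j) * (c l * B l j))"
  proof (intro sum.cong refl)
    fix k l :: "'d \<Rightarrow>\<^sub>0 nat" assume "k \<in> homog m"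
    hence "tdeg k = m" by simp
    thus "c k * c l * (\<Prod>i\<in>UNIV. fact (?L k i + ?L l i)) = (\<Sum>j\<in>P. (c k * B k j) * (c l * B l j))"
      unfolding fact_eq[OF \<open>tdeg k = m\<close>] sum_distrib_left by (intro sum.cong refl) (simp only: mult_ac)
  qed
  also have "\<dots> = (\<Sum>k\<in>homog m. \<Sum>j\<in>P. \<Sum>l\<in>homog m. (c k * B k j) * (c l * B l j))"
    by (intro sum.cong refl sum.swap)
  also have "\<dots> = (\<Sum>j\<in>P. \<Sum>k\<in>homog m. \<Sum>l\<in>homog m. (c k * B k j) * (c l * B l j))"
    by (rule sum.swap)
  also have "\<dots> = (\<Sum>j\<in>P. (\<Sum>k\<in>homog m. c k * B k j)\<^sup>2)"
    by (simp only: power2_eq_square sum_product)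
  finally have eq: "(\<Sum>k\<in>homog m. \<Sum>l\<in>homog m. c k * c l * (\<Prod>i\<in>UNIV. fact (?L k i + ?L l i)))
     = (\<Sum>j\<in>P. (\<Sum>k\<in>homog m. c k * B k j)\<^sup>2)" .
  obtain k0 where k0: "tdeg k0 = m" "c k0 \<noteq> 0" using assms by auto
  have zero: "B k (?L k0) = 0" if k: "tdeg k = m" "k \<noteq> k0" for k
  proof -
    have "\<exists>i. ?L k i < ?L k0 i"
    proof (rule ccontr)
      assume "\<not> ?thesis"
      hence le: "?L k0 i \<le> ?L k i" for i by (meson not_le)
      have eq: "(\<Sum>i\<in>UNIV. ?L k0 i) = (\<Sum>i\<in>UNIV. ?L k i)" using k0(1) k(1) by (simp add: tdeg_def)
      have "?L k0 i = ?L k i" for i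
        using sum_mono_inv[OF eq le UNIV_I] by simp
      hence "k = k0" by (intro poly_mapping_eqI) simp
      thus False using k(2) by simp
    qed
    then obtain i where i: "?L k i < ?L k0 i" by blast
    show ?thesis unfolding B_def
    proof (rule prod_zero)
      show "\<exists>i\<in>UNIV. fact (?L k i) * real (?L k i choose ?L k0 i) = 0"
        using i by (intro bexI[of _ i]) simp_all
    qed simp
  qed
  have "(\<Sum>k\<in>homog m. c k * B k (?L k0)) = (\<Sum>k\<in>homog m. if k = k0 then c k0 * B k0 (?L k0) else 0)"
  proof (intro sum.cong refl)
    fix k :: "'d \<Rightarrow>\<^sub>0 nat" assume "k \<in> homog m"
    thus "c k * B k (?L k0) = (if k = k0 then c k0 * B k0 (?L k0) else 0)"
      using zero[of k] by (cases "k = k0") simp_all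
  qed
  also have "\<dots> = c k0 * B k0 (?L k0)" using k0(1) by (subst sum.delta) simp_all
  finally have "(\<Sum>k\<in>homog m. c k * B k (?L k0)) = c k0 * B k0 (?L k0)" .
  moreover have "B k0 (?L k0) \<noteq> 0" unfolding B_def by simp
  ultimately have "(\<Sum>k\<in>homog m. c k * B k (?L k0))\<^sup>2 > 0" using k0 by simp
  moreover have k0P: "?L k0 \<in> P" unfolding P_def using lookup_le_tdeg[of k0] k0(1) by (simp add: PiE_UNIV_domain)
  ultimately show ?thesis unfolding eq
    by (intro sum_pos2[OF fin k0P]) simp_all
qed

section \<open>The powers of the diagonal ideal\<close>

text \<open>
  The bilinear pairing of families with polynomials. Evaluation at a point, extraction of
  homogeneous parts and inner products in the Hardy space are all special cases.
\<close>

definition pairing :: "('a \<Rightarrow> complex) \<Rightarrow> ('a \<Rightarrow>\<^sub>0 complex) \<Rightarrow> complex" where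
  "pairing h p = (\<Sum>\<alpha>\<in>Poly_Mapping.keys p. Poly_Mapping.lookup p \<alpha> * h \<alpha>)"

lemma pairing_superset:
  assumes "finite A" "Poly_Mapping.keys p \<subseteq> A"
  shows "pairing h p = (\<Sum>\<alpha>\<in>A. Poly_Mapping.lookup p \<alpha> * h \<alpha>)"
  unfolding pairing_def by (rule sum.mono_neutral_left) (use assms in \<open>auto simp: in_keys_iff\<close>)

lemma pairing_add: "pairing h (p + q) = pairing h p + pairing h q"
proof -
  let ?A = "Poly_Mapping.keys p \<union> Poly_Mapping.keys q"
  have "pairing h (p + q) = (\<Sum>\<alpha>\<in>?A. Poly_Mapping.lookup (p + q) \<alpha> * h \<alpha>)"
    by (rule pairing_superset) (auto simp: keys_add)
  also have "\<dots> = pairing h p + pairing h q"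
    by (subst (1 2) pairing_superset[of ?A]) (auto simp: lookup_add algebra_simps sum.distrib)
  finally show ?thesis .
qed

lemma pairing_zero [simp]: "pairing h 0 = 0"
  by (simp add: pairing_def)

lemma pairing_sum: "pairing h (\<Sum>x\<in>A. p x) = (\<Sum>x\<in>A. pairing h (p x))"
  by (induction A rule: infinite_finite_induct) (auto simp: pairing_add)

lemma pairing_single [simp]: "pairing h (Poly_Mapping.single \<alpha> c) = c * h \<alpha>"
  by (simp add: pairing_def)

lemma pairing_fun_add: "pairing (\<lambda>\<alpha>. h \<alpha> + h' \<alpha>) p = pairing h p + pairing h' p"
  by (simp add: pairing_def algebra_simps sum.distrib)

lemma pairing_fun_scale: "pairing (\<lambda>\<alpha>. c * h \<alpha>) p = c * pairing h p"
  by (simp add: pairing_def sum_distrib_left mult_ac)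

lemma pairing_fun_sum: "pairing (\<lambda>\<alpha>. \<Sum>x\<in>A. h x \<alpha>) p = (\<Sum>x\<in>A. pairing (h x) p)"
  by (induction A rule: infinite_finite_induct) (auto simp: pairing_fun_add, auto simp: pairing_def)

lemma pairing_ext:
  fixes p q :: "'a \<Rightarrow>\<^sub>0 complex"
  assumes "\<And>h. pairing h p = pairing h q"
  shows "p = q"
proof (rule poly_mapping_eqI)
  fix \<alpha> :: 'a
  have ind: "pairing (\<lambda>\<beta>. if \<beta> = \<alpha> then 1 else 0) p = Poly_Mapping.lookup p \<alpha>" for p :: "'a \<Rightarrow>\<^sub>0 complex"
  proof -
    have "pairing (\<lambda>\<beta>. if \<beta> = \<alpha> then 1 else 0) p =
        (\<Sum>\<beta>\<in>insert \<alpha> (Poly_Mapping.keys p). Poly_Mapping.lookup p \<beta> * (if \<beta> = \<alpha> then 1 else 0))"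
      by (rule pairing_superset) auto
    also have "\<dots> = (\<Sum>\<beta>\<in>insert \<alpha> (Poly_Mapping.keys p). if \<beta> = \<alpha> then Poly_Mapping.lookup p \<alpha> else 0)"
      by (intro sum.cong) auto
    finally show ?thesis by (simp add: sum.delta)
  qed
  show "Poly_Mapping.lookup p \<alpha> = Poly_Mapping.lookup q \<alpha>" using assms ind by metis
qed

lemma sum_single_keys: "(\<Sum>\<alpha>\<in>Poly_Mapping.keys p. Poly_Mapping.single \<alpha> (Poly_Mapping.lookup p \<alpha>)) = p"
  for p :: "'a \<Rightarrow>\<^sub>0 complex"
  by (rule pairing_ext) (simp add: pairing_sum pairing_def[of _ p])

lemma pairing_mult:
  fixes p q :: "'a::monoid_add \<Rightarrow>\<^sub>0 complex"
  shows "pairing h (p * q) = pairing (\<lambda>\<alpha>. pairing (\<lambda>\<beta>. h (\<alpha> + \<beta>)) q) p"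
proof -
  have "p * q = (\<Sum>\<alpha>\<in>Poly_Mapping.keys p. Poly_Mapping.single \<alpha> (Poly_Mapping.lookup p \<alpha>)) *
     (\<Sum>\<beta>\<in>Poly_Mapping.keys q. Poly_Mapping.single \<beta> (Poly_Mapping.lookup q \<beta>))"
    by (simp only: sum_single_keys)
  also have "pairing h \<dots> = (\<Sum>\<alpha>\<in>Poly_Mapping.keys p. \<Sum>\<beta>\<in>Poly_Mapping.keys q.
       (Poly_Mapping.lookup p \<alpha> * Poly_Mapping.lookup q \<beta>) * h (\<alpha> + \<beta>))"
    by (simp add: sum_product pairing_sum mult_single)
  finally show ?thesis by (simp add: pairing_def sum_distrib_left mult.assoc)
qed

lemma mpoly_eval_pairing: "mpoly_eval p z = pairing (\<lambda>\<alpha>. monom_fun \<alpha> z) p"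
  by (simp add: mpoly_eval_def pairing_def)

lemma monom_fun_add: "monom_fun (\<alpha> + \<beta>) z = monom_fun \<alpha> z * monom_fun \<beta> z"
  by (simp add: monom_fun_def lookup_add power_add prod.distrib)

lemma monom_fun_diag: "monom_fun \<alpha> (\<chi> i. w) = w ^ tdeg \<alpha>"
  by (simp add: monom_fun_def tdeg_def power_sum)

text \<open>
  On the diagonal \<open>p\<close> becomes a polynomial in one variable, whose \<open>n\<close>-th coefficient is the sum
  of the coefficients of \<open>p\<close> in degree \<open>n\<close>.
\<close>

lemma diag_ideal_iff:
  "p \<in> diag_ideal \<longleftrightarrow> (\<forall>n. pairing (\<lambda>\<alpha>. if tdeg \<alpha> = n then 1 else 0) p = 0)"
proof -
  define P where "P = (\<Sum>\<alpha>\<in>Poly_Mapping.keys p. monom (Poly_Mapping.lookup p \<alpha>) (tdeg \<alpha>))"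
  have eval: "diag_restrict (mpoly_eval p) w = poly P w" for w
    by (simp add: diag_restrict_def mpoly_eval_pairing monom_fun_diag pairing_def P_def poly_sum poly_monom)
  have coeff: "coeff P n = pairing (\<lambda>\<alpha>. if tdeg \<alpha> = n then 1 else 0) p" for n
    unfolding P_def pairing_def coeff_sum coeff_monom by (intro sum.cong) auto
  have "p \<in> diag_ideal \<longleftrightarrow> P = 0"
  proof
    assume "p \<in> diag_ideal"
    hence "ball 0 1 \<subseteq> {w. poly P w = 0}" by (auto simp: diag_ideal_def eval)
    moreover have "infinite (ball 0 1 :: complex set)"
      by (rule uncountable_infinite, rule uncountable_ball) auto
    ultimately show "P = 0" using poly_roots_finite[of P] finite_subset by blast
  qed (auto simp: diag_ideal_def eval)
  thus ?thesis unfolding poly_eq_iff coeff by simp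
qed

lemma diag_ideal_pairing:
  assumes "p \<in> diag_ideal"
  shows "pairing (\<lambda>\<alpha>. s (tdeg \<alpha>)) p = 0"
proof -
  let ?D = "tdeg ` Poly_Mapping.keys p"
  have "pairing (\<lambda>\<alpha>. s (tdeg \<alpha>)) p = pairing (\<lambda>\<alpha>. \<Sum>n\<in>?D. s n * (if tdeg \<alpha> = n then 1 else 0)) p"
    unfolding pairing_def
  proof (rule sum.cong)
    fix \<alpha> assume "\<alpha> \<in> Poly_Mapping.keys p"
    hence "(\<Sum>n\<in>?D. s n * (if tdeg \<alpha> = n then 1 else 0)) = (\<Sum>n\<in>?D. if n = tdeg \<alpha> then s (tdeg \<alpha>) else 0)"
      by (intro sum.cong) auto
    also have "\<dots> = s (tdeg \<alpha>)" using \<open>\<alpha> \<in> _\<close> by simp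
    finally show "Poly_Mapping.lookup p \<alpha> * s (tdeg \<alpha>) = 
       Poly_Mapping.lookup p \<alpha> * (\<Sum>n\<in>?D. s n * (if tdeg \<alpha> = n then 1 else 0))" by simp
  qed auto
  also have "\<dots> = 0" using assms unfolding diag_ideal_iff by (simp add: pairing_fun_sum pairing_fun_scale)
  finally show ?thesis .
qed

definition homog_component :: "nat \<Rightarrow> 'd::finite mpoly \<Rightarrow> 'd mpoly" where
  "homog_component n p = (\<Sum>\<alpha>\<in>Poly_Mapping.keys p. if tdeg \<alpha> = n then Poly_Mapping.single \<alpha> (Poly_Mapping.lookup p \<alpha>) else 0)"

lemma pairing_homog_component: "pairing h (homog_component n p) = pairing (\<lambda>\<alpha>. if tdeg \<alpha> = n then h \<alpha> else 0) p"
  unfolding homog_component_def pairing_sum pairing_def[of "\<lambda>\<alpha>. if tdeg \<alpha> = n then h \<alpha> else 0"] by (intro sum.cong) auto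

lemma homog_component_mult: "homog_component n (p * q) = (\<Sum>i\<le>n. homog_component i p * homog_component (n - i) q)"
proof (rule pairing_ext)
  fix h
  have "pairing h (\<Sum>i\<le>n. homog_component i p * homog_component (n - i) q) = 
     pairing (\<lambda>\<alpha>. \<Sum>i\<le>n. if tdeg \<alpha> = i then pairing (\<lambda>\<beta>. if tdeg \<beta> = n - i then h (\<alpha> + \<beta>) else 0) q else 0) p"
    by (simp only: pairing_sum pairing_mult pairing_homog_component pairing_fun_sum)
  also have "(\<lambda>\<alpha>. \<Sum>i\<le>n. if tdeg \<alpha> = i then pairing (\<lambda>\<beta>. if tdeg \<beta> = n - i then h (\<alpha> + \<beta>) else 0) q else 0)
    = (\<lambda>\<alpha>. pairing (\<lambda>\<beta>. if tdeg (\<alpha> + \<beta>) = n then h (\<alpha> + \<beta>) else 0) q)"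
  proof
    fix \<alpha> :: "'a \<Rightarrow>\<^sub>0 nat"
    show "(\<Sum>i\<le>n. if tdeg \<alpha> = i then pairing (\<lambda>\<beta>. if tdeg \<beta> = n - i then h (\<alpha> + \<beta>) else 0) q else 0)
      = pairing (\<lambda>\<beta>. if tdeg (\<alpha> + \<beta>) = n then h (\<alpha> + \<beta>) else 0) q"
    proof (cases "tdeg \<alpha> \<le> n")
      case True
      hence "tdeg \<beta> = n - tdeg \<alpha> \<longleftrightarrow> tdeg (\<alpha> + \<beta>) = n" for \<beta> by auto
      thus ?thesis using True by simp
    next
      case False
      hence "tdeg (\<alpha> + \<beta>) \<noteq> n" for \<beta> by simp
      thus ?thesis using False by (simp add: pairing_def)
    qed
  qed
  finally show "pairing h (homog_component n (p * q)) = pairing h (\<Sum>i\<le>n. homog_component i p * homog_component (n - i) q)"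
    by (simp add: pairing_homog_component pairing_mult)
qed

lemma diag_ideal_homog_component: "p \<in> diag_ideal \<Longrightarrow> homog_component n p \<in> diag_ideal"
  unfolding diag_ideal_iff pairing_homog_component
proof
  fix m assume *: "\<forall>n. pairing (\<lambda>\<alpha>. if tdeg \<alpha> = n then 1 else 0) p = 0"
  have "(\<lambda>\<alpha> :: 'a \<Rightarrow>\<^sub>0 nat. if tdeg \<alpha> = n then if tdeg \<alpha> = m then 1 else 0 else 0 :: complex)
    = (\<lambda>\<alpha>. (if n = m then 1 else 0) * (if tdeg \<alpha> = n then 1 else 0))" by (intro ext) simp
  thus "pairing (\<lambda>\<alpha>. if tdeg \<alpha> = n then if tdeg \<alpha> = m then 1 else 0 else 0) p = 0"
    using * by (simp only: pairing_fun_scale) simp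
qed

text \<open>
  The ring as a module over itself; this makes the facts about spans available for
  \<open>ideal_power\<close>.
\<close>

lemma module_mult: "module ((*) :: 'a::comm_ring_1 \<Rightarrow> 'a \<Rightarrow> 'a)"
  by unfold_locales (auto simp: algebra_simps)

lemma ideal_power_add: "p \<in> ideal_power I m \<Longrightarrow> q \<in> ideal_power I m \<Longrightarrow> p + q \<in> ideal_power I m"
  unfolding ideal_power_def by (rule module.span_add[OF module_mult])

lemma ideal_power_zero: "0 \<in> ideal_power I m"
  unfolding ideal_power_def by (rule module.span_zero[OF module_mult])

lemma ideal_power_mult: "q \<in> ideal_power I m \<Longrightarrow> p * q \<in> ideal_power I m"
  unfolding ideal_power_def by (rule module.span_scale[OF module_mult])

lemma ideal_power_sum: "(\<And>x. x \<in> A \<Longrightarrow> p x \<in> ideal_power I m) \<Longrightarrow> (\<Sum>x\<in>A. p x) \<in> ideal_power I m"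
  by (induction A rule: infinite_finite_induct) (auto intro: ideal_power_add ideal_power_zero)

lemma ideal_power_0: "q \<in> ideal_power I 0"
proof -
  have "q * 1 \<in> ideal_power I 0"
    by (rule ideal_power_mult) (auto simp: ideal_power_def intro: module.span_base[OF module_mult])
  thus ?thesis by simp
qed

lemma ideal_power_Suc_I:
  assumes "g \<in> I" "q \<in> ideal_power I m"
  shows "g * q \<in> ideal_power I (Suc m)"
  using assms(2) unfolding ideal_power_def
proof (induction rule: module.span_induct_alt[OF module_mult, consumes 1, case_names base step])
  case base
  show ?case using module.span_zero[OF module_mult] by simp
next
  case (step c x y)
  then obtain h where h: "x = (\<Prod>k<m. h k)" "\<forall>k<m. h k \<in> I" by blast
  have "g * x = (\<Prod>k<Suc m. (h(m := g)) k)" unfolding h(1) by (simp add: mult.commute)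
  moreover have "\<forall>k<Suc m. (h(m := g)) k \<in> I" using h(2) assms(1) by (simp add: less_Suc_eq)
  ultimately have "g * x \<in> {\<Prod>k<Suc m. h k | h. \<forall>k<Suc m. h k \<in> I}" by blast
  hence "g * x \<in> module.span (*) {\<Prod>k<Suc m. h k | h. \<forall>k<Suc m. h k \<in> I}"
    by (rule module.span_base[OF module_mult])
  from module.span_add[OF module_mult module.span_scale[OF module_mult this] step.IH]
  have "c * (g * x) + g * y \<in> module.span (*) {\<Prod>k<Suc m. h k | h. \<forall>k<Suc m. h k \<in> I}" .
  thus ?case by (simp add: algebra_simps)
qed

text \<open>
  The power \<open>I ^ (m + 1)\<close> is additively generated by the products of an element of \<open>I\<close> and one
  of \<open>I ^ m\<close>.
\<close>

lemma ideal_power_Suc_induct [consumes 1, case_names zero add mult]: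
  assumes "q \<in> ideal_power I (Suc m)"
    and zero: "P 0"
    and add: "\<And>p q. P p \<Longrightarrow> P q \<Longrightarrow> P (p + q)"
    and mult: "\<And>g q. g \<in> I \<Longrightarrow> q \<in> ideal_power I m \<Longrightarrow> P (g * q)"
  shows "P q"
  using assms(1) unfolding ideal_power_def
proof (induction rule: module.span_induct_alt[OF module_mult, consumes 1, case_names base step])
  case base
  show ?case by (rule zero)
next
  case (step c x y)
  then obtain h where h: "x = (\<Prod>k<Suc m. h k)" "\<forall>k<Suc m. h k \<in> I" by blast
  have "c * x = h m * (c * (\<Prod>k<m. h k))" unfolding h(1) by (simp add: mult_ac)
  moreover have "(\<Prod>k<m. h k) \<in> ideal_power I m"
    unfolding ideal_power_def by (rule module.span_base[OF module_mult]) (use h(2) in auto)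
  ultimately have "P (c * x)" using h(2) by (auto intro!: mult ideal_power_mult)
  thus ?case by (rule add) (rule step.IH)
qed

text \<open>
  The homogeneous components of a product are sums of products of homogeneous components of its
  factors, so homogeneity passes from the diagonal ideal to its powers.
\<close>

lemma ideal_power_homog_component: "q \<in> ideal_power diag_ideal m \<Longrightarrow> homog_component n q \<in> ideal_power diag_ideal m"
proof (induction m arbitrary: q n)
  case 0
  show ?case by (rule ideal_power_0)
next
  case (Suc m)
  from Suc.prems show ?case
  proof (induction rule: ideal_power_Suc_induct)
    case zero
    show ?case by (simp add: homog_component_def ideal_power_zero)
  next
    case (add p q)
    have "homog_component n (p + q) = homog_component n p + homog_component n q" by (rule pairing_ext) (simp add: pairing_homog_component pairing_add)
    thus ?case using add by (simp add: ideal_power_add)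
  next
    case (mult g q)
    show ?case unfolding homog_component_mult
      by (intro ideal_power_sum ideal_power_Suc_I diag_ideal_homog_component Suc.IH mult)
  qed
qed

text \<open>
  Polynomials of degree at most \<open>m\<close>, characterised by the vanishing of differences of order
  \<open>m + 1\<close>. This form is suited to the induction over the powers of an ideal, where each factor from
  the diagonal ideal takes one difference.
\<close>

primrec diffdeg :: "nat \<Rightarrow> ('a::monoid_add \<Rightarrow> complex) \<Rightarrow> bool" where
  "diffdeg 0 \<phi> \<longleftrightarrow> (\<forall>\<beta> \<gamma>. \<phi> (\<beta> + \<gamma>) = \<phi> \<gamma>)"
| "diffdeg (Suc m) \<phi> \<longleftrightarrow> (\<forall>\<beta>. diffdeg m (\<lambda>\<gamma>. \<phi> (\<beta> + \<gamma>) - \<phi> \<gamma>))"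

lemma diffdeg_const: "diffdeg m (\<lambda>_. c)"
  by (induction m arbitrary: c) auto

lemma diffdeg_add: "diffdeg m \<phi> \<Longrightarrow> diffdeg m \<psi> \<Longrightarrow> diffdeg m (\<lambda>\<gamma>. \<phi> \<gamma> + \<psi> \<gamma>)"
proof (induction m arbitrary: \<phi> \<psi>)
  case (Suc m)
  have "diffdeg m (\<lambda>\<gamma>. (\<phi> (\<beta> + \<gamma>) - \<phi> \<gamma>) + (\<psi> (\<beta> + \<gamma>) - \<psi> \<gamma>))" for \<beta>
    by (rule Suc.IH) (use Suc.prems in auto)
  thus ?case by (simp add: algebra_simps)
qed simp

lemma diffdeg_shift: 
  fixes \<phi> :: "'a::comm_monoid_add \<Rightarrow> complex"
  shows "diffdeg m \<phi> \<Longrightarrow> diffdeg m (\<lambda>\<gamma>. \<phi> (\<beta> + \<gamma>))"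
proof (induction m arbitrary: \<phi>)
  case (Suc m)
  have "diffdeg m (\<lambda>\<gamma>. \<phi> (\<beta>' + (\<beta> + \<gamma>)) - \<phi> (\<beta> + \<gamma>))" for \<beta>'
    using Suc.IH[of "\<lambda>\<gamma>. \<phi> (\<beta>' + \<gamma>) - \<phi> \<gamma>"] Suc.prems by simp
  thus ?case by (simp add: add_ac)
qed simp

text \<open>
  Leibniz rule: the difference of \<open>\<phi> * \<psi>\<close> is \<open>(\<Delta>\<phi>) * \<psi>(\<beta> + \<cdot>) + \<phi> * (\<Delta>\<psi>)\<close>.
\<close>

lemma diffdeg_mult:
  fixes \<phi> \<psi> :: "'a::comm_monoid_add \<Rightarrow> complex"
  shows "diffdeg a \<phi> \<Longrightarrow> diffdeg b \<psi> \<Longrightarrow> diffdeg (a + b) (\<lambda>\<gamma>. \<phi> \<gamma> * \<psi> \<gamma>)"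
proof (induction "a + b" arbitrary: a b \<phi> \<psi>)
  case 0
  thus ?case by simp
next
  case (Suc s)
  have "diffdeg s (\<lambda>\<gamma>. (\<phi> (\<beta> + \<gamma>) - \<phi> \<gamma>) * \<psi> (\<beta> + \<gamma>))" for \<beta>
  proof (cases a)
    case 0
    thus ?thesis using Suc.prems by (simp add: diffdeg_const)
  next
    case (Suc a')
    thus ?thesis using Suc.hyps(1)[of a' b] Suc.hyps(2) Suc.prems by (auto intro: diffdeg_shift)
  qed
  moreover have "diffdeg s (\<lambda>\<gamma>. \<phi> \<gamma> * (\<psi> (\<beta> + \<gamma>) - \<psi> \<gamma>))" for \<beta>
  proof (cases b)
    case 0
    thus ?thesis using Suc.prems by (simp add: diffdeg_const)
  next
    case (Suc b')
    thus ?thesis using Suc.hyps(1)[of a b'] Suc.hyps(2) Suc.prems by auto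
  qed
  ultimately have "diffdeg s (\<lambda>\<gamma>. (\<phi> (\<beta> + \<gamma>) - \<phi> \<gamma>) * \<psi> (\<beta> + \<gamma>) + \<phi> \<gamma> * (\<psi> (\<beta> + \<gamma>) - \<psi> \<gamma>))" for \<beta>
    by (intro diffdeg_add)
  thus ?case unfolding Suc.hyps(2)[symmetric] by (simp add: algebra_simps)
qed

lemma diffdeg_coordinate_power:
  "diffdeg m (\<lambda>\<gamma> :: 'd::finite \<Rightarrow>\<^sub>0 nat. complex_of_real (real (Poly_Mapping.lookup \<gamma> i) ^ m))"
proof (induction m)
  case (Suc m)
  have "diffdeg (Suc 0) (\<lambda>\<gamma> :: 'd \<Rightarrow>\<^sub>0 nat. complex_of_real (real (Poly_Mapping.lookup \<gamma> i)))"
    by (simp add: lookup_add)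
  from diffdeg_mult[OF this Suc] show ?case by simp
qed simp

lemma diffdeg_prod:
  fixes \<phi> :: "'i \<Rightarrow> 'a::comm_monoid_add \<Rightarrow> complex"
  assumes "finite A" "\<And>i. i \<in> A \<Longrightarrow> diffdeg (m i) (\<phi> i)"
  shows "diffdeg (\<Sum>i\<in>A. m i) (\<lambda>\<gamma>. \<Prod>i\<in>A. \<phi> i \<gamma>)"
  using assms by (induction A) (auto intro: diffdeg_mult)

lemma diffdeg_monom_val: "diffdeg (tdeg k) (\<lambda>\<gamma>. complex_of_real (monom_val k \<gamma>))"
  unfolding tdeg_def monom_val_def of_real_prod by (intro diffdeg_prod diffdeg_coordinate_power) auto

text \<open>
  For \<open>g \<in> J\<close> and \<open>q \<in> J\<^sup>m\<close>, summing \<open>\<phi> (\<alpha> + \<beta>)\<close> against the coefficients of \<open>q\<close> gives the same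
  as summing \<open>\<phi> \<beta>\<close>, since their difference has smaller degree in \<open>\<beta>\<close>. The result depends on
  \<open>\<alpha>\<close> through its degree only, and the coefficients of \<open>g\<close> in each degree add up to \<open>0\<close>.
\<close>

lemma ideal_power_diffdeg:
  assumes "q \<in> ideal_power diag_ideal (Suc m)" "diffdeg m \<phi>"
  shows "pairing (\<lambda>\<alpha>. if tdeg \<alpha> = n then \<phi> \<alpha> else 0) q = 0"
  using assms
proof (induction m arbitrary: q \<phi> n)
  case 0
  have const: "\<phi> (\<alpha> + \<beta>) = \<phi> \<beta>" for \<alpha> \<beta> using 0(2) by simp
  from 0(1) show ?case
  proof (induction rule: ideal_power_Suc_induct)
    case (mult g q)
    have "tdeg (\<alpha> + \<beta>) = n \<longleftrightarrow> tdeg \<alpha> + tdeg \<beta> = n" for \<alpha> \<beta> :: "'a \<Rightarrow>\<^sub>0 nat" by simp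
    thus ?case unfolding pairing_mult const
      using diag_ideal_pairing[OF mult(1), of "\<lambda>i. pairing (\<lambda>\<beta>. if i + tdeg \<beta> = n then \<phi> \<beta> else 0) q"] by simp
  qed (auto simp: pairing_add)
next
  case (Suc m)
  from Suc.prems(1) show ?case
  proof (induction rule: ideal_power_Suc_induct)
    case (mult g q)
    have "pairing (\<lambda>\<beta>. if tdeg (\<alpha> + \<beta>) = n then \<phi> (\<alpha> + \<beta>) else 0) q =
          pairing (\<lambda>\<beta>. if tdeg \<alpha> + tdeg \<beta> = n then \<phi> \<beta> else 0) q" for \<alpha>
    proof -
      have "pairing (\<lambda>\<beta>. if tdeg \<alpha> + tdeg \<beta> = n then \<phi> (\<alpha> + \<beta>) - \<phi> \<beta> else 0) q = 0"
      proof (cases "tdeg \<alpha> \<le> n")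
        case True
        hence "tdeg \<alpha> + tdeg \<beta> = n \<longleftrightarrow> tdeg \<beta> = n - tdeg \<alpha>" for \<beta> :: "'a \<Rightarrow>\<^sub>0 nat" by auto
        thus ?thesis using Suc.IH[OF mult(2), of "\<lambda>\<beta>. \<phi> (\<alpha> + \<beta>) - \<phi> \<beta>" "n - tdeg \<alpha>"] Suc.prems(2) by simp
      next
        case False
        thus ?thesis by (auto simp: pairing_def intro!: sum.neutral)
      qed
      moreover have "pairing (\<lambda>\<beta>. if tdeg (\<alpha> + \<beta>) = n then \<phi> (\<alpha> + \<beta>) else 0) q =
         pairing (\<lambda>\<beta>. (if tdeg \<alpha> + tdeg \<beta> = n then \<phi> (\<alpha> + \<beta>) - \<phi> \<beta> else 0) + (if tdeg \<alpha> + tdeg \<beta> = n then \<phi> \<beta> else 0)) q"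
        unfolding pairing_def by (intro sum.cong) auto
      ultimately show ?thesis by (simp add: pairing_fun_add)
    qed
    thus ?case unfolding pairing_mult
      using diag_ideal_pairing[OF mult(1), of "\<lambda>i. pairing (\<lambda>\<beta>. if i + tdeg \<beta> = n then \<phi> \<beta> else 0) q"] by simp
  qed (auto simp: pairing_add)
qed

lemma ideal_power_monom_val:
  assumes "q \<in> ideal_power diag_ideal N" "Suc (tdeg k) = N"
  shows "pairing (\<lambda>\<alpha>. if tdeg \<alpha> = n then complex_of_real (monom_val k \<alpha>) else 0) q = 0"
  using ideal_power_diffdeg[OF _ diffdeg_monom_val] assms by blast

lemma ideal_power_antimono:
  assumes "q \<in> ideal_power I m" "m' \<le> m"
  shows "q \<in> ideal_power I m'"
proof -
  have step: "q \<in> ideal_power I m" if "q \<in> ideal_power I (Suc m)" for q m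
    using that by (induction rule: ideal_power_Suc_induct) (auto intro: ideal_power_add ideal_power_zero ideal_power_mult)
  from assms(2,1) show ?thesis by (induction rule: dec_induct) (auto intro: step)
qed

lemma ideal_power_mult2:
  assumes "p \<in> ideal_power I m" "q \<in> ideal_power I m'"
  shows "p * q \<in> ideal_power I (m + m')"
  using assms(1)
proof (induction m arbitrary: p)
  case 0
  show ?case using assms(2) by (simp add: ideal_power_mult)
next
  case (Suc m)
  from Suc.prems show ?case
  proof (induction rule: ideal_power_Suc_induct)
    case (mult g p)
    thus ?case using ideal_power_Suc_I[OF mult(1) Suc.IH[OF mult(2)]] by (simp add: mult.assoc)
  qed (auto intro: ideal_power_add ideal_power_zero simp: distrib_right)
qed

lemma ideal_power_power: "u \<in> I \<Longrightarrow> u ^ m \<in> ideal_power I m"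
  by (induction m) (auto intro: ideal_power_0 ideal_power_Suc_I)

lemma ideal_power_prod_power:
  assumes "finite A" "\<And>i. i \<in> A \<Longrightarrow> u i \<in> I"
  shows "(\<Prod>i\<in>A. u i ^ m i) \<in> ideal_power I (\<Sum>i\<in>A. m i)"
  using assms by (induction A) (auto intro: ideal_power_0 ideal_power_mult2 ideal_power_power)

definition var :: "'d::finite \<Rightarrow> 'd mpoly" where
  "var i = Poly_Mapping.single (Poly_Mapping.single i 1) 1"

lemma var_diff_mem_diag_ideal: "var i - var j \<in> diag_ideal"
proof -
  have "tdeg (Poly_Mapping.single i (1::nat)) = 1" for i :: 'a
    by (simp add: tdeg_def lookup_single when_def)
  moreover have "pairing h (var i - var j) + pairing h (var j) = pairing h (var i)" for h
    by (simp flip: pairing_add)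
  hence "pairing h (var i - var j) = pairing h (var i) - pairing h (var j)" for h
    by (simp add: eq_diff_eq)
  ultimately show ?thesis by (simp add: diag_ideal_iff var_def)
qed

lemma var_power: "var i ^ m = Poly_Mapping.single (Poly_Mapping.single i m) 1"
proof (induction m)
  case (Suc m)
  thus ?case by (simp add: var_def mult_single flip: single_add)
qed (simp add: single_one)

lemma prod_var_power: "(\<Prod>i\<in>UNIV. var i ^ Poly_Mapping.lookup \<alpha> i) = Poly_Mapping.single \<alpha> 1"
proof -
  have *: "finite A \<Longrightarrow> (\<Prod>i\<in>A. var i ^ Poly_Mapping.lookup \<alpha> i) =
      Poly_Mapping.single (\<Sum>i\<in>A. Poly_Mapping.single i (Poly_Mapping.lookup \<alpha> i)) 1" for A
    by (induction A rule: finite_induct) (auto simp: var_power mult_single single_one)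
  have "(\<Sum>i\<in>UNIV. Poly_Mapping.single i (Poly_Mapping.lookup \<alpha> i)) = \<alpha>"
    by (rule poly_mapping_eqI) (simp add: lookup_sum lookup_single when_def)
  thus ?thesis using *[of UNIV] by simp
qed

text \<open>
  The monomials in the differences \<open>z\<^sub>i - z\<^sub>i\<^sub>0\<close>, \<open>i \<noteq> i0\<close>, times a power of \<open>z\<^sub>i\<^sub>0\<close>. Those with
  at least \<open>N\<close> factors of the first kind belong to \<open>J\<^sup>N\<close>.
\<close>

definition taylor_poly :: "'d::finite \<Rightarrow> nat \<Rightarrow> ('d \<Rightarrow> nat) \<Rightarrow> 'd mpoly" where
  "taylor_poly i0 e j = var i0 ^ e * (\<Prod>i\<in>UNIV - {i0}. (var i - var i0) ^ j i)"

text \<open>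
  Expanding \<open>z\<^sub>i = (z\<^sub>i - z\<^sub>i\<^sub>0) + z\<^sub>i\<^sub>0\<close> in one variable after the other shows that these polynomials span
  all homogeneous polynomials of degree \<open>n\<close>.
\<close>

lemma pairing_eq_zero_of_taylor:
  assumes h: "\<And>e j. e + (\<Sum>i\<in>UNIV - {i0}. j i) = n \<Longrightarrow> pairing h (taylor_poly i0 e j) = 0"
    and "tdeg \<alpha> = n"
  shows "h \<alpha> = 0"
proof -
  have "pairing h (var i0 ^ e * (\<Prod>i\<in>A. var i ^ j i) * (\<Prod>i\<in>UNIV - {i0} - A. (var i - var i0) ^ j i)) = 0"
    if "finite A" "A \<subseteq> UNIV - {i0}" "e + (\<Sum>i\<in>UNIV - {i0}. j i) = n" for A e j
    using that
  proof (induction A arbitrary: e j rule: finite_induct)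
    case empty
    thus ?case using h[of e j] by (simp add: taylor_poly_def)
  next
    case (insert a A)
    define R where "R = UNIV - {i0} - insert a A"
    have R: "UNIV - {i0} - A = insert a R" "a \<notin> R" using insert unfolding R_def by auto
    have sum_a: "(\<Sum>i\<in>UNIV - {i0}. j i) = j a + (\<Sum>i\<in>UNIV - {i0} - {a}. j i)"
      using insert.prems(1) by (subst sum.remove[of _ a]) auto
    have "var a ^ j a = ((var a - var i0) + var i0) ^ j a" by simp
    also have "\<dots> = (\<Sum>t\<le>j a. of_nat (j a choose t) * (var a - var i0) ^ t * var i0 ^ (j a - t))"
      by (rule binomial_ring)
    finally have va: "var a ^ j a = (\<Sum>t\<le>j a. of_nat (j a choose t) * (var a - var i0) ^ t * var i0 ^ (j a - t))" .
    have "var i0 ^ e * (\<Prod>i\<in>insert a A. var i ^ j i) * (\<Prod>i\<in>R. (var i - var i0) ^ j i)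
      = (\<Sum>t\<le>j a. of_nat (j a choose t) * (var i0 ^ (e + (j a - t)) * (\<Prod>i\<in>A. var i ^ (j(a := t)) i) *
            (\<Prod>i\<in>insert a R. (var i - var i0) ^ (j(a := t)) i)))"
    proof -
      have 1: "(\<Prod>i\<in>A. var i ^ (j(a := t)) i) = (\<Prod>i\<in>A. var i ^ j i)" for t
        using insert by (intro prod.cong) auto
      have 2: "(\<Prod>i\<in>insert a R. (var i - var i0) ^ (j(a := t)) i) = (var a - var i0) ^ t * (\<Prod>i\<in>R. (var i - var i0) ^ j i)" for t
      proof -
        have "(\<Prod>i\<in>R. (var i - var i0) ^ (j(a := t)) i) = (\<Prod>i\<in>R. (var i - var i0) ^ j i)"
          using R by (intro prod.cong) auto
        thus ?thesis using R by simp
      qed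
      have "var i0 ^ e * (\<Prod>i\<in>insert a A. var i ^ j i) * (\<Prod>i\<in>R. (var i - var i0) ^ j i) =
         var a ^ j a * (var i0 ^ e * (\<Prod>i\<in>A. var i ^ j i) * (\<Prod>i\<in>R. (var i - var i0) ^ j i))"
        using insert by (simp add: mult_ac)
      also have "\<dots> = (\<Sum>t\<le>j a. of_nat (j a choose t) * (var i0 ^ (e + (j a - t)) * (\<Prod>i\<in>A. var i ^ j i) *
            ((var a - var i0) ^ t * (\<Prod>i\<in>R. (var i - var i0) ^ j i))))"
        unfolding va sum_distrib_right by (intro sum.cong) (simp_all only: power_add mult_ac)
      finally show ?thesis unfolding 1 2 .
    qed
    moreover have "pairing h (of_nat c * p) = of_nat c * pairing h p" for c p
      by (induction c) (auto simp: pairing_add algebra_simps)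
    moreover have "pairing h (var i0 ^ (e + (j a - t)) * (\<Prod>i\<in>A. var i ^ (j(a := t)) i) *
            (\<Prod>i\<in>insert a R. (var i - var i0) ^ (j(a := t)) i)) = 0" if "t \<le> j a" for t
    proof -
      have "(\<Sum>i\<in>UNIV - {i0}. (j(a := t)) i) = t + (\<Sum>i\<in>UNIV - {i0} - {a}. j i)"
        using insert.prems(1) by (subst sum.remove[of _ a]) auto
      hence "e + (j a - t) + (\<Sum>i\<in>UNIV - {i0}. (j(a := t)) i) = n"
        using insert.prems(2) that sum_a by simp
      from insert.IH[OF _ this] show ?thesis using insert.prems(1) unfolding R by simp
    qed
    ultimately show ?case unfolding R_def[symmetric] by (simp add: pairing_sum)
  qed
  note * = this
  have "tdeg \<alpha> = Poly_Mapping.lookup \<alpha> i0 + (\<Sum>i\<in>UNIV - {i0}. Poly_Mapping.lookup \<alpha> i)"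
    unfolding tdeg_def by (subst sum.remove[of _ i0]) auto
  from *[of "UNIV - {i0}" "Poly_Mapping.lookup \<alpha> i0" "Poly_Mapping.lookup \<alpha>"] this assms(2)
  have "pairing h (var i0 ^ Poly_Mapping.lookup \<alpha> i0 * (\<Prod>i\<in>UNIV - {i0}. var i ^ Poly_Mapping.lookup \<alpha> i)) = 0"
    by simp
  also have "var i0 ^ Poly_Mapping.lookup \<alpha> i0 * (\<Prod>i\<in>UNIV - {i0}. var i ^ Poly_Mapping.lookup \<alpha> i)
     = (\<Prod>i\<in>UNIV. var i ^ Poly_Mapping.lookup \<alpha> i)"
    by (subst prod.remove[of UNIV i0]) auto
  finally show ?thesis by (simp add: prod_var_power)
qed

text \<open>
  Gaussian elimination: one unknown is used up by each equation.
\<close>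

lemma homogeneous_system_nontrivial_solution:
  fixes M :: "'b \<Rightarrow> 'a \<Rightarrow> complex"
  assumes "finite A" "finite B" "card A < card B"
  shows "\<exists>c. (\<exists>b\<in>B. c b \<noteq> 0) \<and> (\<forall>a\<in>A. (\<Sum>b\<in>B. c b * M b a) = 0)"
  using assms
proof (induction A arbitrary: B M rule: finite_induct)
  case empty
  then obtain b where "b \<in> B" by fastforce
  thus ?case by (intro exI[of _ "\<lambda>_. 1"]) auto
next
  case (insert a A)
  show ?case
  proof (cases "\<forall>b\<in>B. M b a = 0")
    case True
    have "card A < card B" using insert by simp
    then obtain c where "\<exists>b\<in>B. c b \<noteq> 0" "\<forall>a\<in>A. (\<Sum>b\<in>B. c b * M b a) = 0"
      using insert.IH[OF \<open>finite B\<close>, of M] by blast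
    thus ?thesis using True by (intro exI[of _ c]) auto
  next
    case False
    then obtain b0 where b0: "b0 \<in> B" "M b0 a \<noteq> 0" by blast
    define M' where "M' = (\<lambda>b x. M b x - M b a / M b0 a * M b0 x)"
    obtain c where c: "\<exists>b\<in>B - {b0}. c b \<noteq> 0" "\<forall>x\<in>A. (\<Sum>b\<in>B - {b0}. c b * M' b x) = 0"
    proof -
      have "card A < card (B - {b0})" using insert b0 by (simp add: card_Diff_singleton)
      thus ?thesis using insert.IH[of "B - {b0}" M'] \<open>finite B\<close> that by blast
    qed
    define c' where "c' = c(b0 := - (\<Sum>b\<in>B - {b0}. c b * (M b a / M b0 a)))"
    have eq: "(\<Sum>b\<in>B. c' b * M b x) = (\<Sum>b\<in>B - {b0}. c b * M' b x)" for x
    proof -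
      have "(\<Sum>b\<in>B. c' b * M b x) = c' b0 * M b0 x + (\<Sum>b\<in>B - {b0}. c' b * M b x)"
        using insert b0 by (subst sum.remove[of _ b0]) auto
      also have "(\<Sum>b\<in>B - {b0}. c' b * M b x) = (\<Sum>b\<in>B - {b0}. c b * M b x)"
        by (intro sum.cong) (auto simp: c'_def)
      also have "c' b0 * M b0 x = - (\<Sum>b\<in>B - {b0}. c b * (M b a / M b0 a) * M b0 x)"
        by (simp add: c'_def sum_distrib_right)
      finally show ?thesis by (simp add: M'_def algebra_simps sum_subtractf)
    qed
    have "M' b a = 0" for b using b0 by (simp add: M'_def)
    hence "\<forall>x\<in>insert a A. (\<Sum>b\<in>B. c' b * M b x) = 0" unfolding eq using c(2) by auto
    moreover have "\<exists>b\<in>B. c' b \<noteq> 0" using c(1) unfolding c'_def by auto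
    ultimately show ?thesis by blast
  qed
qed

text \<open>
  Modulo \<open>J ^ (m + 1)\<close> the homogeneous polynomials of degree \<open>n\<close> are spanned by the \<open>taylor_poly\<close>
  with at most \<open>m\<close> factors \<open>z\<^sub>i - z\<^sub>i\<^sub>0\<close>. Their exponents can be completed to multi-indices of degree \<open>m\<close>
  by an artificial exponent at \<open>i0\<close>, so there are \<open>card (homog m)\<close> of them, which bounds the
  dimension of the annihilator of \<open>J ^ (m + 1)\<close> in degree \<open>n\<close>.
\<close>

lemma annihilator_dependent:
  fixes h :: "'b \<Rightarrow> ('d::finite \<Rightarrow>\<^sub>0 nat) \<Rightarrow> complex"
  assumes "finite B" "card (homog m :: ('d \<Rightarrow>\<^sub>0 nat) set) < card B" "m \<le> n"
    and h: "\<And>b q. b \<in> B \<Longrightarrow> q \<in> ideal_power diag_ideal (Suc m) \<Longrightarrow> pairing (h b) q = 0"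
  shows "\<exists>c. (\<exists>b\<in>B. c b \<noteq> 0) \<and> (\<forall>\<alpha>\<in>homog n. (\<Sum>b\<in>B. c b * h b \<alpha>) = 0)"
proof -
  obtain i0 :: 'd where True by blast
  define w where "w = (\<lambda>k :: 'd \<Rightarrow>\<^sub>0 nat. taylor_poly i0 (n + Poly_Mapping.lookup k i0 - m) (Poly_Mapping.lookup k))"
  obtain c where c: "\<exists>b\<in>B. c b \<noteq> 0" "\<forall>k\<in>homog m. (\<Sum>b\<in>B. c b * pairing (h b) (w k)) = 0"
    using homogeneous_system_nontrivial_solution[of "homog m" B "\<lambda>b k. pairing (h b) (w k)"] assms(1,2) by auto
  define H where "H = (\<lambda>\<alpha>. \<Sum>b\<in>B. c b * h b \<alpha>)"
  have pairing_H: "pairing H p = (\<Sum>b\<in>B. c b * pairing (h b) p)" for p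
    unfolding H_def by (simp add: pairing_fun_sum pairing_fun_scale)
  have "pairing H (taylor_poly i0 e j) = 0" if ej: "e + (\<Sum>i\<in>UNIV - {i0}. j i) = n" for e j
  proof (cases "(\<Sum>i\<in>UNIV - {i0}. j i) \<le> m")
    case False
    have "(\<Prod>i\<in>UNIV - {i0}. (var i - var i0) ^ j i) \<in> ideal_power diag_ideal (\<Sum>i\<in>UNIV - {i0}. j i)"
      by (intro ideal_power_prod_power) (auto intro: var_diff_mem_diag_ideal)
    hence "taylor_poly i0 e j \<in> ideal_power diag_ideal (Suc m)" unfolding taylor_poly_def
      by (intro ideal_power_mult) (rule ideal_power_antimono, use False in auto)
    thus ?thesis unfolding pairing_H using h by simp
  next
    case True
    (* The exponent at i0 does not occur in the product over the other variables; it is chosen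
       to make the degree equal to m. *)
    define k where "k = Abs_poly_mapping (j(i0 := m - (\<Sum>i\<in>UNIV - {i0}. j i)))"
    have "tdeg k = m" unfolding tdeg_def using True by (subst sum.remove[of _ i0]) (auto simp: k_def)
    moreover have "w k = taylor_poly i0 e j"
    proof -
      have "(\<Prod>i\<in>UNIV - {i0}. (var i - var i0) ^ Poly_Mapping.lookup k i) = (\<Prod>i\<in>UNIV - {i0}. (var i - var i0) ^ j i)"
        by (intro prod.cong) (auto simp: k_def)
      moreover have "n + Poly_Mapping.lookup k i0 - m = e" using True ej \<open>m \<le> n\<close> by (simp add: k_def)
      ultimately show ?thesis by (simp add: w_def taylor_poly_def)
    qed
    moreover have "(\<Sum>b\<in>B. c b * pairing (h b) (w k)) = 0" using c(2) \<open>tdeg k = m\<close> by simp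
    ultimately show ?thesis unfolding pairing_H by simp
  qed
  hence "\<forall>\<alpha>\<in>homog n. H \<alpha> = 0" using pairing_eq_zero_of_taylor[of i0 n H] by auto
  thus ?thesis using c(1) unfolding H_def by blast
qed

section \<open>Square-summable families and their orthonormal bases\<close>

definition l2 :: "('a \<Rightarrow> complex) set" where
  "l2 = {a. (\<lambda>\<alpha>. (cmod (a \<alpha>))\<^sup>2) summable_on UNIV}"

definition l2_inner :: "('a \<Rightarrow> complex) \<Rightarrow> ('a \<Rightarrow> complex) \<Rightarrow> complex" where
  "l2_inner a b = (\<Sum>\<^sub>\<infinity>\<alpha>. a \<alpha> * cnj (b \<alpha>))"

definition l2norm :: "('a \<Rightarrow> complex) \<Rightarrow> real" where
  "l2norm a = sqrt (\<Sum>\<^sub>\<infinity>\<alpha>. (cmod (a \<alpha>))\<^sup>2)"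

lemma l2_abs_summable_mult:
  assumes "a \<in> l2" "b \<in> l2"
  shows "(\<lambda>\<alpha>. norm (a \<alpha> * cnj (b \<alpha>))) summable_on UNIV"
proof (rule abs_summable_product)
  show "(\<lambda>i. norm (a i * a i)) summable_on UNIV" using assms(1)
    by (simp add: l2_def norm_mult power2_eq_square)
  show "(\<lambda>i. norm (cnj (b i) * cnj (b i))) summable_on UNIV" using assms(2)
    by (simp add: l2_def norm_mult power2_eq_square)
qed

lemma l2_inner_has_sum:
  assumes "a \<in> l2" "b \<in> l2"
  shows "((\<lambda>\<alpha>. a \<alpha> * cnj (b \<alpha>)) has_sum l2_inner a b) UNIV"
  unfolding l2_inner_def using abs_summable_summable[OF l2_abs_summable_mult[OF assms]] by (rule has_sum_infsum)

lemma l2_scale: "a \<in> l2 \<Longrightarrow> (\<lambda>\<alpha>. c * a \<alpha>) \<in> l2"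
  by (auto simp: l2_def norm_mult power_mult_distrib intro: summable_on_cmult_right)

lemma l2_add:
  assumes "a \<in> l2" "b \<in> l2"
  shows "(\<lambda>\<alpha>. a \<alpha> + b \<alpha>) \<in> l2"
proof -
  have "(\<lambda>\<alpha>. 2 * (cmod (a \<alpha>))\<^sup>2 + 2 * (cmod (b \<alpha>))\<^sup>2) summable_on UNIV"
    using assms by (intro summable_on_add summable_on_cmult_right) (auto simp: l2_def)
  moreover have "norm ((cmod (a \<alpha> + b \<alpha>))\<^sup>2) \<le> 2 * (cmod (a \<alpha>))\<^sup>2 + 2 * (cmod (b \<alpha>))\<^sup>2" for \<alpha>
  proof -
    have "(cmod (a \<alpha> + b \<alpha>))\<^sup>2 \<le> (cmod (a \<alpha>) + cmod (b \<alpha>))\<^sup>2"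
      by (intro power_mono norm_triangle_ineq) auto
    also have "\<dots> \<le> 2 * (cmod (a \<alpha>))\<^sup>2 + 2 * (cmod (b \<alpha>))\<^sup>2"
      using sum_squares_bound[of "cmod (a \<alpha>)" "cmod (b \<alpha>)"] by (simp add: power2_sum)
    finally show ?thesis by simp
  qed
  ultimately show ?thesis unfolding l2_def
    using summable_on_comparison_test[of "\<lambda>\<alpha>. 2 * (cmod (a \<alpha>))\<^sup>2 + 2 * (cmod (b \<alpha>))\<^sup>2" UNIV "\<lambda>\<alpha>. (cmod (a \<alpha> + b \<alpha>))\<^sup>2"]
    by simp
qed

lemma l2_diff: "a \<in> l2 \<Longrightarrow> b \<in> l2 \<Longrightarrow> (\<lambda>\<alpha>. a \<alpha> - b \<alpha>) \<in> l2"
  using l2_add[OF _ l2_scale[of b "-1"], of a] by simp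

lemma l2_zero [simp]: "(\<lambda>_. 0) \<in> l2"
  by (simp add: l2_def)

lemma l2_sum: "(\<And>i. i \<in> A \<Longrightarrow> v i \<in> l2) \<Longrightarrow> (\<lambda>\<alpha>. \<Sum>i\<in>A. v i \<alpha>) \<in> l2"
  by (induction A rule: infinite_finite_induct) (auto intro: l2_add)

lemma l2_lincomb: "(\<And>i. i \<in> A \<Longrightarrow> v i \<in> l2) \<Longrightarrow> (\<lambda>\<alpha>. \<Sum>i\<in>A. c i * v i \<alpha>) \<in> l2"
  by (intro l2_sum l2_scale)

lemma l2_finite_support:
  assumes "finite A" "\<And>\<alpha>. \<alpha> \<notin> A \<Longrightarrow> a \<alpha> = 0"
  shows "a \<in> l2"
proof -
  have "(\<lambda>\<alpha>. (cmod (a \<alpha>))\<^sup>2) summable_on UNIV \<longleftrightarrow> (\<lambda>\<alpha>. (cmod (a \<alpha>))\<^sup>2) summable_on A"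
    by (rule summable_on_cong_neutral) (use assms in auto)
  thus ?thesis using assms(1) by (simp add: l2_def)
qed

lemma l2_bounded_sums:
  assumes "\<And>A. finite A \<Longrightarrow> (\<Sum>\<alpha>\<in>A. (cmod (a \<alpha>))\<^sup>2) \<le> K"
  shows "a \<in> l2" "(\<Sum>\<^sub>\<infinity>\<alpha>. (cmod (a \<alpha>))\<^sup>2) \<le> K"
proof -
  have "(\<lambda>\<alpha>. (cmod (a \<alpha>))\<^sup>2) summable_on UNIV"
    by (rule nonneg_bdd_above_summable_on) (auto intro!: bdd_aboveI[of _ K] assms)
  thus "a \<in> l2" "(\<Sum>\<^sub>\<infinity>\<alpha>. (cmod (a \<alpha>))\<^sup>2) \<le> K"
    by (auto simp: l2_def intro: infsum_le_finite_sums assms)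
qed

lemma l2_inner_add_left: "a \<in> l2 \<Longrightarrow> b \<in> l2 \<Longrightarrow> g \<in> l2 \<Longrightarrow> l2_inner (\<lambda>\<alpha>. a \<alpha> + b \<alpha>) g = l2_inner a g + l2_inner b g"
  using has_sum_add[OF l2_inner_has_sum[of a g] l2_inner_has_sum[of b g]]
  by (auto simp: l2_inner_def distrib_right intro!: infsumI)

lemma l2_inner_scale_left: "a \<in> l2 \<Longrightarrow> g \<in> l2 \<Longrightarrow> l2_inner (\<lambda>\<alpha>. c * a \<alpha>) g = c * l2_inner a g"
  using has_sum_cmult_right[OF l2_inner_has_sum[of a g], of c]
  by (auto simp: l2_inner_def mult.assoc intro!: infsumI)

lemma l2_inner_diff_left: "a \<in> l2 \<Longrightarrow> b \<in> l2 \<Longrightarrow> g \<in> l2 \<Longrightarrow> l2_inner (\<lambda>\<alpha>. a \<alpha> - b \<alpha>) g = l2_inner a g - l2_inner b g"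
  using l2_inner_add_left[of a "\<lambda>\<alpha>. -1 * b \<alpha>" g] l2_inner_scale_left[of b g "-1"] l2_scale[of b "-1"] by simp

lemma l2_inner_cnj: "l2_inner b a = cnj (l2_inner a b)"
proof -
  have "cnj (l2_inner a b) = (\<Sum>\<^sub>\<infinity>\<alpha>. cnj (a \<alpha> * cnj (b \<alpha>)))"
    unfolding l2_inner_def by (rule infsum_cnj[symmetric])
  thus ?thesis by (simp add: l2_inner_def mult.commute)
qed

lemma l2_inner_zero_left [simp]: "l2_inner (\<lambda>_. 0) g = 0"
  by (simp add: l2_inner_def)

lemma l2_inner_sum_left:
  assumes "\<And>i. i \<in> A \<Longrightarrow> v i \<in> l2" "g \<in> l2"
  shows "l2_inner (\<lambda>\<alpha>. \<Sum>i\<in>A. c i * v i \<alpha>) g = (\<Sum>i\<in>A. c i * l2_inner (v i) g)"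
  using assms
proof (induction A rule: infinite_finite_induct)
  case (insert i A)
  thus ?case using l2_inner_add_left[OF l2_scale[of "v i" "c i"] l2_lincomb[of A v c], of g]
    by (simp add: l2_inner_scale_left)
qed auto

lemma l2_inner_diff_right: "a \<in> l2 \<Longrightarrow> b \<in> l2 \<Longrightarrow> g \<in> l2 \<Longrightarrow> l2_inner g (\<lambda>\<alpha>. a \<alpha> - b \<alpha>) = l2_inner g a - l2_inner g b"
  by (simp add: l2_inner_cnj[of g] l2_inner_diff_left)

lemma l2_inner_scale_right: "a \<in> l2 \<Longrightarrow> g \<in> l2 \<Longrightarrow> l2_inner g (\<lambda>\<alpha>. c * a \<alpha>) = cnj c * l2_inner g a"
  by (simp add: l2_inner_cnj[of g] l2_inner_scale_left)

lemma l2_inner_sum_right: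
  assumes "\<And>i. i \<in> A \<Longrightarrow> v i \<in> l2" "g \<in> l2"
  shows "l2_inner g (\<lambda>\<alpha>. \<Sum>i\<in>A. c i * v i \<alpha>) = (\<Sum>i\<in>A. cnj (c i) * l2_inner g (v i))"
  using assms by (simp add: l2_inner_cnj[of g] l2_inner_sum_left)

lemma of_real_cmod_square: "(complex_of_real (cmod z))\<^sup>2 = z * cnj z"
  using complex_norm_square[of z] by simp

lemma l2_inner_self: "l2_inner a a = complex_of_real ((l2norm a)\<^sup>2)"
proof -
  have "l2_inner a a = (\<Sum>\<^sub>\<infinity>\<alpha>. complex_of_real ((cmod (a \<alpha>))\<^sup>2))"
    by (simp add: l2_inner_def of_real_cmod_square)
  also have "\<dots> = complex_of_real (\<Sum>\<^sub>\<infinity>\<alpha>. (cmod (a \<alpha>))\<^sup>2)"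
  proof (cases "(\<lambda>\<alpha>. (cmod (a \<alpha>))\<^sup>2) summable_on UNIV")
    case True
    from has_sum_of_real[OF has_sum_infsum[OF this]] show ?thesis by (rule infsumI)
  next
    case False
    moreover from False have "\<not> (\<lambda>\<alpha>. complex_of_real ((cmod (a \<alpha>))\<^sup>2)) summable_on UNIV"
      using summable_on_Re by fastforce
    ultimately show ?thesis by (simp add: infsum_not_exists)
  qed
  also have "(\<Sum>\<^sub>\<infinity>\<alpha>. (cmod (a \<alpha>))\<^sup>2) = (l2norm a)\<^sup>2"
    by (simp add: l2norm_def infsum_nonneg)
  finally show ?thesis .
qed

lemma l2norm_nonneg [simp]: "l2norm a \<ge> 0"
  by (simp add: l2norm_def infsum_nonneg)

lemma l2norm_eq_0:
  assumes "a \<in> l2" "l2norm a = 0"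
  shows "a = (\<lambda>_. 0)"
proof
  fix \<alpha>
  have "(\<Sum>\<^sub>\<infinity>\<alpha>. (cmod (a \<alpha>))\<^sup>2) \<le> 0" using assms(2) by (simp add: l2norm_def)
  hence "(cmod (a \<alpha>))\<^sup>2 = 0"
    using assms(1) by (intro nonneg_infsum_le_0D[of "\<lambda>\<alpha>. (cmod (a \<alpha>))\<^sup>2" UNIV]) (auto simp: l2_def)
  thus "a \<alpha> = 0" by simp
qed

lemma l2_inner_self_eq_0: "a \<in> l2 \<Longrightarrow> l2_inner a a = 0 \<Longrightarrow> a = (\<lambda>_. 0)"
  using l2norm_eq_0[of a] by (simp add: l2_inner_self)

text \<open>
  The vector \<open>c\<close> is \<open>a\<close> minus its projection to the line spanned by \<open>b\<close>; its norm is nonnegative.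
\<close>

lemma l2_inner_Cauchy_Schwarz:
  assumes a: "a \<in> l2" and b: "b \<in> l2"
  shows "cmod (l2_inner a b) \<le> l2norm a * l2norm b"
proof (cases "l2norm b = 0")
  case True
  hence "l2_inner a b = 0" using l2norm_eq_0[OF b] l2_inner_cnj[of a b] by simp
  thus ?thesis by simp
next
  case False
  define t where "t = l2_inner a b"
  define B where "B = (l2norm b)\<^sup>2"
  define A where "A = (l2norm a)\<^sup>2"
  have B: "B > 0" using False by (simp add: B_def)
  define k where "k = t / of_real B"
  define c where "c = (\<lambda>\<alpha>. a \<alpha> - k * b \<alpha>)"
  have c: "c \<in> l2" unfolding c_def by (intro l2_diff l2_scale a b)
  have ba: "l2_inner b a = cnj t" unfolding t_def by (rule l2_inner_cnj)
  have kb: "(\<lambda>\<alpha>. k * b \<alpha>) \<in> l2" by (intro l2_scale b)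
  have "l2_inner c c = l2_inner c a - cnj k * l2_inner c b"
    using l2_inner_diff_right[OF a kb c] l2_inner_scale_right[OF b c, of k] by (simp add: c_def)
  also have "l2_inner c a = l2_inner a a - k * l2_inner b a"
    using l2_inner_diff_left[OF a kb a] l2_inner_scale_left[OF b a, of k] by (simp add: c_def)
  also have "l2_inner c b = l2_inner a b - k * l2_inner b b"
    using l2_inner_diff_left[OF a kb b] l2_inner_scale_left[OF b b, of k] by (simp add: c_def)
  also have "l2_inner a a - k * l2_inner b a - cnj k * (l2_inner a b - k * l2_inner b b) = complex_of_real A - t * cnj t / of_real B"
  proof -
    have "k * complex_of_real B = t" "t * cnj t / complex_of_real B = k * cnj t" using B by (auto simp: k_def)
    thus ?thesis unfolding l2_inner_self ba t_def[symmetric] A_def[symmetric] B_def[symmetric] by simp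
  qed
  also have "\<dots> = complex_of_real (A - (cmod t)\<^sup>2 / B)"
    by (simp only: complex_norm_square of_real_diff of_real_divide)
  finally have "complex_of_real ((l2norm c)\<^sup>2) = complex_of_real (A - (cmod t)\<^sup>2 / B)"
    unfolding l2_inner_self .
  hence "(l2norm c)\<^sup>2 = A - (cmod t)\<^sup>2 / B" by (simp only: of_real_eq_iff)
  hence "(cmod t)\<^sup>2 / B \<le> A" by (metis diff_ge_0_iff_ge zero_le_power2)
  hence "(cmod t)\<^sup>2 \<le> A * B" using B by (simp add: field_simps)
  hence "(cmod t)\<^sup>2 \<le> (l2norm a * l2norm b)\<^sup>2" by (simp add: A_def B_def power_mult_distrib)
  thus ?thesis unfolding t_def by (rule power2_le_imp_le) simp
qed

definition orthonormal :: "('a \<Rightarrow> complex) set \<Rightarrow> bool" where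
  "orthonormal E \<longleftrightarrow> E \<subseteq> l2 \<and> (\<forall>e\<in>E. \<forall>e'\<in>E. l2_inner e e' = (if e = e' then 1 else 0))"

text \<open>
  The partial sum over \<open>F\<close> of the expansion of \<open>x\<close> in an orthonormal system.
\<close>

definition expand :: "('a \<Rightarrow> complex) set \<Rightarrow> ('a \<Rightarrow> complex) \<Rightarrow> ('a \<Rightarrow> complex)" where
  "expand F x = (\<lambda>\<alpha>. \<Sum>e\<in>F. l2_inner x e * e \<alpha>)"

lemma expand_l2: "orthonormal E \<Longrightarrow> F \<subseteq> E \<Longrightarrow> expand F x \<in> l2"
  unfolding expand_def orthonormal_def by (intro l2_lincomb) auto

lemma l2_inner_expand:
  assumes "orthonormal E" "F \<subseteq> E" "finite F" "e \<in> E" 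
  shows "l2_inner (expand F x) e = (if e \<in> F then l2_inner x e else 0)"
proof -
  have "l2_inner (expand F x) e = (\<Sum>e'\<in>F. l2_inner x e' * l2_inner e' e)"
    unfolding expand_def by (rule l2_inner_sum_left) (use assms in \<open>auto simp: orthonormal_def\<close>)
  also have "\<dots> = (\<Sum>e'\<in>F. if e' = e then l2_inner x e else 0)"
    by (intro sum.cong refl) (use assms in \<open>auto simp: orthonormal_def\<close>)
  finally show ?thesis using assms(3) by simp
qed

lemma norm_expand:
  assumes "orthonormal E" "F \<subseteq> E" "finite F"
  shows "(l2norm (expand F x))\<^sup>2 = (\<Sum>e\<in>F. (cmod (l2_inner x e))\<^sup>2)"
proof -
  have "l2_inner (expand F x) (expand F x) = (\<Sum>e\<in>F. cnj (l2_inner x e) * l2_inner (expand F x) e)"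
    by (subst (2) expand_def, rule l2_inner_sum_right)
       (use assms expand_l2[OF assms(1,2)] in \<open>auto simp: orthonormal_def\<close>)
  also have "\<dots> = (\<Sum>e\<in>F. complex_of_real ((cmod (l2_inner x e))\<^sup>2))"
    by (intro sum.cong refl) (subst l2_inner_expand[OF assms(1-3)], use assms(2) in \<open>auto simp: of_real_cmod_square mult.commute\<close>)
  finally have "complex_of_real ((l2norm (expand F x))\<^sup>2) = complex_of_real (\<Sum>e\<in>F. (cmod (l2_inner x e))\<^sup>2)"
    unfolding l2_inner_self by simp
  thus ?thesis by (simp only: of_real_eq_iff)
qed

lemma Bessel:
  assumes "orthonormal E" "F \<subseteq> E" "finite F" "x \<in> l2"
  shows "(\<Sum>e\<in>F. (cmod (l2_inner x e))\<^sup>2) \<le> (l2norm x)\<^sup>2"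
proof -
  let ?y = "expand F x"
  have y: "?y \<in> l2" by (rule expand_l2[OF assms(1,2)])
  have "l2_inner x ?y = (\<Sum>e\<in>F. cnj (l2_inner x e) * l2_inner x e)"
    unfolding expand_def by (rule l2_inner_sum_right) (use assms in \<open>auto simp: orthonormal_def\<close>)
  also have "\<dots> = complex_of_real (\<Sum>e\<in>F. (cmod (l2_inner x e))\<^sup>2)"
    by (simp add: of_real_cmod_square mult.commute)
  finally have xy: "l2_inner x ?y = complex_of_real ((l2norm ?y)\<^sup>2)"
    by (simp add: norm_expand[OF assms(1-3)])
  have yx: "l2_inner ?y x = complex_of_real ((l2norm ?y)\<^sup>2)" by (subst l2_inner_cnj) (simp add: xy)
  have "l2_inner (\<lambda>\<alpha>. x \<alpha> - ?y \<alpha>) (\<lambda>\<alpha>. x \<alpha> - ?y \<alpha>) = complex_of_real ((l2norm x)\<^sup>2 - (l2norm ?y)\<^sup>2)"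
    using assms(4) y by (subst l2_inner_diff_left) (auto intro: l2_diff simp: l2_inner_diff_right l2_inner_self[of x] l2_inner_self[of ?y] xy yx)
  hence "(l2norm (\<lambda>\<alpha>. x \<alpha> - ?y \<alpha>))\<^sup>2 = (l2norm x)\<^sup>2 - (l2norm ?y)\<^sup>2"
    unfolding l2_inner_self of_real_eq_iff .
  hence "(l2norm ?y)\<^sup>2 \<le> (l2norm x)\<^sup>2" by (metis diff_ge_0_iff_ge zero_le_power2)
  thus ?thesis by (simp add: norm_expand[OF assms(1-3)])
qed

lemma Bessel_summable:
  assumes "orthonormal E" "x \<in> l2"
  shows "(\<lambda>e. (cmod (l2_inner x e))\<^sup>2) summable_on E" "(\<Sum>\<^sub>\<infinity>e\<in>E. (cmod (l2_inner x e))\<^sup>2) \<le> (l2norm x)\<^sup>2"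
proof -
  have *: "(\<Sum>e\<in>F. (cmod (l2_inner x e))\<^sup>2) \<le> (l2norm x)\<^sup>2" if "finite F" "F \<subseteq> E" for F
    using Bessel assms that by blast
  show "(\<lambda>e. (cmod (l2_inner x e))\<^sup>2) summable_on E"
    by (rule nonneg_bdd_above_summable_on) (auto intro!: bdd_aboveI[of _ "(l2norm x)\<^sup>2"] *)
  thus "(\<Sum>\<^sub>\<infinity>e\<in>E. (cmod (l2_inner x e))\<^sup>2) \<le> (l2norm x)\<^sup>2"
    by (rule infsum_le_finite_sums) (rule *)
qed

lemma l2_inner_delta: 
  "l2_inner (\<lambda>\<beta>. if \<beta> = \<alpha> then 1 else 0) a = cnj (a \<alpha>)"
proof -
  have "l2_inner (\<lambda>\<beta>. if \<beta> = \<alpha> then 1 else 0) a = (\<Sum>\<^sub>\<infinity>\<beta>\<in>{\<alpha>}. cnj (a \<beta>))"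
    unfolding l2_inner_def by (rule infsum_cong_neutral) auto
  thus ?thesis by simp
qed

text \<open>
  The closed subspace \<open>V\<close> is given as an orthogonal complement, so that its closedness amounts to
  the continuity of the inner product. The expansion of \<open>x\<close> converges pointwise to some \<open>u\<close>; a Fatou
  argument over finite sets of indices shows that it also converges in norm, with error at most
  \<open>tail F\<close>. Then \<open>x - u\<close> lies in \<open>V\<close> and is orthogonal to \<open>E\<close>, so it vanishes.
\<close>

lemma Parseval:
  fixes \<Gamma> :: "('a \<Rightarrow> complex) set"
  defines "V \<equiv> {a \<in> l2. \<forall>g\<in>\<Gamma>. l2_inner a g = 0}"
  assumes \<Gamma>: "\<Gamma> \<subseteq> l2" and E: "orthonormal E" and EV: "E \<subseteq> V"
    and total: "\<And>f. f \<in> V \<Longrightarrow> (\<forall>e\<in>E. l2_inner f e = 0) \<Longrightarrow> f = (\<lambda>_. 0)"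
    and x: "x \<in> V" and y: "y \<in> l2"
  shows "((\<lambda>e. l2_inner x e * cnj (l2_inner y e)) has_sum l2_inner x y) E"
proof -
  have xl2: "x \<in> l2" using x by (simp add: V_def)
  have El2: "e \<in> l2" if "e \<in> E" for e using E that by (auto simp: orthonormal_def)
  define q where "q = (\<lambda>e. (cmod (l2_inner x e))\<^sup>2)"
  define tail where "tail = (\<lambda>F. infsum q E - sum q F)"
  note q_sum = Bessel_summable(1)[OF E xl2, folded q_def]
  have q_nonneg: "q e \<ge> 0" for e by (simp add: q_def)
  have sum_le: "sum q F \<le> infsum q E" if "finite F" "F \<subseteq> E" for F
    using finite_sum_le_infsum[OF q_sum that] q_nonneg by blast
  have "(sum q \<longlongrightarrow> infsum q E) (finite_subsets_at_top E)"
    using has_sum_infsum[OF q_sum] by (simp add: has_sum_def)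
  hence tail0: "(tail \<longlongrightarrow> 0) (finite_subsets_at_top E)"
    unfolding tail_def by (auto intro!: tendsto_eq_intros)
  define u where "u = (\<lambda>\<alpha>. \<Sum>\<^sub>\<infinity>e\<in>E. l2_inner x e * e \<alpha>)"
  have u: "((\<lambda>e. l2_inner x e * e \<alpha>) has_sum u \<alpha>) E" for \<alpha>
  proof -
    let ?d = "\<lambda>\<beta>. if \<beta> = \<alpha> then 1 else (0::complex)"
    have d: "?d \<in> l2" by (rule l2_finite_support[of "{\<alpha>}"]) auto
    have e_sum: "(\<lambda>e. (cmod (e \<alpha>))\<^sup>2) summable_on E"
      using Bessel_summable(1)[OF E d] by (simp add: l2_inner_delta)
    have "(\<lambda>e. norm (l2_inner x e * e \<alpha>)) summable_on E"
    proof (rule abs_summable_product)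
      show "(\<lambda>e. norm (l2_inner x e * l2_inner x e)) summable_on E"
        using q_sum by (simp only: q_def norm_mult power2_eq_square)
      show "(\<lambda>e. norm (e \<alpha> * e \<alpha>)) summable_on E"
        using e_sum by (simp only: norm_mult power2_eq_square)
    qed
    from has_sum_infsum[OF abs_summable_summable[OF this]] show ?thesis by (simp add: u_def)
  qed
  have bound: "(\<Sum>\<alpha>\<in>A. (cmod (u \<alpha> - expand F x \<alpha>))\<^sup>2) \<le> tail F"
    if A: "finite A" and F: "finite F" "F \<subseteq> E" for A F
  proof (rule tendsto_upperbound)
    show "((\<lambda>F'. \<Sum>\<alpha>\<in>A. (cmod (expand F' x \<alpha> - expand F x \<alpha>))\<^sup>2) \<longlongrightarrow>
        (\<Sum>\<alpha>\<in>A. (cmod (u \<alpha> - expand F x \<alpha>))\<^sup>2)) (finite_subsets_at_top E)"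
      unfolding expand_def using u by (intro tendsto_intros) (simp add: has_sum_def)
    show "\<forall>\<^sub>F F' in finite_subsets_at_top E. (\<Sum>\<alpha>\<in>A. (cmod (expand F' x \<alpha> - expand F x \<alpha>))\<^sup>2) \<le> tail F"
      unfolding eventually_finite_subsets_at_top
    proof (intro exI[of _ F] conjI F allI impI)
      fix F' assume F': "finite F' \<and> F \<subseteq> F' \<and> F' \<subseteq> E"
      have diff: "(\<lambda>\<alpha>. expand F' x \<alpha> - expand F x \<alpha>) = expand (F' - F) x"
        unfolding expand_def using F' F by (auto simp: sum_diff)
      have D: "F' - F \<subseteq> E" "finite (F' - F)" using F' by auto
      have "(\<Sum>\<alpha>\<in>A. (cmod (expand (F' - F) x \<alpha>))\<^sup>2) \<le> (l2norm (expand (F' - F) x))\<^sup>2"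
      proof -
        have "(\<Sum>\<alpha>\<in>A. (cmod (expand (F' - F) x \<alpha>))\<^sup>2) \<le> (\<Sum>\<^sub>\<infinity>\<alpha>. (cmod (expand (F' - F) x \<alpha>))\<^sup>2)"
          using expand_l2[OF E D(1), of x] A by (intro finite_sum_le_infsum) (auto simp: l2_def)
        thus ?thesis by (simp add: l2norm_def infsum_nonneg)
      qed
      also have "\<dots> = sum q (F' - F)" unfolding q_def by (rule norm_expand[OF E D])
      also have "\<dots> = sum q F' - sum q F" using F' F by (auto simp: sum_diff)
      also have "\<dots> \<le> tail F" using sum_le[of F'] F' by (simp add: tail_def)
      finally show "(\<Sum>\<alpha>\<in>A. (cmod (expand F' x \<alpha> - expand F x \<alpha>))\<^sup>2) \<le> tail F"
        unfolding fun_cong[OF diff] .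
    qed
  qed simp
  have ul2: "u \<in> l2"
    using bound[of _ "{}"] by (intro l2_bounded_sums(1)[of _ "tail {}"]) (simp add: expand_def)
  have normdiff: "l2norm (\<lambda>\<alpha>. u \<alpha> - expand F x \<alpha>) \<le> sqrt (tail F)" if "finite F" "F \<subseteq> E" for F
    unfolding l2norm_def using bound[OF _ that] by (intro real_sqrt_le_mono l2_bounded_sums(2)) 
  have conv: "((\<lambda>F. l2_inner (expand F x) g) \<longlongrightarrow> l2_inner u g) (finite_subsets_at_top E)" if g: "g \<in> l2" for g
  proof (rule LIM_zero_cancel, rule Lim_null_comparison)
    show "\<forall>\<^sub>F F in finite_subsets_at_top E. norm (l2_inner (expand F x) g - l2_inner u g) \<le> sqrt (tail F) * l2norm g"
    proof (rule eventually_finite_subsets_at_top_weakI)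
      fix F assume F: "finite F" "F \<subseteq> E"
      have "norm (l2_inner (expand F x) g - l2_inner u g) = cmod (l2_inner (\<lambda>\<alpha>. u \<alpha> - expand F x \<alpha>) g)"
        using ul2 expand_l2[OF E F(2)] g by (simp add: l2_inner_diff_left norm_minus_commute)
      also have "\<dots> \<le> l2norm (\<lambda>\<alpha>. u \<alpha> - expand F x \<alpha>) * l2norm g"
        by (intro l2_inner_Cauchy_Schwarz l2_diff ul2 expand_l2[OF E F(2)] g)
      also have "\<dots> \<le> sqrt (tail F) * l2norm g" by (intro mult_right_mono normdiff F) simp
      finally show "norm (l2_inner (expand F x) g - l2_inner u g) \<le> sqrt (tail F) * l2norm g" .
    qed
    have "((\<lambda>F. sqrt (tail F) * l2norm g) \<longlongrightarrow> sqrt 0 * l2norm g) (finite_subsets_at_top E)"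
      by (intro tendsto_intros tail0)
    thus "((\<lambda>F. sqrt (tail F) * l2norm g) \<longlongrightarrow> 0) (finite_subsets_at_top E)" by simp
  qed
  have nontriv: "finite_subsets_at_top E \<noteq> bot" by simp
  have uE: "l2_inner u e = l2_inner x e" if e: "e \<in> E" for e
  proof (rule tendsto_unique[OF nontriv conv[OF El2[OF e]]], rule tendsto_eventually)
    show "\<forall>\<^sub>F F in finite_subsets_at_top E. l2_inner (expand F x) e = l2_inner x e"
      unfolding eventually_finite_subsets_at_top
      by (intro exI[of _ "{e}"]) (use e l2_inner_expand[OF E _ _ e, of _ x] in auto)
  qed
  have "u \<in> V" unfolding V_def
  proof (intro CollectI conjI ballI ul2)
    fix g assume g: "g \<in> \<Gamma>"
    show "l2_inner u g = 0"
    proof (rule tendsto_unique[OF nontriv conv], use g \<Gamma> in blast, rule tendsto_eventually,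
        rule eventually_finite_subsets_at_top_weakI)
      fix F assume F: "finite F" "F \<subseteq> E"
      have "l2_inner (expand F x) g = (\<Sum>e\<in>F. l2_inner x e * l2_inner e g)" unfolding expand_def
        by (rule l2_inner_sum_left) (use F El2 g \<Gamma> in auto)
      also have "\<dots> = 0" using F EV g by (intro sum.neutral) (auto simp: V_def)
      finally show "l2_inner (expand F x) g = 0" .
    qed
  qed
  hence "(\<lambda>\<alpha>. x \<alpha> - u \<alpha>) \<in> V" using x \<Gamma> by (auto simp: V_def intro: l2_diff simp: l2_inner_diff_left subset_eq)
  moreover have "\<forall>e\<in>E. l2_inner (\<lambda>\<alpha>. x \<alpha> - u \<alpha>) e = 0"
    using uE El2 ul2 xl2 by (simp add: l2_inner_diff_left)
  ultimately have "(\<lambda>\<alpha>. x \<alpha> - u \<alpha>) = (\<lambda>_. 0)" by (rule total)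
  hence xu: "x = u" by (auto simp: fun_eq_iff)
  have "l2_inner (expand F x) y = (\<Sum>e\<in>F. l2_inner x e * cnj (l2_inner y e))" if "finite F" "F \<subseteq> E" for F
  proof -
    have "l2_inner (expand F x) y = (\<Sum>e\<in>F. l2_inner x e * l2_inner e y)"
      unfolding expand_def by (rule l2_inner_sum_left) (use that El2 y in auto)
    thus ?thesis by (simp add: l2_inner_cnj[of _ y])
  qed
  hence "\<forall>\<^sub>F F in finite_subsets_at_top E. l2_inner (expand F x) y = (\<Sum>e\<in>F. l2_inner x e * cnj (l2_inner y e))"
    by (intro eventually_finite_subsets_at_top_weakI)
  thus ?thesis unfolding has_sum_def using conv[OF y, folded xu] by (rule Lim_transform_eventually[rotated])
qed

text \<open>
  By Bessel's inequality the double series of \<open>\<langle>y p, e\<rangle> \<langle>e, x p\<rangle>\<close> converges absolutely. Summing it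
  over \<open>e\<close> first gives the right-hand side by \<open>Parseval\<close>, and summing it over \<open>p\<close> first gives the
  diagonal of \<open>T\<close> in the basis \<open>E\<close>. So the sum over the diagonal does not depend on \<open>E\<close>.
\<close>

lemma nuclear_trace:
  fixes \<Gamma> :: "('a \<Rightarrow> complex) set" and P :: "'p set"
  defines "V \<equiv> {a \<in> l2. \<forall>g\<in>\<Gamma>. l2_inner a g = 0}"
  assumes \<Gamma>: "\<Gamma> \<subseteq> l2" and E: "orthonormal E" and EV: "E \<subseteq> V"
    and total: "\<And>f. f \<in> V \<Longrightarrow> (\<forall>e\<in>E. l2_inner f e = 0) \<Longrightarrow> f = (\<lambda>_. 0)"
    and xV: "\<And>p. p \<in> P \<Longrightarrow> x p \<in> V" and yV: "\<And>p. p \<in> P \<Longrightarrow> y p \<in> V"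
    and summ: "(\<lambda>p. l2norm (x p) * l2norm (y p)) summable_on P"
    and T: "\<And>e. e \<in> E \<Longrightarrow> ((\<lambda>p. l2_inner e (x p) * l2_inner (y p) e) has_sum l2_inner (T e) e) P"
    and c: "((\<lambda>p. l2_inner (y p) (x p)) has_sum c) P"
  shows "((\<lambda>e. l2_inner (T e) e) has_sum c) E"
proof -
  define f where "f = (\<lambda>(p, e). l2_inner (y p) e * cnj (l2_inner (x p) e))"
  have l2: "x p \<in> l2" "y p \<in> l2" if "p \<in> P" for p using xV[OF that] yV[OF that] by (auto simp: V_def)
  have rows: "((\<lambda>e. f (p, e)) has_sum l2_inner (y p) (x p)) E" if "p \<in> P" for p
    unfolding f_def prod.case
    using Parseval[OF \<Gamma> E EV[unfolded V_def] total[unfolded V_def] yV[unfolded V_def] l2(1), of p p] that by blast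
  have fin: "(\<Sum>e\<in>F. norm (f (p, e))) \<le> l2norm (x p) * l2norm (y p)" if "p \<in> P" "finite F" "F \<subseteq> E" for p F
  proof -
    have "(\<Sum>e\<in>F. norm (f (p, e))) = (\<Sum>e\<in>F. \<bar>cmod (l2_inner (x p) e)\<bar> * \<bar>cmod (l2_inner (y p) e)\<bar>)"
      by (simp add: f_def norm_mult mult.commute)
    also have "\<dots> \<le> L2_set (\<lambda>e. cmod (l2_inner (x p) e)) F * L2_set (\<lambda>e. cmod (l2_inner (y p) e)) F"
      by (rule L2_set_mult_ineq)
    also have "\<dots> \<le> l2norm (x p) * l2norm (y p)"
      unfolding L2_set_def using Bessel[OF E that(3,2) l2(1)[OF that(1)]] Bessel[OF E that(3,2) l2(2)[OF that(1)]]
      by (intro mult_mono) (auto intro!: real_le_lsqrt sum_nonneg)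
    finally show ?thesis .
  qed
  have absrow: "(\<lambda>e. norm (f (p, e))) summable_on E" if "p \<in> P" for p
    by (rule nonneg_bdd_above_summable_on) (auto intro!: bdd_aboveI[of _ "l2norm (x p) * l2norm (y p)"] fin that)
  have "(\<lambda>z. norm (f z)) summable_on (P \<times> E)"
  proof (rule iffD2[OF Infinite_Sum.abs_summable_on_Sigma_iff], intro conjI ballI absrow)
    have "norm (\<Sum>\<^sub>\<infinity>e\<in>E. norm (f (p, e))) \<le> l2norm (x p) * l2norm (y p)" if "p \<in> P" for p
    proof -
      have "(\<Sum>\<^sub>\<infinity>e\<in>E. norm (f (p, e))) \<le> l2norm (x p) * l2norm (y p)"
        by (rule infsum_le_finite_sums[OF absrow[OF that]]) (rule fin[OF that])
      thus ?thesis by (simp add: infsum_nonneg)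
    qed
    hence "norm (\<Sum>\<^sub>\<infinity>e\<in>E. norm (f (p, e))) \<le> norm (l2norm (x p) * l2norm (y p))" if "p \<in> P" for p
      using that by simp
    thus "(\<lambda>p. norm (\<Sum>\<^sub>\<infinity>e\<in>E. norm (f (p, e)))) summable_on P"
      by (rule Infinite_Sum.abs_summable_on_comparison_test[rotated]) (use summ in simp_all)
  qed auto
  hence "f summable_on (P \<times> E)" by (rule abs_summable_summable)
  then obtain S where S: "(f has_sum S) (P \<times> E)" unfolding summable_on_def by blast
  have "((\<lambda>p. l2_inner (y p) (x p)) has_sum S) P" by (rule has_sum_SigmaD[OF S rows])
  hence "S = c" using c has_sum_unique by blast
  moreover have "((\<lambda>(e, p). f (p, e)) has_sum S) (E \<times> P)"
    using has_sum_swap[where f = f and A = P and B = E and S = S] S by simp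
  moreover have "((\<lambda>p. f (p, e)) has_sum l2_inner (T e) e) P" if "e \<in> E" for e
  proof -
    have "f (p, e) = l2_inner e (x p) * l2_inner (y p) e" for p
      unfolding f_def prod.case by (simp add: l2_inner_cnj[of _ e] mult.commute)
    thus ?thesis using T[OF that] by simp
  qed
  ultimately show ?thesis using has_sum_SigmaD[where f = "\<lambda>(e, p). f (p, e)" and S = c and A = E and B = "\<lambda>_. P"
        and g = "\<lambda>e. l2_inner (T e) e"] by simp
qed

section \<open>The Hardy space in terms of coefficients\<close>

lemma power_series_zero:
  fixes h :: "nat \<Rightarrow> complex"
  assumes "\<And>w. norm w < 1 \<Longrightarrow> (\<lambda>n. h n * w ^ n) sums 0"
  shows "h n = 0"
proof -
  define F where "F = Abs_fps h"
  have "ereal (norm (1/2 :: complex)) \<le> conv_radius h"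
    by (rule conv_radius_geI) (rule sums_summable, rule assms, simp)
  moreover have "(0 :: ereal) < ereal (norm (1/2 :: complex))" by simp
  ultimately have "conv_radius h > 0" by (rule less_le_trans[rotated])
  hence "fps_conv_radius F > 0" by (simp add: fps_conv_radius_def F_def)
  moreover have "eval_fps F w = 0" if "w \<in> ball 0 1" for w
    using assms[of w] that by (simp add: eval_fps_def F_def sums_iff)
  hence "eventually (\<lambda>w. eval_fps F w = eval_fps 0 w) (nhds 0)"
    by (intro eventually_nhds_in_open[of "ball 0 1", THEN eventually_mono]) auto
  ultimately have "F = 0" by (intro eval_fps_eqD) auto
  thus ?thesis by (metis F_def fps_nth_Abs_fps fps_zero_nth)
qed

text \<open>
  The exponents are fixed to those of \<open>\<alpha>0\<close> in one coordinate after the other: for fixed values of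
  the remaining variables, the series is a power series in \<open>z\<^sub>j\<close>, so its coefficient with exponent
  \<open>\<alpha>0\<^sub>j\<close> vanishes.
\<close>

lemma hardy_coefficients_zero:
  fixes c :: "('d::finite \<Rightarrow>\<^sub>0 nat) \<Rightarrow> complex"
  assumes c: "\<And>z. z \<in> polydisc \<Longrightarrow> ((\<lambda>\<alpha>. c \<alpha> * monom_fun \<alpha> z) has_sum 0) UNIV"
  shows "c \<alpha>0 = 0"
proof -
  let ?L = Poly_Mapping.lookup
  have "((\<lambda>\<alpha>. c \<alpha> * (\<Prod>i\<in>-A. (z $ i) ^ ?L \<alpha> i)) has_sum 0) {\<alpha>. \<forall>i\<in>A. ?L \<alpha> i = ?L \<alpha>0 i}"
    if "z \<in> polydisc" for A z
    using finite[of A] that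
  proof (induction A arbitrary: z rule: finite_induct)
    case empty
    have "((\<lambda>\<alpha>. c \<alpha> * monom_fun \<alpha> z) has_sum 0) UNIV" by (rule c[OF empty])
    moreover have "{\<alpha>. \<forall>i\<in>{}. ?L \<alpha> i = ?L \<alpha>0 i} = UNIV" "(- {} :: 'd set) = UNIV" by auto
    ultimately show ?case unfolding monom_fun_def by (simp only:)
  next
    case (insert j A)
    define S where "S = {\<alpha>. \<forall>i\<in>A. ?L \<alpha> i = ?L \<alpha>0 i}"
    define S' where "S' = (\<lambda>n. {\<alpha>\<in>S. ?L \<alpha> j = n})"
    define F where "F = (\<lambda>\<alpha>. c \<alpha> * (\<Prod>i\<in>-insert j A. (z $ i) ^ ?L \<alpha> i))"
    have sum_w: "((\<lambda>(n, \<alpha>). F \<alpha> * w ^ n) has_sum 0) (SIGMA n:UNIV. S' n)" if w: "norm w < 1" for w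
    proof -
      define z' where "z' = (\<chi> i. if i = j then w else z $ i)"
      have "z' \<in> polydisc" using insert.prems w by (auto simp: polydisc_def z'_def)
      from insert.IH[OF this]
      have "((\<lambda>\<alpha>. c \<alpha> * (\<Prod>i\<in>-A. (z' $ i) ^ ?L \<alpha> i)) has_sum 0) S" by (simp add: S_def)
      moreover have "c \<alpha> * (\<Prod>i\<in>-A. (z' $ i) ^ ?L \<alpha> i) = F \<alpha> * w ^ ?L \<alpha> j" for \<alpha>
      proof -
        have "- A = insert j (- insert j A)" using insert by auto
        moreover have "(\<Prod>i\<in>-insert j A. (z' $ i) ^ ?L \<alpha> i) = (\<Prod>i\<in>-insert j A. (z $ i) ^ ?L \<alpha> i)"
          by (intro prod.cong) (auto simp: z'_def)
        ultimately show ?thesis by (simp add: F_def z'_def)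
      qed
      ultimately have "((\<lambda>\<alpha>. F \<alpha> * w ^ ?L \<alpha> j) has_sum 0) S" by simp
      also have "?this \<longleftrightarrow> ?thesis"
        by (rule has_sum_reindex_bij_witness[of _ snd "\<lambda>\<alpha>. (?L \<alpha> j, \<alpha>)"]) (auto simp: S'_def)
      finally show ?thesis .
    qed
    have F_summable: "F summable_on S' n" for n
    proof -
      have "(\<lambda>(n, \<alpha>). F \<alpha> * (1/2) ^ n) summable_on (SIGMA n:UNIV. S' n)"
        using sum_w[of "1/2"] by (auto simp: summable_on_def)
      hence "(\<lambda>\<alpha>. F \<alpha> * (1/2) ^ n) summable_on S' n"
        by (rule summable_on_SigmaD1[where f = "\<lambda>n \<alpha>. F \<alpha> * (1/2) ^ n"]) simp
      hence "(\<lambda>\<alpha>. F \<alpha> * (1/2) ^ n * 2 ^ n) summable_on S' n" by (rule summable_on_cmult_left)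
      moreover have "F \<alpha> * (1/2) ^ n * 2 ^ n = F \<alpha>" for \<alpha> by (simp add: power_divide)
      ultimately show ?thesis by (simp only:)
    qed
    define h where "h = (\<lambda>n. infsum F (S' n))"
    have "(\<lambda>n. h n * w ^ n) sums 0" if w: "norm w < 1" for w
    proof -
      have "((\<lambda>n. h n * w ^ n) has_sum 0) UNIV"
        using sum_w[OF w] by (rule has_sum_SigmaD)
          (auto simp: h_def intro!: has_sum_cmult_left has_sum_infsum F_summable)
      thus ?thesis by (rule has_sum_imp_sums)
    qed
    hence "h (?L \<alpha>0 j) = 0" by (rule power_series_zero)
    hence "(F has_sum 0) (S' (?L \<alpha>0 j))" using has_sum_infsum[OF F_summable] by (metis h_def)
    moreover have "S' (?L \<alpha>0 j) = {\<alpha>. \<forall>i\<in>insert j A. ?L \<alpha> i = ?L \<alpha>0 i}" by (auto simp: S'_def S_def)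
    ultimately show ?case by (simp add: F_def)
  qed
  from this[of 0 UNIV] have "((\<lambda>\<alpha>. c \<alpha> * (\<Prod>i\<in>-UNIV. ((0::complex ^ 'd) $ i) ^ ?L \<alpha> i)) has_sum 0) {\<alpha>. \<forall>i\<in>UNIV. ?L \<alpha> i = ?L \<alpha>0 i}"
    by (auto simp: polydisc_def)
  moreover have "{\<alpha>. \<forall>i\<in>UNIV. ?L \<alpha> i = ?L \<alpha>0 i} = {\<alpha>0}" by (auto intro: poly_mapping_eqI)
  ultimately have "(c has_sum 0) {\<alpha>0}" by simp
  thus ?thesis using has_sum_finite[of "{\<alpha>0}" c] has_sum_unique by fastforce
qed

lemma summable_prod_powers:
  fixes x :: "'d::finite \<Rightarrow> real"
  assumes "\<And>i. 0 \<le> x i" "\<And>i. x i < 1"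
  shows "(\<lambda>\<alpha> :: 'd \<Rightarrow>\<^sub>0 nat. \<Prod>i\<in>UNIV. x i ^ Poly_Mapping.lookup \<alpha> i) summable_on UNIV"
proof (rule nonneg_bdd_above_summable_on)
  show "bdd_above (sum (\<lambda>\<alpha> :: 'd \<Rightarrow>\<^sub>0 nat. \<Prod>i\<in>UNIV. x i ^ Poly_Mapping.lookup \<alpha> i) ` {F. F \<subseteq> UNIV \<and> finite F})"
  proof (rule bdd_aboveI2)
    fix F :: "('d \<Rightarrow>\<^sub>0 nat) set" assume F: "F \<in> {F. F \<subseteq> UNIV \<and> finite F}"
    define m where "m = (\<Sum>\<alpha>\<in>F. tdeg \<alpha>)"
    have le: "Poly_Mapping.lookup \<alpha> i \<le> m" if "\<alpha> \<in> F" for \<alpha> i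
      using lookup_le_tdeg[of \<alpha> i] member_le_sum[of \<alpha> F tdeg] that F unfolding m_def by force
    have inj: "inj_on Poly_Mapping.lookup F" by (intro inj_onI poly_mapping_eqI) (rule fun_cong)
    have "(\<Sum>\<alpha>\<in>F. \<Prod>i\<in>UNIV. x i ^ Poly_Mapping.lookup \<alpha> i) = (\<Sum>f\<in>Poly_Mapping.lookup ` F. \<Prod>i\<in>UNIV. x i ^ f i)"
      by (simp add: sum.reindex[OF inj])
    also have "\<dots> \<le> (\<Sum>f\<in>PiE UNIV (\<lambda>_. {..m}). \<Prod>i\<in>UNIV. x i ^ f i)"
    proof (rule sum_mono2)
      show "finite (PiE (UNIV :: 'd set) (\<lambda>_. {..m}))" by (intro finite_PiE) auto
      show "Poly_Mapping.lookup ` F \<subseteq> PiE UNIV (\<lambda>_. {..m})"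
        by (rule image_subsetI) (simp add: PiE_UNIV_domain le)
    qed (intro prod_nonneg zero_le_power assms ballI)
    also have "\<dots> = (\<Prod>i\<in>UNIV. \<Sum>n\<le>m. x i ^ n)"
      by (rule prod_sum_PiE[symmetric]) auto
    also have "\<dots> \<le> (\<Prod>i\<in>UNIV. 1 / (1 - x i))"
    proof (rule prod_mono, intro conjI)
      fix i
      show "0 \<le> (\<Sum>n\<le>m. x i ^ n)" by (intro sum_nonneg) (simp add: assms)
      have "(\<Sum>n\<le>m. x i ^ n) \<le> suminf (\<lambda>n. x i ^ n)"
        by (rule sum_le_suminf) (use assms[of i] in \<open>auto intro: summable_geometric\<close>)
      thus "(\<Sum>n\<le>m. x i ^ n) \<le> 1 / (1 - x i)" using assms[of i] by (simp add: suminf_geometric)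
    qed
    finally show "(\<Sum>\<alpha>\<in>F. \<Prod>i\<in>UNIV. x i ^ Poly_Mapping.lookup \<alpha> i) \<le> (\<Prod>i\<in>UNIV. 1 / (1 - x i))" .
  qed
qed (intro prod_nonneg zero_le_power assms ballI)

text \<open>
  The reproducing kernel at \<open>z\<close>, which makes the series of an element of the Hardy space converge
  absolutely.
\<close>

lemma monom_fun_l2:
  assumes "z \<in> polydisc"
  shows "(\<lambda>\<alpha>. cnj (monom_fun \<alpha> z)) \<in> l2"
proof -
  have "(cmod (cnj (monom_fun \<alpha> z)))\<^sup>2 = (\<Prod>i\<in>UNIV. ((cmod (z $ i))\<^sup>2) ^ Poly_Mapping.lookup \<alpha> i)" for \<alpha>
    by (simp add: monom_fun_def norm_power prod_power_distrib mult.commute flip: prod_norm power_mult)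
  thus ?thesis unfolding l2_def
    using summable_prod_powers[of "\<lambda>i. (cmod (z $ i))\<^sup>2"] assms
    by (simp add: polydisc_def power_less_one_iff abs_square_less_1)
qed

definition hfun :: "(('d::finite \<Rightarrow>\<^sub>0 nat) \<Rightarrow> complex) \<Rightarrow> complex ^ 'd \<Rightarrow> complex" where
  "hfun a z = (if z \<in> polydisc then \<Sum>\<^sub>\<infinity>\<alpha>. a \<alpha> * monom_fun \<alpha> z else 0)"

lemma hfun_has_sum:
  assumes "a \<in> l2" "z \<in> polydisc"
  shows "((\<lambda>\<alpha>. a \<alpha> * monom_fun \<alpha> z) has_sum hfun a z) UNIV"
  using l2_inner_has_sum[OF assms(1) monom_fun_l2[OF assms(2)]] assms(2) by (simp add: hfun_def l2_inner_def)

lemma hardy_expansion_hfun: "a \<in> l2 \<Longrightarrow> hardy_expansion a (hfun a)"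
  unfolding hardy_expansion_def
  by (intro conjI ballI allI impI hfun_has_sum) (simp_all add: l2_def hfun_def)

lemma hardy_expansion_unique:
  assumes "hardy_expansion a f" "hardy_expansion b f"
  shows "a = b"
proof
  fix \<alpha>
  have "((\<lambda>\<alpha>. (a \<alpha> - b \<alpha>) * monom_fun \<alpha> z) has_sum 0) UNIV" if "z \<in> polydisc" for z
  proof -
    have "((\<lambda>\<alpha>. a \<alpha> * monom_fun \<alpha> z + - (b \<alpha> * monom_fun \<alpha> z)) has_sum f z + - f z) UNIV"
      using assms that by (intro has_sum_add has_sum_uminusI) (auto simp: hardy_expansion_def)
    thus ?thesis by (simp add: algebra_simps)
  qed
  hence "a \<alpha> - b \<alpha> = 0" by (rule hardy_coefficients_zero)
  thus "a \<alpha> = b \<alpha>" by simp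
qed

lemma hardy_expansion_imp:
  assumes "hardy_expansion a f"
  shows "a \<in> l2" "f = hfun a"
proof -
  show a: "a \<in> l2" using assms by (simp add: hardy_expansion_def l2_def)
  show "f = hfun a"
  proof
    fix z
    show "f z = hfun a z"
    proof (cases "z \<in> polydisc")
      case True
      have "((\<lambda>\<alpha>. a \<alpha> * monom_fun \<alpha> z) has_sum f z) UNIV"
        using assms True by (simp add: hardy_expansion_def)
      thus ?thesis using hfun_has_sum[OF a True] by (rule has_sum_unique)
    next
      case False
      thus ?thesis using assms by (simp add: hardy_expansion_def hfun_def)
    qed
  qed
qed

lemma hardy_coeff_eqI: "hardy_expansion a f \<Longrightarrow> hardy_coeff f = a"
  unfolding hardy_coeff_def by (rule the_equality) (auto intro: hardy_expansion_unique)

lemma hardy_coeff_hfun [simp]: "a \<in> l2 \<Longrightarrow> hardy_coeff (hfun a) = a"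
  by (intro hardy_coeff_eqI hardy_expansion_hfun)

lemma hardy_eq: "hardy = hfun ` l2"
  unfolding hardy_def using hardy_expansion_hfun hardy_expansion_imp by blast

lemma hardy_inner_hfun [simp]: "a \<in> l2 \<Longrightarrow> b \<in> l2 \<Longrightarrow> hardy_inner (hfun a) (hfun b) = l2_inner a b"
  by (simp add: hardy_inner_def l2_inner_def)

lemma hardy_norm_hfun [simp]: "a \<in> l2 \<Longrightarrow> hardy_norm (hfun a) = l2norm a"
  by (simp add: hardy_norm_def l2_inner_self)

lemma hfun_lincomb:
  assumes "\<And>i. i \<in> A \<Longrightarrow> v i \<in> l2"
  shows "hfun (\<lambda>\<alpha>. \<Sum>i\<in>A. c i * v i \<alpha>) z = (\<Sum>i\<in>A. c i * hfun (v i) z)"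
proof (cases "z \<in> polydisc")
  case True
  have "((\<lambda>\<alpha>. (\<Sum>i\<in>A. c i * v i \<alpha>) * monom_fun \<alpha> z) has_sum (\<Sum>i\<in>A. c i * hfun (v i) z)) UNIV"
    using assms
  proof (induction A rule: infinite_finite_induct)
    case (insert i A)
    have "((\<lambda>\<alpha>. c i * (v i \<alpha> * monom_fun \<alpha> z) + (\<Sum>i\<in>A. c i * v i \<alpha>) * monom_fun \<alpha> z)
        has_sum (c i * hfun (v i) z + (\<Sum>i\<in>A. c i * hfun (v i) z))) UNIV"
      using insert True by (intro has_sum_add has_sum_cmult_right hfun_has_sum) auto
    thus ?case using insert by (simp add: algebra_simps)
  qed auto
  moreover have "((\<lambda>\<alpha>. (\<Sum>i\<in>A. c i * v i \<alpha>) * monom_fun \<alpha> z) has_sum hfun (\<lambda>\<alpha>. \<Sum>i\<in>A. c i * v i \<alpha>) z) UNIV"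
    using True by (intro hfun_has_sum l2_lincomb assms)
  ultimately show ?thesis using has_sum_unique by blast
qed (simp add: hfun_def)

lemma hfun_diff: "a \<in> l2 \<Longrightarrow> b \<in> l2 \<Longrightarrow> hfun a - hfun b = hfun (\<lambda>\<alpha>. a \<alpha> - b \<alpha>)"
proof
  fix z assume "a \<in> l2" "b \<in> l2"
  thus "(hfun a - hfun b) z = hfun (\<lambda>\<alpha>. a \<alpha> - b \<alpha>) z"
    using hfun_lincomb[of "{True, False}" "\<lambda>x. if x then a else b" "\<lambda>x. if x then 1 else -1" z]
    by simp
qed

lemma hfun_inj: "a \<in> l2 \<Longrightarrow> b \<in> l2 \<Longrightarrow> hfun a = hfun b \<longleftrightarrow> a = b"
  using hardy_coeff_hfun by metis

lemma lookup_l2: "Poly_Mapping.lookup p \<in> l2" for p :: "'a \<Rightarrow>\<^sub>0 complex"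
  by (rule l2_finite_support[of "Poly_Mapping.keys p"]) (auto simp: in_keys_iff)

lemma hardy_of_mpoly_eq: "hardy_of_mpoly p = hfun (Poly_Mapping.lookup p)"
proof
  fix z
  have "(\<Sum>\<^sub>\<infinity>\<alpha>. Poly_Mapping.lookup p \<alpha> * monom_fun \<alpha> z) = (\<Sum>\<^sub>\<infinity>\<alpha>\<in>Poly_Mapping.keys p. Poly_Mapping.lookup p \<alpha> * monom_fun \<alpha> z)"
    by (rule infsum_cong_neutral) (auto simp: in_keys_iff)
  thus "hardy_of_mpoly p z = hfun (Poly_Mapping.lookup p) z"
    by (simp add: hardy_of_mpoly_def hfun_def mpoly_eval_def)
qed

lemma l2_inner_lookup: "l2_inner a (Poly_Mapping.lookup p) = cnj (pairing (\<lambda>\<alpha>. cnj (a \<alpha>)) p)"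
proof -
  have "l2_inner a (Poly_Mapping.lookup p) = (\<Sum>\<^sub>\<infinity>\<alpha>\<in>Poly_Mapping.keys p. a \<alpha> * cnj (Poly_Mapping.lookup p \<alpha>))"
    unfolding l2_inner_def by (rule infsum_cong_neutral) (auto simp: in_keys_iff)
  thus ?thesis by (simp add: pairing_def mult.commute)
qed

text \<open>
  Multiplication by the monomial with exponent \<open>\<beta>\<close>, on coefficients. Subtraction of multi-indices
  is truncated, hence the condition.
\<close>

definition shift :: "('d::finite \<Rightarrow>\<^sub>0 nat) \<Rightarrow> (('d \<Rightarrow>\<^sub>0 nat) \<Rightarrow> complex) \<Rightarrow> ('d \<Rightarrow>\<^sub>0 nat) \<Rightarrow> complex" where
  "shift \<beta> a \<alpha> = (if \<alpha> \<in> range ((+) \<beta>) then a (\<alpha> - \<beta>) else 0)"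

text \<open>
  The adjoint of \<open>shift\<close>.
\<close>

definition backshift :: "('d::finite \<Rightarrow>\<^sub>0 nat) \<Rightarrow> (('d \<Rightarrow>\<^sub>0 nat) \<Rightarrow> complex) \<Rightarrow> ('d \<Rightarrow>\<^sub>0 nat) \<Rightarrow> complex" where
  "backshift \<beta> a \<alpha> = a (\<beta> + \<alpha>)"

lemma shift_add [simp]: "shift \<beta> a (\<beta> + \<alpha>) = a \<alpha>"
  by (simp add: shift_def)

lemma shift_outside: "\<alpha> \<notin> range ((+) \<beta>) \<Longrightarrow> shift \<beta> a \<alpha> = 0"
  by (simp add: shift_def)

lemma inj_shift: "inj ((+) (\<beta> :: 'd::finite \<Rightarrow>\<^sub>0 nat))"
  by simp

lemma has_sum_shift:
  fixes g :: "('d::finite \<Rightarrow>\<^sub>0 nat) \<Rightarrow> 'b::{comm_monoid_add, topological_space}"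
  assumes "\<And>\<alpha>. \<alpha> \<notin> range ((+) \<beta>) \<Longrightarrow> g \<alpha> = 0"
  shows "(g has_sum s) UNIV \<longleftrightarrow> ((\<lambda>\<alpha>. g (\<beta> + \<alpha>)) has_sum s) UNIV"
proof -
  have "(g has_sum s) UNIV \<longleftrightarrow> (g has_sum s) (range ((+) \<beta>))"
    by (rule has_sum_cong_neutral) (use assms in auto)
  also have "\<dots> \<longleftrightarrow> ((\<lambda>\<alpha>. g (\<beta> + \<alpha>)) has_sum s) UNIV"
    by (subst has_sum_reindex[OF inj_shift]) (simp add: o_def)
  finally show ?thesis .
qed

lemma shift_l2:
  assumes "a \<in> l2"
  shows "shift \<beta> a \<in> l2"
proof -
  obtain s where "((\<lambda>\<alpha>. (cmod (a \<alpha>))\<^sup>2) has_sum s) UNIV"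
    using assms by (auto simp: l2_def summable_on_def)
  hence "((\<lambda>\<alpha>. (cmod (shift \<beta> a \<alpha>))\<^sup>2) has_sum s) UNIV"
    by (subst has_sum_shift[of \<beta>]) (auto simp: shift_outside)
  thus ?thesis by (auto simp: l2_def summable_on_def)
qed

lemma backshift_l2:
  assumes "a \<in> l2"
  shows "backshift \<beta> a \<in> l2"
proof -
  have "(\<lambda>\<alpha>. (cmod (a \<alpha>))\<^sup>2) summable_on range ((+) \<beta>)"
    using assms unfolding l2_def by (auto intro: summable_on_subset_banach)
  thus ?thesis by (subst (asm) summable_on_reindex[OF inj_shift]) (simp add: l2_def backshift_def o_def)
qed

lemma l2_inner_shift: "l2_inner (shift \<beta> a) b = l2_inner a (backshift \<beta> b)" if "a \<in> l2" "b \<in> l2"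
proof -
  have "((\<lambda>\<alpha>. shift \<beta> a \<alpha> * cnj (b \<alpha>)) has_sum l2_inner (shift \<beta> a) b) UNIV"
    by (intro l2_inner_has_sum shift_l2 that)
  hence "((\<lambda>\<alpha>. a \<alpha> * cnj (b (\<beta> + \<alpha>))) has_sum l2_inner (shift \<beta> a) b) UNIV"
    by (subst (asm) has_sum_shift[of \<beta>]) (auto simp: shift_outside)
  moreover have "((\<lambda>\<alpha>. a \<alpha> * cnj (b (\<beta> + \<alpha>))) has_sum l2_inner a (backshift \<beta> b)) UNIV"
    using l2_inner_has_sum[OF that(1) backshift_l2[OF that(2)]] by (simp add: backshift_def)
  ultimately show ?thesis using has_sum_unique by blast
qed

lemma hfun_shift:
  assumes "a \<in> l2"
  shows "hfun (shift \<beta> a) z = monom_fun \<beta> z * hfun a z"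
proof (cases "z \<in> polydisc")
  case True
  have "((\<lambda>\<alpha>. monom_fun \<beta> z * (a \<alpha> * monom_fun \<alpha> z)) has_sum monom_fun \<beta> z * hfun a z) UNIV"
    by (intro has_sum_cmult_right hfun_has_sum assms True)
  hence "((\<lambda>\<alpha>. shift \<beta> a \<alpha> * monom_fun \<alpha> z) has_sum monom_fun \<beta> z * hfun a z) UNIV"
    by (subst has_sum_shift[of \<beta>]) (auto simp: shift_outside monom_fun_add mult_ac)
  moreover have "((\<lambda>\<alpha>. shift \<beta> a \<alpha> * monom_fun \<alpha> z) has_sum hfun (shift \<beta> a) z) UNIV"
    by (intro hfun_has_sum shift_l2 assms True)
  ultimately show ?thesis using has_sum_unique by blast
qed (simp add: hfun_def)

definition mult_coeff :: "'d::finite mpoly \<Rightarrow> (('d \<Rightarrow>\<^sub>0 nat) \<Rightarrow> complex) \<Rightarrow> ('d \<Rightarrow>\<^sub>0 nat) \<Rightarrow> complex" where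
  "mult_coeff p a = (\<lambda>\<alpha>. \<Sum>\<beta>\<in>Poly_Mapping.keys p. Poly_Mapping.lookup p \<beta> * shift \<beta> a \<alpha>)"

definition mult_coeff_adj :: "'d::finite mpoly \<Rightarrow> (('d \<Rightarrow>\<^sub>0 nat) \<Rightarrow> complex) \<Rightarrow> ('d \<Rightarrow>\<^sub>0 nat) \<Rightarrow> complex" where
  "mult_coeff_adj p a = (\<lambda>\<alpha>. \<Sum>\<beta>\<in>Poly_Mapping.keys p. cnj (Poly_Mapping.lookup p \<beta>) * backshift \<beta> a \<alpha>)"

lemma mult_coeff_l2: "a \<in> l2 \<Longrightarrow> mult_coeff p a \<in> l2"
  unfolding mult_coeff_def by (intro l2_lincomb shift_l2)

lemma mult_coeff_adj_l2: "a \<in> l2 \<Longrightarrow> mult_coeff_adj p a \<in> l2"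
  unfolding mult_coeff_adj_def by (intro l2_lincomb backshift_l2)

lemma l2_inner_mult_coeff: "a \<in> l2 \<Longrightarrow> b \<in> l2 \<Longrightarrow> l2_inner (mult_coeff p a) b = l2_inner a (mult_coeff_adj p b)"
  unfolding mult_coeff_def mult_coeff_adj_def
  by (subst l2_inner_sum_left, simp add: shift_l2, simp, subst l2_inner_sum_right, simp add: backshift_l2, simp)
     (simp add: l2_inner_shift)

lemma mult_op_hfun:
  assumes "a \<in> l2"
  shows "mult_op p (hfun a) = hfun (mult_coeff p a)"
proof
  fix z
  show "mult_op p (hfun a) z = hfun (mult_coeff p a) z"
    unfolding mult_coeff_def
    by (subst hfun_lincomb, rule shift_l2[OF assms])
       (simp add: mult_op_def mpoly_eval_def hfun_shift[OF assms] sum_distrib_right mult.assoc)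
qed

section \<open>Graded subspaces with a homogeneous orthonormal basis\<close>

definition slice :: "nat \<Rightarrow> (('d::finite \<Rightarrow>\<^sub>0 nat) \<Rightarrow> complex) \<Rightarrow> ('d \<Rightarrow>\<^sub>0 nat) \<Rightarrow> complex" where
  "slice n a \<alpha> = (if tdeg \<alpha> = n then a \<alpha> else 0)"

lemma slice_l2 [simp]: "slice n a \<in> l2"
  by (rule l2_finite_support[of "homog n"]) (auto simp: slice_def)

lemma l2_inner_homogeneous:
  assumes "\<And>\<alpha>. tdeg \<alpha> \<noteq> n \<Longrightarrow> b \<alpha> = 0"
  shows "l2_inner a b = (\<Sum>\<alpha>\<in>homog n. a \<alpha> * cnj (b \<alpha>))"
proof -
  have "l2_inner a b = (\<Sum>\<^sub>\<infinity>\<alpha>\<in>homog n. a \<alpha> * cnj (b \<alpha>))"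
    unfolding l2_inner_def by (rule infsum_cong_neutral) (use assms in auto)
  thus ?thesis by simp
qed

lemma l2_inner_slice: "(\<And>\<alpha>. tdeg \<alpha> \<noteq> n \<Longrightarrow> b \<alpha> = 0) \<Longrightarrow> l2_inner (slice n a) b = l2_inner a b"
  by (subst (1 2) l2_inner_homogeneous[of n]) (auto simp: slice_def)

lemma l2_by_degree:
  fixes a c :: "('d::finite \<Rightarrow>\<^sub>0 nat) \<Rightarrow> complex"
  assumes "a \<in> l2" and le: "\<And>n. (\<Sum>\<alpha>\<in>homog n. (cmod (c \<alpha>))\<^sup>2) \<le> (\<Sum>\<alpha>\<in>homog n. (cmod (a \<alpha>))\<^sup>2)"
  shows "c \<in> l2"
proof (rule l2_bounded_sums(1))
  fix A :: "('d \<Rightarrow>\<^sub>0 nat) set" assume A: "finite A"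
  define D where "D = tdeg ` A"
  have D: "finite D" using A by (simp add: D_def)
  have fin: "finite (\<Union>n\<in>D. homog n :: ('d \<Rightarrow>\<^sub>0 nat) set)" using D by simp
  have disj: "\<forall>n\<in>D. \<forall>m\<in>D. n \<noteq> m \<longrightarrow> homog n \<inter> (homog m :: ('d \<Rightarrow>\<^sub>0 nat) set) = {}" by auto
  have "(\<Sum>\<alpha>\<in>A. (cmod (c \<alpha>))\<^sup>2) \<le> (\<Sum>\<alpha>\<in>(\<Union>n\<in>D. homog n). (cmod (c \<alpha>))\<^sup>2)"
    by (rule sum_mono2[OF fin]) (auto simp: D_def)
  also have "\<dots> = (\<Sum>n\<in>D. \<Sum>\<alpha>\<in>homog n. (cmod (c \<alpha>))\<^sup>2)"
    by (rule sum.UNION_disjoint[OF D _ disj]) simp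
  also have "\<dots> \<le> (\<Sum>n\<in>D. \<Sum>\<alpha>\<in>homog n. (cmod (a \<alpha>))\<^sup>2)"
    by (rule sum_mono) (rule le)
  also have "\<dots> = (\<Sum>\<alpha>\<in>(\<Union>n\<in>D. homog n). (cmod (a \<alpha>))\<^sup>2)"
    by (rule sum.UNION_disjoint[OF D _ disj, symmetric]) simp
  also have "\<dots> \<le> (\<Sum>\<^sub>\<infinity>\<alpha>. (cmod (a \<alpha>))\<^sup>2)"
    using assms(1) by (intro finite_sum_le_infsum fin) (auto simp: l2_def)
  finally show "(\<Sum>\<alpha>\<in>A. (cmod (c \<alpha>))\<^sup>2) \<le> (\<Sum>\<^sub>\<infinity>\<alpha>. (cmod (a \<alpha>))\<^sup>2)" .
qed

text \<open>
  A graded subspace \<open>V\<close>, given as the orthogonal complement of \<open>\<Gamma>\<close>, together with orthonormal bases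
  \<open>b (n, j)\<close>, \<open>j < r n\<close>, of its homogeneous parts. The grading makes the orthogonal projection a
  finite sum at each multi-index, so no limits are needed to define it.
\<close>

locale graded_basis =
  fixes V \<Gamma> :: "(('d::finite \<Rightarrow>\<^sub>0 nat) \<Rightarrow> complex) set"
    and r :: "nat \<Rightarrow> nat" and b :: "nat \<times> nat \<Rightarrow> ('d \<Rightarrow>\<^sub>0 nat) \<Rightarrow> complex"
  assumes \<Gamma>: "\<Gamma> \<subseteq> l2" and V_def: "V = {a \<in> l2. \<forall>g\<in>\<Gamma>. l2_inner a g = 0}"
    and slice_mem: "\<And>a n. a \<in> V \<Longrightarrow> slice n a \<in> V"
    and slices_mem: "\<And>a. a \<in> l2 \<Longrightarrow> (\<And>n. slice n a \<in> V) \<Longrightarrow> a \<in> V"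
    and b_mem: "\<And>n j. j < r n \<Longrightarrow> b (n, j) \<in> V"
    and b_homogeneous: "\<And>n j \<alpha>. j < r n \<Longrightarrow> tdeg \<alpha> \<noteq> n \<Longrightarrow> b (n, j) \<alpha> = 0"
    and b_orthonormal: "\<And>n j k. j < r n \<Longrightarrow> k < r n \<Longrightarrow> l2_inner (b (n, j)) (b (n, k)) = (if j = k then 1 else 0)"
    and b_total: "\<And>a n. a \<in> V \<Longrightarrow> (\<And>\<alpha>. tdeg \<alpha> \<noteq> n \<Longrightarrow> a \<alpha> = 0) \<Longrightarrow>
       (\<And>j. j < r n \<Longrightarrow> l2_inner a (b (n, j)) = 0) \<Longrightarrow> a = (\<lambda>_. 0)"
begin

definition I :: "(nat \<times> nat) set" where "I = (SIGMA n:UNIV. {..<r n})"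

definition level :: "nat \<Rightarrow> (nat \<times> nat) set" where "level n = {n} \<times> {..<r n}"

definition coord :: "(('d \<Rightarrow>\<^sub>0 nat) \<Rightarrow> complex) \<Rightarrow> nat \<times> nat \<Rightarrow> complex" where "coord a i = l2_inner a (b i)"

definition proj :: "(('d \<Rightarrow>\<^sub>0 nat) \<Rightarrow> complex) \<Rightarrow> ('d \<Rightarrow>\<^sub>0 nat) \<Rightarrow> complex" where
  "proj a \<alpha> = (\<Sum>j<r (tdeg \<alpha>). coord a (tdeg \<alpha>, j) * b (tdeg \<alpha>, j) \<alpha>)"

lemma V_l2: "a \<in> V \<Longrightarrow> a \<in> l2"
  by (simp add: V_def)

lemma b_V: "i \<in> I \<Longrightarrow> b i \<in> V"
  by (auto simp: I_def b_mem)

lemma b_l2: "i \<in> I \<Longrightarrow> b i \<in> l2"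
  by (intro V_l2 b_V)

lemma V_lincomb:
  assumes "\<And>x. x \<in> A \<Longrightarrow> v x \<in> V"
  shows "(\<lambda>\<alpha>. \<Sum>x\<in>A. c x * v x \<alpha>) \<in> V"
  unfolding V_def
proof (intro CollectI conjI ballI)
  show "(\<lambda>\<alpha>. \<Sum>x\<in>A. c x * v x \<alpha>) \<in> l2" by (intro l2_lincomb V_l2 assms)
  fix g assume g: "g \<in> \<Gamma>"
  have "l2_inner (\<lambda>\<alpha>. \<Sum>x\<in>A. c x * v x \<alpha>) g = (\<Sum>x\<in>A. c x * l2_inner (v x) g)"
    by (rule l2_inner_sum_left) (use assms V_l2 g \<Gamma> in auto)
  thus "l2_inner (\<lambda>\<alpha>. \<Sum>x\<in>A. c x * v x \<alpha>) g = 0" using assms g by (simp add: V_def)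
qed

lemma V_diff: "x \<in> V \<Longrightarrow> y \<in> V \<Longrightarrow> (\<lambda>\<alpha>. x \<alpha> - y \<alpha>) \<in> V"
  using V_lincomb[of "{True, False}" "\<lambda>t. if t then x else y" "\<lambda>t. if t then 1 else -1"] by simp

lemma l2_inner_b_left: "l2_inner (b i) h = cnj (coord h i)"
  unfolding coord_def by (rule l2_inner_cnj)

lemma sum_level: "(\<Sum>i\<in>level n. f i) = (\<Sum>j<r n. f (n, j))"
proof -
  have "level n = Pair n ` {..<r n}" by (auto simp: level_def)
  thus ?thesis by (simp add: sum.reindex inj_on_def)
qed

lemma finite_level [simp]: "finite (level n)"
  by (simp add: level_def)

lemma slice_proj: "slice n (proj a) = (\<lambda>\<alpha>. \<Sum>j<r n. coord a (n, j) * b (n, j) \<alpha>)"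
  by (rule ext) (auto simp: slice_def proj_def b_homogeneous intro!: sum.neutral)

lemma l2_inner_b:
  assumes "i \<in> I" "l \<in> I"
  shows "l2_inner (b i) (b l) = (if i = l then 1 else 0)"
proof (cases "fst i = fst l")
  case True
  thus ?thesis using assms b_orthonormal[of "snd i" "fst i" "snd l"] by (auto simp: I_def prod_eq_iff)
next
  case False
  have "l2_inner (b i) (b l) = (\<Sum>\<alpha>\<in>homog (fst l). b i \<alpha> * cnj (b l \<alpha>))"
    by (rule l2_inner_homogeneous) (use assms b_homogeneous in \<open>auto simp: I_def\<close>)
  also have "\<dots> = 0" by (intro sum.neutral) (use False assms b_homogeneous in \<open>auto simp: I_def\<close>)
  finally show ?thesis using False by auto
qed

lemma coord_slice: "(n, j) \<in> I \<Longrightarrow> coord (slice n a) (n, j) = coord a (n, j)"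
  unfolding coord_def by (rule l2_inner_slice) (auto simp: I_def b_homogeneous)

lemma coord_proj: 
  assumes "i \<in> I"
  shows "coord (proj a) i = coord a i"
proof -
  obtain n j where i: "i = (n, j)" "j < r n" using assms by (auto simp: I_def)
  have "coord (proj a) i = coord (slice n (proj a)) i" using coord_slice assms i by simp
  also have "\<dots> = (\<Sum>k<r n. coord a (n, k) * l2_inner (b (n, k)) (b i))"
    unfolding slice_proj coord_def[of "\<lambda>\<alpha>. \<Sum>j<r n. coord a (n, j) * b (n, j) \<alpha>"]
    by (rule l2_inner_sum_left) (use b_l2 assms in \<open>auto simp: I_def\<close>)
  also have "\<dots> = (\<Sum>k<r n. if k = j then coord a (n, j) else 0)"
    by (intro sum.cong refl) (use i in \<open>auto simp: b_orthonormal\<close>)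
  finally show ?thesis using i by simp
qed

lemma proj_l2:
  assumes "a \<in> l2"
  shows "proj a \<in> l2"
proof (rule l2_by_degree[OF assms])
  fix n
  have l2norm_slice: "(\<Sum>\<alpha>\<in>homog n. (cmod (c \<alpha>))\<^sup>2) = (l2norm (slice n c))\<^sup>2" for c :: "('d \<Rightarrow>\<^sub>0 nat) \<Rightarrow> complex"
  proof -
    have "(\<Sum>\<^sub>\<infinity>\<alpha>. (cmod (slice n c \<alpha>))\<^sup>2) = (\<Sum>\<^sub>\<infinity>\<alpha>\<in>homog n. (cmod (c \<alpha>))\<^sup>2)"
      by (rule infsum_cong_neutral) (auto simp: slice_def)
    thus ?thesis by (simp add: l2norm_def sum_nonneg)
  qed
  define E where "E = b ` level n"
  have LI: "level n \<subseteq> I" by (auto simp: level_def I_def)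
  have inj: "inj_on b (level n)"
  proof (rule inj_onI)
    fix i l assume "i \<in> level n" "l \<in> level n" "b i = b l"
    moreover from this have "i \<in> I" "l \<in> I" using LI by auto
    ultimately show "i = l" using l2_inner_b[of i l] l2_inner_b[of i i] by (metis zero_neq_one)
  qed
  have E: "orthonormal E" unfolding orthonormal_def E_def
  proof (intro conjI ballI)
    show "b ` level n \<subseteq> l2" using LI b_l2 by auto
    fix e e' assume "e \<in> b ` level n" "e' \<in> b ` level n"
    then obtain i l where il: "i \<in> level n" "l \<in> level n" "e = b i" "e' = b l" by blast
    show "l2_inner e e' = (if e = e' then 1 else 0)"
      unfolding il inj_on_eq_iff[OF inj il(1,2)] by (rule l2_inner_b) (use il LI in auto)
  qed
  have "expand E (slice n a) = slice n (proj a)"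
    unfolding expand_def E_def slice_proj sum.reindex[OF inj] o_def sum_level
    by (intro ext sum.cong refl) (use coord_slice in \<open>simp add: I_def coord_def\<close>)
  moreover have "(l2norm (expand E (slice n a)))\<^sup>2 = (\<Sum>e\<in>E. (cmod (l2_inner (slice n a) e))\<^sup>2)"
    by (rule norm_expand[OF E]) (auto simp: E_def level_def)
  moreover have "(\<Sum>e\<in>E. (cmod (l2_inner (slice n a) e))\<^sup>2) \<le> (l2norm (slice n a))\<^sup>2"
    by (rule Bessel[OF E]) (auto simp: E_def level_def)
  ultimately show "(\<Sum>\<alpha>\<in>homog n. (cmod (proj a \<alpha>))\<^sup>2) \<le> (\<Sum>\<alpha>\<in>homog n. (cmod (a \<alpha>))\<^sup>2)"
    unfolding l2norm_slice by simp
qed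

lemma proj_V:
  assumes "a \<in> l2"
  shows "proj a \<in> V"
proof (rule slices_mem[OF proj_l2[OF assms]])
  fix n
  show "slice n (proj a) \<in> V" unfolding slice_proj by (intro V_lincomb) (auto simp: b_mem)
qed

lemma eq_zero_of_coord:
  assumes "a \<in> V" "\<And>i. i \<in> I \<Longrightarrow> coord a i = 0"
  shows "a = (\<lambda>_. 0)"
proof
  fix \<alpha> :: "'d \<Rightarrow>\<^sub>0 nat"
  have "slice (tdeg \<alpha>) a = (\<lambda>_. 0)"
  proof (rule b_total[of _ "tdeg \<alpha>"])
    show "slice (tdeg \<alpha>) a \<in> V" by (rule slice_mem[OF assms(1)])
    fix j assume "j < r (tdeg \<alpha>)"
    thus "l2_inner (slice (tdeg \<alpha>) a) (b (tdeg \<alpha>, j)) = 0"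
      using coord_slice[of "tdeg \<alpha>" j a] assms(2) by (auto simp: I_def coord_def)
  qed (simp add: slice_def)
  from fun_cong[OF this, of \<alpha>] show "a \<alpha> = 0" by (simp add: slice_def)
qed

lemma inj_b: "inj_on b I"
proof (rule inj_onI)
  fix i l assume "i \<in> I" "l \<in> I" "b i = b l"
  thus "i = l" using l2_inner_b[of i l] l2_inner_b[of i i] by (metis zero_neq_one)
qed

text \<open>
  The homogeneous bases together form an orthonormal basis of \<open>V\<close>.
\<close>

lemma Parseval_coord:
  assumes x: "x \<in> V" and y: "y \<in> l2"
  shows "((\<lambda>i. coord x i * cnj (coord y i)) has_sum l2_inner x y) I"
proof -
  have E: "orthonormal (b ` I)" unfolding orthonormal_def
  proof (intro conjI ballI)
    show "b ` I \<subseteq> l2" using b_l2 by auto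
    fix e e' assume "e \<in> b ` I" "e' \<in> b ` I"
    then obtain i l where il: "i \<in> I" "l \<in> I" "e = b i" "e' = b l" by blast
    show "l2_inner e e' = (if e = e' then 1 else 0)"
      unfolding il inj_on_eq_iff[OF inj_b il(1,2)] by (rule l2_inner_b) (use il in auto)
  qed
  have "((\<lambda>e. l2_inner x e * cnj (l2_inner y e)) has_sum l2_inner x y) (b ` I)"
  proof (rule Parseval[OF \<Gamma> E])
    show "b ` I \<subseteq> {a \<in> l2. \<forall>g\<in>\<Gamma>. l2_inner a g = 0}" using b_V by (auto simp: V_def)
    show "x \<in> {a \<in> l2. \<forall>g\<in>\<Gamma>. l2_inner a g = 0}" using x by (simp add: V_def)
    fix f assume "f \<in> {a \<in> l2. \<forall>g\<in>\<Gamma>. l2_inner a g = 0}" "\<forall>e\<in>b ` I. l2_inner f e = 0"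
    thus "f = (\<lambda>_. 0)" by (intro eq_zero_of_coord) (auto simp: V_def coord_def)
  qed (rule y)
  thus ?thesis by (subst (asm) has_sum_reindex[OF inj_b]) (simp add: o_def coord_def)
qed

lemma l2_inner_proj:
  assumes "a \<in> l2" "h \<in> V"
  shows "l2_inner (proj a) h = l2_inner a h"
proof -
  have ph: "((\<lambda>i. coord h i * cnj (coord (proj a) i)) has_sum l2_inner h (proj a)) I"
    by (intro Parseval_coord assms proj_l2)
  have "((\<lambda>i. coord h i * cnj (coord (proj a) i)) has_sum l2_inner h a) I \<longleftrightarrow> ((\<lambda>i. coord h i * cnj (coord a i)) has_sum l2_inner h a) I"
    by (rule has_sum_cong) (simp add: coord_proj)
  hence "((\<lambda>i. coord h i * cnj (coord (proj a) i)) has_sum l2_inner h a) I" using Parseval_coord[OF assms(2,1)] by simp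
  hence "l2_inner h (proj a) = l2_inner h a" using ph has_sum_unique by blast
  thus ?thesis using l2_inner_cnj[of "proj a" h] l2_inner_cnj[of a h] by simp
qed

lemma V_eqI:
  assumes "x \<in> V" "y \<in> V" "\<And>h. h \<in> V \<Longrightarrow> l2_inner x h = l2_inner y h"
  shows "x = y"
proof -
  have "l2_inner (\<lambda>\<alpha>. x \<alpha> - y \<alpha>) (\<lambda>\<alpha>. x \<alpha> - y \<alpha>) = 0"
    using assms V_diff[OF assms(1,2)] by (simp add: l2_inner_diff_left V_l2)
  hence "(\<lambda>\<alpha>. x \<alpha> - y \<alpha>) = (\<lambda>_. 0)" by (intro l2_inner_self_eq_0 V_l2 V_diff assms)
  thus ?thesis by (auto simp: fun_eq_iff)
qed

lemma hardy_proj_hfun: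
  assumes "a \<in> l2"
  shows "hardy_proj (hfun ` V) (hfun a) = hfun (proj a)"
  unfolding hardy_proj_def
proof (rule the_equality)
  have "hardy_inner (hfun a - hfun (proj a)) (hfun h) = 0" if "h \<in> V" for h
    using that assms by (simp add: hfun_diff proj_l2 l2_diff V_l2 l2_inner_diff_left l2_inner_proj)
  thus "hfun (proj a) \<in> hfun ` V \<and> (\<forall>h\<in>hfun ` V. hardy_inner (hfun a - hfun (proj a)) h = 0)"
    using proj_V[OF assms] by auto
next
  fix g assume g: "g \<in> hfun ` V \<and> (\<forall>h\<in>hfun ` V. hardy_inner (hfun a - g) h = 0)"
  then obtain x where x: "x \<in> V" "g = hfun x" by auto
  have "x = proj a"
  proof (rule V_eqI[OF x(1) proj_V[OF assms]])
    fix h assume h: "h \<in> V"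
    hence "hardy_inner (hfun a - hfun x) (hfun h) = 0" using g x by auto
    thus "l2_inner x h = l2_inner (proj a) h"
      using h x assms by (simp add: hfun_diff l2_diff V_l2 l2_inner_diff_left l2_inner_proj)
  qed
  thus "g = hfun (proj a)" using x by simp
qed

lemma compression_hfun:
  "a \<in> l2 \<Longrightarrow> compression (hfun ` V) p (hfun a) = hfun (proj (mult_coeff p a))"
  by (simp add: compression_def mult_op_hfun hardy_proj_hfun mult_coeff_l2)

lemma adjoint_on_compression_hfun:
  assumes "a \<in> V"
  shows "adjoint_on (hfun ` V) (compression (hfun ` V) p) (hfun a) = hfun (proj (mult_coeff_adj p a))"
  unfolding adjoint_on_def
proof (rule the_equality)
  note a = V_l2[OF assms]
  have *: "hardy_inner (compression (hfun ` V) p (hfun k)) (hfun a) = l2_inner k (proj (mult_coeff_adj p a))" if k: "k \<in> V" for k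
  proof -
    have "hardy_inner (compression (hfun ` V) p (hfun k)) (hfun a) = l2_inner (proj (mult_coeff p k)) a"
      using V_l2[OF k] a by (simp add: compression_hfun mult_coeff_l2 proj_l2)
    also have "\<dots> = l2_inner (mult_coeff p k) a" using V_l2[OF k] by (intro l2_inner_proj mult_coeff_l2 assms)
    also have "\<dots> = l2_inner k (mult_coeff_adj p a)" by (intro l2_inner_mult_coeff V_l2[OF k] a)
    also have "\<dots> = cnj (l2_inner (proj (mult_coeff_adj p a)) k)"
      using l2_inner_proj[OF mult_coeff_adj_l2[OF a] k] l2_inner_cnj by metis
    also have "\<dots> = l2_inner k (proj (mult_coeff_adj p a))" by (rule l2_inner_cnj[symmetric])
    finally show ?thesis .
  qed
  note pl2 = proj_l2[OF mult_coeff_adj_l2[OF a], of p]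
  show "hfun (proj (mult_coeff_adj p a)) \<in> hfun ` V \<and>
     (\<forall>k\<in>hfun ` V. hardy_inner (compression (hfun ` V) p k) (hfun a) = hardy_inner k (hfun (proj (mult_coeff_adj p a))))"
    using proj_V[OF mult_coeff_adj_l2[OF a]] * pl2 V_l2 by auto
  fix g assume g: "g \<in> hfun ` V \<and> (\<forall>k\<in>hfun ` V. hardy_inner (compression (hfun ` V) p k) (hfun a) = hardy_inner k g)"
  then obtain x where x: "x \<in> V" "g = hfun x" by auto
  have "x = proj (mult_coeff_adj p a)"
  proof (rule V_eqI[OF x(1) proj_V[OF mult_coeff_adj_l2[OF a]]])
    fix h assume h: "h \<in> V"
    hence "l2_inner h (proj (mult_coeff_adj p a)) = l2_inner h x" using g x * V_l2 by auto
    thus "l2_inner x h = l2_inner (proj (mult_coeff_adj p a)) h" using l2_inner_cnj by metis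
  qed
  thus "g = hfun (proj (mult_coeff_adj p a))" using x by simp
qed

text \<open>
  The operator \<open>T\<close> has the matrix \<open>M\<close> in the basis \<open>b\<close>, and \<open>M\<close> is absolutely summable over all
  entries. Such operators are nuclear: \<open>T\<close> is the sum of the operators
  \<open>a \<mapsto> M i l * \<langle>a, b l\<rangle> * b i\<close>. In this form the stability under linear combinations is
  immediate.
\<close>

definition has_matrix :: "((('d \<Rightarrow>\<^sub>0 nat) \<Rightarrow> complex) \<Rightarrow> ('d \<Rightarrow>\<^sub>0 nat) \<Rightarrow> complex) \<Rightarrow>
    (nat \<times> nat \<Rightarrow> nat \<times> nat \<Rightarrow> complex) \<Rightarrow> bool" where
  "has_matrix T M \<longleftrightarrow> (\<forall>a\<in>V. T a \<in> V) \<and> (\<lambda>(i, l). norm (M i l)) summable_on (I \<times> I) \<and>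
     (\<forall>a\<in>V. \<forall>i\<in>I. ((\<lambda>l. M i l * coord a l) has_sum coord (T a) i) I)"

lemma l2norm_scale_b:
  assumes "i \<in> I"
  shows "l2norm (\<lambda>\<alpha>. c * b i \<alpha>) = cmod c"
proof -
  have "l2_inner (\<lambda>\<alpha>. c * b i \<alpha>) (\<lambda>\<alpha>. c * b i \<alpha>) = c * cnj c"
    using b_l2[OF assms] l2_inner_b[OF assms assms] by (simp add: l2_inner_scale_left l2_inner_scale_right l2_scale)
  hence "complex_of_real ((l2norm (\<lambda>\<alpha>. c * b i \<alpha>))\<^sup>2) = complex_of_real ((cmod c)\<^sup>2)"
    unfolding l2_inner_self complex_norm_square[of c] .
  hence "(l2norm (\<lambda>\<alpha>. c * b i \<alpha>))\<^sup>2 = (cmod c)\<^sup>2" by (simp only: of_real_eq_iff)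
  thus ?thesis by simp
qed

lemma l2norm_b: "i \<in> I \<Longrightarrow> l2norm (b i) = 1"
  using l2norm_scale_b[of i 1] by simp

lemma coord_bound:
  assumes "a \<in> l2" "i \<in> I"
  shows "cmod (coord a i) \<le> l2norm a"
  using l2_inner_Cauchy_Schwarz[OF assms(1) b_l2[OF assms(2)]] l2norm_b[OF assms(2)] by (simp add: coord_def)

lemma has_matrix_weak:
  assumes T: "has_matrix T M" and a: "a \<in> V" and h: "h \<in> V"
  shows "((\<lambda>(i, l). coord a l * (M i l * cnj (coord h i))) has_sum l2_inner (T a) h) (I \<times> I)"
proof -
  let ?f = "\<lambda>(i, l). coord a l * (M i l * cnj (coord h i))"
  have "(\<lambda>p. norm (?f p)) summable_on (I \<times> I)"
  proof (rule Infinite_Sum.abs_summable_on_comparison_test)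
    show "(\<lambda>p. norm (l2norm a * l2norm h * (case p of (i, l) \<Rightarrow> norm (M i l)))) summable_on (I \<times> I)"
      using T unfolding has_matrix_def
      by (auto simp: norm_mult case_prod_unfold intro!: summable_on_cmult_right)
    fix p assume "p \<in> I \<times> I"
    then obtain i l where p: "p = (i, l)" "i \<in> I" "l \<in> I" by auto
    have "norm (?f p) = cmod (coord a l) * cmod (coord h i) * norm (M i l)" by (simp add: p norm_mult)
    also have "\<dots> \<le> l2norm a * l2norm h * norm (M i l)"
      by (intro mult_right_mono mult_mono coord_bound V_l2 a h p) auto
    finally show "norm (?f p) \<le> norm (l2norm a * l2norm h * (case p of (i, l) \<Rightarrow> norm (M i l)))"
      by (simp add: p)
  qed
  from abs_summable_summable[OF this] obtain S where S: "(?f has_sum S) (I \<times> I)" by (auto simp: summable_on_def)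
  have "((\<lambda>i. coord (T a) i * cnj (coord h i)) has_sum S) I"
  proof (rule has_sum_SigmaD[OF S])
    fix i assume i: "i \<in> I"
    have "((\<lambda>l. M i l * coord a l * cnj (coord h i)) has_sum coord (T a) i * cnj (coord h i)) I"
      using T a i unfolding has_matrix_def by (intro has_sum_cmult_left) auto
    thus "((\<lambda>l. ?f (i, l)) has_sum coord (T a) i * cnj (coord h i)) I" by (simp add: mult_ac)
  qed
  moreover have "((\<lambda>i. coord (T a) i * cnj (coord h i)) has_sum l2_inner (T a) h) I"
    using T a h V_l2 by (intro Parseval_coord) (auto simp: has_matrix_def)
  ultimately have "S = l2_inner (T a) h" using has_sum_unique by blast
  thus ?thesis using S by simp
qed

lemma has_matrix_lincomb:
  assumes "finite A" "\<And>x. x \<in> A \<Longrightarrow> has_matrix (T x) (M x)"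
  shows "has_matrix (\<lambda>a \<alpha>. \<Sum>x\<in>A. c x * T x a \<alpha>) (\<lambda>i l. \<Sum>x\<in>A. c x * M x i l)"
  unfolding has_matrix_def
proof (intro conjI ballI)
  fix a assume a: "a \<in> V"
  show "(\<lambda>\<alpha>. \<Sum>x\<in>A. c x * T x a \<alpha>) \<in> V"
    by (rule V_lincomb) (use assms a in \<open>auto simp: has_matrix_def\<close>)
  fix i assume i: "i \<in> I"
  have "coord (\<lambda>\<alpha>. \<Sum>x\<in>A. c x * T x a \<alpha>) i = (\<Sum>x\<in>A. c x * coord (T x a) i)"
    unfolding coord_def by (rule l2_inner_sum_left) (use assms a V_l2 b_l2 i in \<open>auto simp: has_matrix_def\<close>)
  moreover have "((\<lambda>l. \<Sum>x\<in>B. c x * (M x i l * coord a l)) has_sum (\<Sum>x\<in>B. c x * coord (T x a) i)) I" if "B \<subseteq> A" for B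
    using finite_subset[OF that assms(1)] that
  proof (induction B rule: finite_induct)
    case (insert x B)
    thus ?case using assms(2)[of x] a i
      by (auto simp: has_matrix_def intro!: has_sum_add has_sum_cmult_right)
  qed auto
  ultimately show "((\<lambda>l. (\<Sum>x\<in>A. c x * M x i l) * coord a l) has_sum coord (\<lambda>\<alpha>. \<Sum>x\<in>A. c x * T x a \<alpha>) i) I"
    by (simp add: sum_distrib_right mult.assoc)
next
  have "(\<lambda>p. norm (\<Sum>x\<in>B. c x * M x (fst p) (snd p))) summable_on (I \<times> I)" if "B \<subseteq> A" for B
    using finite_subset[OF that assms(1)] that
  proof (induction B rule: finite_induct)
    case (insert x B)
    have "(\<lambda>p. norm (c x) * norm (M x (fst p) (snd p)) + norm (\<Sum>x\<in>B. c x * M x (fst p) (snd p))) summable_on (I \<times> I)"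
      using insert assms(2)[of x] by (auto simp: has_matrix_def case_prod_unfold intro!: summable_on_add summable_on_cmult_right)
    thus ?case
      by (rule summable_on_comparison_test) (use insert in \<open>auto simp: norm_mult[symmetric] intro: norm_triangle_ineq\<close>)
  qed auto
  thus "(\<lambda>(i, l). norm (\<Sum>x\<in>A. c x * M x i l)) summable_on (I \<times> I)" by (simp add: case_prod_unfold)
qed

text \<open>
  The pairs of basis indices are enumerated by the natural numbers, with zero vectors where the
  enumeration leaves gaps.
\<close>

lemma has_matrix_nuclear:
  assumes T: "has_matrix T M"
  obtains x y :: "nat \<Rightarrow> ('d \<Rightarrow>\<^sub>0 nat) \<Rightarrow> complex" where
    "range x \<subseteq> V" "range y \<subseteq> V" "summable (\<lambda>n. l2norm (x n) * l2norm (y n))"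
    "\<And>a h. a \<in> V \<Longrightarrow> h \<in> V \<Longrightarrow> (\<lambda>n. l2_inner a (x n) * l2_inner (y n) h) sums l2_inner (T a) h"
proof -
  define P where "P = to_nat ` (I \<times> I)"
  define x where "x = (\<lambda>n. if n \<in> P then b (snd (from_nat n :: (nat \<times> nat) \<times> (nat \<times> nat))) else (\<lambda>_. 0))"
  define y where "y = (\<lambda>n. if n \<in> P then (\<lambda>\<alpha>. M (fst (from_nat n :: (nat \<times> nat) \<times> (nat \<times> nat))) (snd (from_nat n :: (nat \<times> nat) \<times> (nat \<times> nat)))
        * b (fst (from_nat n :: (nat \<times> nat) \<times> (nat \<times> nat))) \<alpha>) else (\<lambda>_. 0))"
  have zero_V: "(\<lambda>_. 0) \<in> V" using V_lincomb[of "{}"] by simp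
  have scale_V: "(\<lambda>\<alpha>. c * v \<alpha>) \<in> V" if "v \<in> V" for c v using V_lincomb[of "{()}" "\<lambda>_. v" "\<lambda>_. c"] that by simp
  have xV: "x n \<in> V" for n using zero_V b_V by (auto simp: x_def P_def)
  have yV: "y n \<in> V" for n using zero_V b_V scale_V by (auto simp: y_def P_def)
  have inj: "inj_on to_nat (I \<times> I)" by (simp add: inj_on_def)
  have reindex: "(f has_sum s) UNIV \<longleftrightarrow> (g has_sum s) (I \<times> I)"
    if "\<And>n. n \<notin> P \<Longrightarrow> f n = 0" "\<And>p. p \<in> I \<times> I \<Longrightarrow> f (to_nat p) = g p" for f :: "nat \<Rightarrow> 'z::{comm_monoid_add,topological_space}" and g s
  proof -
    have "(f has_sum s) UNIV \<longleftrightarrow> (f has_sum s) P" by (rule has_sum_cong_neutral) (use that in auto)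
    also have "\<dots> \<longleftrightarrow> ((f \<circ> to_nat) has_sum s) (I \<times> I)" unfolding P_def by (rule has_sum_reindex[OF inj])
    also have "\<dots> \<longleftrightarrow> (g has_sum s) (I \<times> I)" by (rule has_sum_cong) (use that in auto)
    finally show ?thesis .
  qed
  obtain S where "((\<lambda>(i, l). norm (M i l)) has_sum S) (I \<times> I)"
    using T by (auto simp: has_matrix_def summable_on_def)
  hence "((\<lambda>n. l2norm (x n) * l2norm (y n)) has_sum S) UNIV"
    by (subst reindex) (auto simp: x_def y_def P_def l2norm_b l2norm_scale_b l2norm_def[of "\<lambda>_. 0"])
  hence "summable (\<lambda>n. l2norm (x n) * l2norm (y n))" using has_sum_imp_sums sums_summable by blast
  moreover have "(\<lambda>n. l2_inner a (x n) * l2_inner (y n) h) sums l2_inner (T a) h" if "a \<in> V" "h \<in> V" for a h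
  proof -
    have "((\<lambda>n. l2_inner a (x n) * l2_inner (y n) h) has_sum l2_inner (T a) h) UNIV"
    proof (subst reindex)
      show "((\<lambda>(i, l). coord a l * (M i l * cnj (coord h i))) has_sum l2_inner (T a) h) (I \<times> I)"
        by (rule has_matrix_weak[OF T that])
      fix p assume "p \<in> I \<times> I"
      moreover obtain i l where "p = (i, l)" by (rule prod.exhaust)
      ultimately show "l2_inner a (x (to_nat p)) * l2_inner (y (to_nat p)) h = (case p of (i, l) \<Rightarrow> coord a l * (M i l * cnj (coord h i)))"
        using that V_l2 b_l2 by (auto simp: x_def y_def P_def coord_def[symmetric] l2_inner_scale_left l2_inner_b_left)
    qed (auto simp: y_def)
    thus ?thesis by (rule has_sum_imp_sums)
  qed
  ultimately show ?thesis using that[of x y] xV yV by blast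
qed

text \<open>
  The remainder \<open>w m\<close> is tested against itself: its squared norm is at most its norm times the
  tail of \<open>\<Sum>n. \<parallel>x n\<parallel> * \<parallel>y n\<parallel>\<close>.
\<close>

lemma trace_class_on_hfun:
  assumes T: "has_matrix T M" and op: "\<And>a. a \<in> V \<Longrightarrow> op (hfun a) = hfun (T a)"
  shows "trace_class_on (hfun ` V) op"
  unfolding trace_class_on_def
proof (intro conjI ballI)
  fix f assume "f \<in> hfun ` V"
  thus "op f \<in> hfun ` V" using T op by (auto simp: has_matrix_def)
next
  obtain x y :: "nat \<Rightarrow> ('d \<Rightarrow>\<^sub>0 nat) \<Rightarrow> complex" where
    xy: "range x \<subseteq> V" "range y \<subseteq> V" "summable (\<lambda>n. l2norm (x n) * l2norm (y n))"
    and weak: "\<And>a h. a \<in> V \<Longrightarrow> h \<in> V \<Longrightarrow> (\<lambda>n. l2_inner a (x n) * l2_inner (y n) h) sums l2_inner (T a) h"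
    using has_matrix_nuclear[OF T] by blast
  have xV: "x n \<in> V" "y n \<in> V" for n using xy by auto
  have l2: "x n \<in> l2" "y n \<in> l2" for n using xV V_l2 by auto
  have "(\<lambda>m. hardy_norm (op f - (\<lambda>z. \<Sum>n<m. hardy_inner f (hfun (x n)) * hfun (y n) z))) \<longlonglongrightarrow> 0"
    if f: "f \<in> hfun ` V" for f
  proof -
    obtain a where a: "a \<in> V" "f = hfun a" using f by auto
    have TaV: "T a \<in> V" using T a by (simp add: has_matrix_def)
    define w where "w = (\<lambda>m \<alpha>. T a \<alpha> - (\<Sum>n<m. l2_inner a (x n) * y n \<alpha>))"
    have wV: "w m \<in> V" for m unfolding w_def by (intro V_diff V_lincomb TaV xV)
    have eq: "op f - (\<lambda>z. \<Sum>n<m. hardy_inner f (hfun (x n)) * hfun (y n) z) = hfun (w m)" for m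
    proof -
      have "(\<lambda>z. \<Sum>n<m. hardy_inner f (hfun (x n)) * hfun (y n) z) = hfun (\<lambda>\<alpha>. \<Sum>n<m. l2_inner a (x n) * y n \<alpha>)"
        by (rule ext, subst hfun_lincomb) (use l2 a V_l2 in auto)
      thus ?thesis using V_l2[OF TaV] l2 op[OF a(1)] a(2) by (simp add: hfun_diff l2_lincomb w_def)
    qed
    define q where "q = (\<lambda>n. l2norm (x n) * l2norm (y n))"
    have bound: "l2norm (w m) \<le> l2norm a * suminf (\<lambda>n. q (n + m))" for m
    proof -
      have "(\<lambda>n. l2_inner a (x (n + m)) * l2_inner (y (n + m)) (w m)) sums
          (l2_inner (T a) (w m) - (\<Sum>n<m. l2_inner a (x n) * l2_inner (y n) (w m)))"
        using weak[OF a(1) wV[of m]] by (rule sums_split_initial_segment)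
      also have "l2_inner (T a) (w m) - (\<Sum>n<m. l2_inner a (x n) * l2_inner (y n) (w m)) = l2_inner (w m) (w m)"
      proof -
        have "l2_inner (w m) (w m) = l2_inner (T a) (w m) - l2_inner (\<lambda>\<alpha>. \<Sum>n<m. l2_inner a (x n) * y n \<alpha>) (w m)"
          by (subst w_def, rule l2_inner_diff_left) (use V_l2 TaV wV l2 in \<open>auto intro: l2_lincomb\<close>)
        also have "l2_inner (\<lambda>\<alpha>. \<Sum>n<m. l2_inner a (x n) * y n \<alpha>) (w m) = (\<Sum>n<m. l2_inner a (x n) * l2_inner (y n) (w m))"
          by (rule l2_inner_sum_left) (use l2 V_l2 wV in auto)
        finally show ?thesis by simp
      qed
      finally have s: "(\<lambda>n. l2_inner a (x (n + m)) * l2_inner (y (n + m)) (w m)) sums l2_inner (w m) (w m)" .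
      have le: "norm (l2_inner a (x (n + m)) * l2_inner (y (n + m)) (w m)) \<le> l2norm a * l2norm (w m) * q (n + m)" for n
      proof -
        have "norm (l2_inner a (x (n + m)) * l2_inner (y (n + m)) (w m)) \<le> (l2norm a * l2norm (x (n + m))) * (l2norm (y (n + m)) * l2norm (w m))"
          unfolding norm_mult by (intro mult_mono l2_inner_Cauchy_Schwarz V_l2 a xV wV mult_nonneg_nonneg) auto
        thus ?thesis by (simp add: q_def mult_ac)
      qed
      have qs: "summable (\<lambda>n. q (n + m))" using xy(3) unfolding q_def by (subst summable_iff_shift)
      have "norm (suminf (\<lambda>n. l2_inner a (x (n + m)) * l2_inner (y (n + m)) (w m))) \<le> suminf (\<lambda>n. l2norm a * l2norm (w m) * q (n + m))"
        by (rule norm_suminf_le[OF le]) (intro summable_mult qs)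
      also have "\<dots> = l2norm a * l2norm (w m) * suminf (\<lambda>n. q (n + m))" by (rule suminf_mult[OF qs])
      finally have "(l2norm (w m))\<^sup>2 \<le> l2norm a * l2norm (w m) * suminf (\<lambda>n. q (n + m))"
        unfolding sums_unique[OF s, symmetric] by (simp add: l2_inner_self norm_power)
      hence *: "l2norm (w m) * l2norm (w m) \<le> l2norm (w m) * (l2norm a * suminf (\<lambda>n. q (n + m)))"
        by (simp add: power2_eq_square mult_ac)
      have "suminf (\<lambda>n. q (n + m)) \<ge> 0" by (rule suminf_nonneg[OF qs]) (simp add: q_def)
      thus ?thesis using * l2norm_nonneg[of "w m"] l2norm_nonneg[of a]
        by (cases "l2norm (w m) = 0") (auto simp: mult_le_cancel_left)
    qed
    have "(\<lambda>m. l2norm a * suminf (\<lambda>n. q (n + m))) \<longlonglongrightarrow> l2norm a * 0"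
      using xy(3) unfolding q_def by (intro tendsto_intros suminf_exist_split2)
    hence lim: "(\<lambda>m. l2norm a * suminf (\<lambda>n. q (n + m))) \<longlonglongrightarrow> 0" by simp
    have "(\<lambda>m. l2norm (w m)) \<longlonglongrightarrow> 0"
      by (rule tendsto_sandwich[OF _ _ tendsto_const lim]) (auto simp: bound)
    thus ?thesis unfolding eq using wV V_l2 by simp
  qed
  thus "\<exists>x y. range x \<subseteq> hfun ` V \<and> range y \<subseteq> hfun ` V \<and> summable (\<lambda>n. hardy_norm (x n) * hardy_norm (y n)) \<and>
      (\<forall>f\<in>hfun ` V. (\<lambda>m. hardy_norm (op f - (\<lambda>z. \<Sum>n<m. hardy_inner f (x n) * y n z))) \<longlonglongrightarrow> 0)"
    using xy l2 xV by (intro exI[of _ "\<lambda>n. hfun (x n)"] exI[of _ "\<lambda>n. hfun (y n)"]) auto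
qed

lemma has_trace_on_hfun:
  assumes T: "has_matrix T M" and op: "\<And>a. a \<in> V \<Longrightarrow> op (hfun a) = hfun (T a)"
    and c: "((\<lambda>i. M i i) has_sum c) I"
  shows "has_trace_on (hfun ` V) op c"
  unfolding has_trace_on_def
proof (intro conjI allI impI)
  show "trace_class_on (hfun ` V) op" by (rule trace_class_on_hfun[OF T op])
  fix E assume E: "orthonormal_basis (hfun ` V) E"
  define E' where "E' = hardy_coeff ` E"
  have EV: "E \<subseteq> hfun ` V" using E by (simp add: orthonormal_basis_def)
  have coeff: "hardy_coeff e \<in> V \<and> hfun (hardy_coeff e) = e" if "e \<in> E" for e
    using EV that V_l2 by (auto simp: subset_iff image_iff)
  have inj: "inj_on hardy_coeff E" using coeff by (metis inj_onI)
  have E'V: "E' \<subseteq> V" using coeff by (auto simp: E'_def)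
  have ipE: "l2_inner (hardy_coeff e) (hardy_coeff e') = (if e = e' then 1 else 0)" if "e \<in> E" "e' \<in> E" for e e'
  proof -
    have "hardy_inner e e' = (if e = e' then 1 else 0)" using E that by (simp add: orthonormal_basis_def)
    thus ?thesis using hardy_inner_hfun[of "hardy_coeff e" "hardy_coeff e'"] coeff that V_l2 by auto
  qed
  have orth: "orthonormal E'" unfolding orthonormal_def
  proof (intro conjI ballI)
    show "E' \<subseteq> l2" using E'V V_l2 by auto
    fix x y assume "x \<in> E'" "y \<in> E'"
    then obtain e e' where e: "e \<in> E" "e' \<in> E" "x = hardy_coeff e" "y = hardy_coeff e'"
      unfolding E'_def by blast
    show "l2_inner x y = (if x = y then 1 else 0)"
      unfolding e inj_on_eq_iff[OF inj e(1,2)] by (rule ipE) (use e in auto)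
  qed
  have total: "f = (\<lambda>_. 0)" if f: "f \<in> V" "\<forall>e\<in>E'. l2_inner f e = 0" for f
  proof -
    have "\<forall>e\<in>E. hardy_inner (hfun f) e = 0"
    proof
      fix e assume e: "e \<in> E"
      have "hardy_inner (hfun f) (hfun (hardy_coeff e)) = l2_inner f (hardy_coeff e)"
        using coeff e f V_l2 by (intro hardy_inner_hfun) auto
      thus "hardy_inner (hfun f) e = 0" using coeff e f by (auto simp: E'_def)
    qed
    hence "hfun f = (\<lambda>_. 0)" using E f by (auto simp: orthonormal_basis_def)
    hence "hfun f = hfun (\<lambda>_. 0)" by (auto simp: hfun_def fun_eq_iff)
    thus ?thesis using hfun_inj[OF V_l2[OF f(1)] l2_zero] by blast
  qed
  have "((\<lambda>e. l2_inner (T e) e) has_sum c) E'"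
  proof (rule nuclear_trace[where P = "I \<times> I" and x = "\<lambda>(i, l). b l" and y = "\<lambda>(i, l) \<alpha>. M i l * b i \<alpha>" and \<Gamma> = \<Gamma>])
    show "E' \<subseteq> {a \<in> l2. \<forall>g\<in>\<Gamma>. l2_inner a g = 0}" using E'V by (simp add: V_def)
    show "\<And>f. f \<in> {a \<in> l2. \<forall>g\<in>\<Gamma>. l2_inner a g = 0} \<Longrightarrow> \<forall>e\<in>E'. l2_inner f e = 0 \<Longrightarrow> f = (\<lambda>_. 0)"
      using total unfolding V_def .
    have scale_V: "(\<lambda>\<alpha>. c * v \<alpha>) \<in> V" if "v \<in> V" for c v using V_lincomb[of "{()}" "\<lambda>_. v" "\<lambda>_. c"] that by simp
    show "\<And>p. p \<in> I \<times> I \<Longrightarrow> (case p of (i, l) \<Rightarrow> b l) \<in> {a \<in> l2. \<forall>g\<in>\<Gamma>. l2_inner a g = 0}"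
      using b_V unfolding V_def[symmetric] by auto
    show "\<And>p. p \<in> I \<times> I \<Longrightarrow> (case p of (i, l) \<Rightarrow> \<lambda>\<alpha>. M i l * b i \<alpha>) \<in> {a \<in> l2. \<forall>g\<in>\<Gamma>. l2_inner a g = 0}"
      using b_V scale_V unfolding V_def[symmetric] by auto
    have "(\<lambda>(i, l). norm (M i l)) summable_on (I \<times> I)" using T by (simp add: has_matrix_def)
    thus "(\<lambda>p. l2norm (case p of (i, l) \<Rightarrow> b l) * l2norm (case p of (i, l) \<Rightarrow> \<lambda>\<alpha>. M i l * b i \<alpha>)) summable_on (I \<times> I)"
      by (rule summable_on_cong[THEN iffD2, rotated]) (auto simp: l2norm_b l2norm_scale_b)
    show "((\<lambda>p. l2_inner e (case p of (i, l) \<Rightarrow> b l) * l2_inner (case p of (i, l) \<Rightarrow> \<lambda>\<alpha>. M i l * b i \<alpha>) e) has_sum l2_inner (T e) e) (I \<times> I)"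
      if "e \<in> E'" for e
    proof -
      have e: "e \<in> V" using that E'V by auto
      show ?thesis
        using has_matrix_weak[OF T e e]
        by (rule has_sum_cong[THEN iffD2, rotated])
           (use e V_l2 b_l2 in \<open>auto simp: coord_def[symmetric] l2_inner_scale_left l2_inner_b_left\<close>)
    qed
    have "((\<lambda>(i, l). M i l * (if i = l then 1 else 0)) has_sum c) (I \<times> I)"
    proof -
      have "((\<lambda>(i, l). M i l * (if i = l then 1 else 0)) has_sum c) (I \<times> I) \<longleftrightarrow>
            ((\<lambda>(i, l). M i l) has_sum c) ((\<lambda>i. (i, i)) ` I)"
        by (rule has_sum_cong_neutral) auto
      also have "\<dots> \<longleftrightarrow> ((\<lambda>i. M i i) has_sum c) I"
        by (subst has_sum_reindex) (auto simp: inj_on_def o_def)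
      finally show ?thesis using c by simp
    qed
    thus "((\<lambda>p. l2_inner (case p of (i, l) \<Rightarrow> \<lambda>\<alpha>. M i l * b i \<alpha>) (case p of (i, l) \<Rightarrow> b l)) has_sum c) (I \<times> I)"
      by (rule has_sum_cong[THEN iffD2, rotated]) (use b_l2 in \<open>auto simp: l2_inner_scale_left l2_inner_b\<close>)
  qed (rule \<Gamma>, rule orth)
  hence "((\<lambda>e. l2_inner (T (hardy_coeff e)) (hardy_coeff e)) has_sum c) E"
    unfolding E'_def by (subst (asm) has_sum_reindex[OF inj]) (simp add: o_def)
  moreover have "hardy_inner (op e) e = l2_inner (T (hardy_coeff e)) (hardy_coeff e)" if e: "e \<in> E" for e
  proof -
    obtain a where a: "a \<in> V" "hardy_coeff e = a" "e = hfun a" using coeff[OF e] by metis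
    have "T a \<in> V" using T a(1) by (simp add: has_matrix_def)
    thus ?thesis unfolding a(2) unfolding a(3) op[OF a(1)] using V_l2 a(1) by simp
  qed
  ultimately show "((\<lambda>e. hardy_inner (op e) e) has_sum c) E"
    by (rule has_sum_cong[THEN iffD2, rotated]) 
qed

end

section \<open>Commutators of compressed monomials\<close>

lemma has_sum_sum_finite:
  fixes f :: "'x \<Rightarrow> 'y \<Rightarrow> complex"
  assumes "finite A" "\<And>x. x \<in> A \<Longrightarrow> (f x has_sum S x) B"
  shows "((\<lambda>y. \<Sum>x\<in>A. f x y) has_sum (\<Sum>x\<in>A. S x)) B"
  using assms by (induction A rule: finite_induct) (auto intro: has_sum_add)

context graded_basis
begin

text \<open>
  The matrix of the compression to \<open>V\<close> of multiplication by the monomial with exponent \<open>\<beta>\<close>.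
\<close>

definition shift_matrix :: "('d \<Rightarrow>\<^sub>0 nat) \<Rightarrow> nat \<times> nat \<Rightarrow> nat \<times> nat \<Rightarrow> complex" where
  "shift_matrix \<beta> i l = l2_inner (shift \<beta> (b l)) (b i)"

lemma level_subset: "level n \<subseteq> I"
  by (auto simp: level_def I_def)

lemma fst_level: "l \<in> level n \<Longrightarrow> fst l = n"
  by (auto simp: level_def)

lemma shift_matrix_eq_zero:
  assumes "i \<in> I" "l \<in> I" "fst i \<noteq> fst l + tdeg \<beta>"
  shows "shift_matrix \<beta> i l = 0"
proof -
  have "shift_matrix \<beta> i l = (\<Sum>\<alpha>\<in>homog (fst i). shift \<beta> (b l) \<alpha> * cnj (b i \<alpha>))"
    unfolding shift_matrix_def by (rule l2_inner_homogeneous) (use assms b_homogeneous in \<open>auto simp: I_def\<close>)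
  also have "\<dots> = 0"
  proof (rule sum.neutral, intro ballI)
    fix \<alpha> :: "'d \<Rightarrow>\<^sub>0 nat" assume \<alpha>: "\<alpha> \<in> homog (fst i)"
    have "shift \<beta> (b l) \<alpha> = 0"
    proof (cases "\<alpha> \<in> range ((+) \<beta>)")
      case True
      then obtain \<gamma> where \<gamma>: "\<alpha> = \<beta> + \<gamma>" by blast
      hence "tdeg \<gamma> \<noteq> fst l" using assms(3) \<alpha> by auto
      thus ?thesis using \<gamma> assms(2) b_homogeneous by (auto simp: I_def)
    qed (rule shift_outside)
    thus "shift \<beta> (b l) \<alpha> * cnj (b i \<alpha>) = 0" by simp
  qed
  finally show ?thesis .
qed

lemma coord_proj_shift:
  assumes a: "a \<in> V" and i: "i \<in> I"
  shows "((\<lambda>l. shift_matrix \<gamma> i l * coord a l) has_sum coord (proj (shift \<gamma> a)) i) I"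
proof -
  have u: "backshift \<gamma> (b i) \<in> l2" by (intro backshift_l2 b_l2 i)
  have "coord (proj (shift \<gamma> a)) i = l2_inner a (backshift \<gamma> (b i))"
    unfolding coord_proj[OF i] unfolding coord_def by (rule l2_inner_shift) (auto intro: V_l2 a b_l2 i)
  moreover have "cnj (coord (backshift \<gamma> (b i)) l) = shift_matrix \<gamma> i l" if "l \<in> I" for l
    unfolding shift_matrix_def coord_def l2_inner_shift[OF b_l2[OF that] b_l2[OF i]] by (rule l2_inner_cnj[symmetric])
  hence "((\<lambda>l. shift_matrix \<gamma> i l * coord a l) has_sum l2_inner a (backshift \<gamma> (b i))) I"
    using Parseval_coord[OF a u] by (subst has_sum_cong[where g = "\<lambda>l. coord a l * cnj (coord (backshift \<gamma> (b i)) l)"]) auto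
  ultimately show ?thesis by simp
qed

lemma coord_proj_unshift:
  assumes a: "a \<in> V" and i: "i \<in> I"
  shows "((\<lambda>l. cnj (shift_matrix \<beta> l i) * coord a l) has_sum coord (proj (backshift \<beta> a)) i) I"
proof -
  have u: "shift \<beta> (b i) \<in> l2" by (intro shift_l2 b_l2 i)
  have "coord (proj (backshift \<beta> a)) i = cnj (l2_inner (b i) (backshift \<beta> a))"
    unfolding coord_proj[OF i] unfolding coord_def by (rule l2_inner_cnj)
  also have "l2_inner (b i) (backshift \<beta> a) = l2_inner (shift \<beta> (b i)) a"
    by (rule l2_inner_shift[symmetric]) (auto intro: V_l2 a b_l2 i)
  also have "cnj \<dots> = l2_inner a (shift \<beta> (b i))" by (rule l2_inner_cnj[symmetric])
  finally have "coord (proj (backshift \<beta> a)) i = l2_inner a (shift \<beta> (b i))" .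
  moreover have "coord (shift \<beta> (b i)) l = shift_matrix \<beta> l i" for l
    unfolding shift_matrix_def coord_def ..
  ultimately show ?thesis using Parseval_coord[OF a u] by (simp add: mult.commute)
qed

lemma coord_proj_unshift_level:
  assumes a: "a \<in> V" and i: "i \<in> I"
  shows "coord (proj (backshift \<beta> a)) i = (\<Sum>l\<in>level (fst i + tdeg \<beta>). cnj (shift_matrix \<beta> l i) * coord a l)"
proof -
  have "((\<lambda>l. cnj (shift_matrix \<beta> l i) * coord a l) has_sum coord (proj (backshift \<beta> a)) i) (level (fst i + tdeg \<beta>))"
  proof (rule has_sum_cong_neutral[THEN iffD1, OF _ _ _ coord_proj_unshift[OF a i]])
    fix l assume "l \<in> I - level (fst i + tdeg \<beta>)"
    hence "l \<in> I" "fst l \<noteq> fst i + tdeg \<beta>" by (auto simp: level_def I_def)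
    thus "cnj (shift_matrix \<beta> l i) * coord a l = 0" using shift_matrix_eq_zero[OF _ i] by simp
  qed (use level_subset in auto)
  thus ?thesis using has_sum_finite[OF finite_level] has_sum_unique by blast
qed

lemma coord_proj_shift_level:
  assumes a: "a \<in> V" and i: "i \<in> I"
  shows "coord (proj (shift \<gamma> a)) i = (if tdeg \<gamma> \<le> fst i then \<Sum>l\<in>level (fst i - tdeg \<gamma>). shift_matrix \<gamma> i l * coord a l else 0)"
proof -
  define L where "L = (if tdeg \<gamma> \<le> fst i then level (fst i - tdeg \<gamma>) else {})"
  have LI: "L \<subseteq> I" using level_subset by (simp add: L_def)
  have "((\<lambda>l. shift_matrix \<gamma> i l * coord a l) has_sum coord (proj (shift \<gamma> a)) i) L"
  proof (rule has_sum_cong_neutral[THEN iffD1, OF _ _ _ coord_proj_shift[OF a i]])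
    fix l assume "l \<in> I - L"
    hence "l \<in> I" "fst i \<noteq> fst l + tdeg \<gamma>" by (auto simp: level_def I_def L_def split: if_splits)
    thus "shift_matrix \<gamma> i l * coord a l = 0" using shift_matrix_eq_zero[OF i] by simp
  qed (use LI in auto)
  moreover have "finite L" by (simp add: L_def)
  ultimately have "coord (proj (shift \<gamma> a)) i = (\<Sum>l\<in>L. shift_matrix \<gamma> i l * coord a l)"
    using has_sum_finite has_sum_unique by blast
  thus ?thesis by (simp add: L_def)
qed

definition monom_commutator :: "('d \<Rightarrow>\<^sub>0 nat) \<Rightarrow> ('d \<Rightarrow>\<^sub>0 nat) \<Rightarrow> (('d \<Rightarrow>\<^sub>0 nat) \<Rightarrow> complex) \<Rightarrow> ('d \<Rightarrow>\<^sub>0 nat) \<Rightarrow> complex" where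
  "monom_commutator \<beta> \<gamma> a = (\<lambda>\<alpha>. proj (backshift \<beta> (proj (shift \<gamma> a))) \<alpha> - proj (shift \<gamma> (proj (backshift \<beta> a))) \<alpha>)"

text \<open>
  The matrix of \<open>S\<^sub>\<beta>\<^sup>* S\<^sub>\<gamma> - S\<^sub>\<gamma> S\<^sub>\<beta>\<^sup>*\<close>. The sums are finite because \<open>S\<^sub>\<beta>\<close> maps degree \<open>n\<close> to degree
  \<open>n + \<bar>\<beta>\<bar>\<close>; the second product is absent in degrees below \<open>\<bar>\<gamma>\<bar>\<close>.
\<close>

definition commutator_matrix :: "('d \<Rightarrow>\<^sub>0 nat) \<Rightarrow> ('d \<Rightarrow>\<^sub>0 nat) \<Rightarrow> nat \<times> nat \<Rightarrow> nat \<times> nat \<Rightarrow> complex" where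
  "commutator_matrix \<beta> \<gamma> i m = (\<Sum>l\<in>level (fst i + tdeg \<beta>). cnj (shift_matrix \<beta> l i) * shift_matrix \<gamma> l m) -
     (if tdeg \<gamma> \<le> fst i then \<Sum>l\<in>level (fst i - tdeg \<gamma>). shift_matrix \<gamma> i l * cnj (shift_matrix \<beta> m l) else 0)"

lemma monom_commutator_V: "a \<in> V \<Longrightarrow> monom_commutator \<beta> \<gamma> a \<in> V"
  unfolding monom_commutator_def by (intro V_diff proj_V backshift_l2 shift_l2 proj_l2 V_l2)

lemma monom_commutator_has_sum:
  assumes a: "a \<in> V" and i: "i \<in> I"
  shows "((\<lambda>m. commutator_matrix \<beta> \<gamma> i m * coord a m) has_sum coord (monom_commutator \<beta> \<gamma> a) i) I"
proof -
  have a2: "a \<in> l2" by (rule V_l2[OF a])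
  have V1: "proj (shift \<gamma> a) \<in> V" "proj (backshift \<beta> a) \<in> V"
    by (intro proj_V shift_l2 backshift_l2 a2)+
  have eq: "coord (monom_commutator \<beta> \<gamma> a) i = coord (proj (backshift \<beta> (proj (shift \<gamma> a)))) i - coord (proj (shift \<gamma> (proj (backshift \<beta> a)))) i"
    unfolding monom_commutator_def coord_def by (intro l2_inner_diff_left proj_l2 backshift_l2 shift_l2 a2 b_l2 i)
  have 1: "((\<lambda>m. \<Sum>l\<in>level (fst i + tdeg \<beta>). cnj (shift_matrix \<beta> l i) * (shift_matrix \<gamma> l m * coord a m)) has_sum
      coord (proj (backshift \<beta> (proj (shift \<gamma> a)))) i) I"
    unfolding coord_proj_unshift_level[OF V1(1) i]
    by (intro has_sum_sum_finite has_sum_cmult_right coord_proj_shift a) (use level_subset in auto)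
  have 2: "((\<lambda>m. if tdeg \<gamma> \<le> fst i then \<Sum>l\<in>level (fst i - tdeg \<gamma>). shift_matrix \<gamma> i l * (cnj (shift_matrix \<beta> m l) * coord a m) else 0) has_sum
      coord (proj (shift \<gamma> (proj (backshift \<beta> a)))) i) I"
  proof (cases "tdeg \<gamma> \<le> fst i")
    case True
    have "((\<lambda>m. \<Sum>l\<in>level (fst i - tdeg \<gamma>). shift_matrix \<gamma> i l * (cnj (shift_matrix \<beta> m l) * coord a m)) has_sum
        (\<Sum>l\<in>level (fst i - tdeg \<gamma>). shift_matrix \<gamma> i l * coord (proj (backshift \<beta> a)) l)) I"
      by (intro has_sum_sum_finite has_sum_cmult_right coord_proj_unshift a) (use level_subset in auto)
    thus ?thesis using True by (simp add: coord_proj_shift_level[OF V1(2) i])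
  qed (simp add: coord_proj_shift_level[OF V1(2) i])
  have "((\<lambda>m. (\<Sum>l\<in>level (fst i + tdeg \<beta>). cnj (shift_matrix \<beta> l i) * (shift_matrix \<gamma> l m * coord a m)) +
      - (if tdeg \<gamma> \<le> fst i then \<Sum>l\<in>level (fst i - tdeg \<gamma>). shift_matrix \<gamma> i l * (cnj (shift_matrix \<beta> m l) * coord a m) else 0)) has_sum
     (coord (proj (backshift \<beta> (proj (shift \<gamma> a)))) i + - coord (proj (shift \<gamma> (proj (backshift \<beta> a)))) i)) I"
    by (intro has_sum_add has_sum_uminusI 1 2)
  moreover have "(\<Sum>l\<in>level (fst i + tdeg \<beta>). cnj (shift_matrix \<beta> l i) * (shift_matrix \<gamma> l m * coord a m)) +
      - (if tdeg \<gamma> \<le> fst i then \<Sum>l\<in>level (fst i - tdeg \<gamma>). shift_matrix \<gamma> i l * (cnj (shift_matrix \<beta> m l) * coord a m) else 0)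
      = commutator_matrix \<beta> \<gamma> i m * coord a m" for m
    by (simp add: commutator_matrix_def left_diff_distrib sum_distrib_right mult.assoc)
  ultimately show ?thesis unfolding eq by simp
qed

lemma commutator_matrix_eq_zero:
  assumes "i \<in> I" "m \<in> I" "fst i + tdeg \<beta> \<noteq> fst m + tdeg \<gamma>"
  shows "commutator_matrix \<beta> \<gamma> i m = 0"
proof -
  have 1: "shift_matrix \<gamma> l m = 0" if "l \<in> level (fst i + tdeg \<beta>)" for l
    by (rule shift_matrix_eq_zero) (use that level_subset fst_level[OF that] assms in auto)
  have 2: "shift_matrix \<beta> m l = 0" if "l \<in> level (fst i - tdeg \<gamma>)" "tdeg \<gamma> \<le> fst i" for l
    by (rule shift_matrix_eq_zero) (use that level_subset fst_level[OF that(1)] assms in auto)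
  show ?thesis unfolding commutator_matrix_def by (auto simp: 1 2 intro!: sum.neutral)
qed

lemma proj_lincomb:
  assumes "\<And>x. x \<in> A \<Longrightarrow> v x \<in> l2"
  shows "proj (\<lambda>\<alpha>. \<Sum>x\<in>A. c x * v x \<alpha>) = (\<lambda>\<alpha>. \<Sum>x\<in>A. c x * proj (v x) \<alpha>)"
proof
  fix \<alpha> :: "'d \<Rightarrow>\<^sub>0 nat"
  have "coord (\<lambda>\<alpha>. \<Sum>x\<in>A. c x * v x \<alpha>) i = (\<Sum>x\<in>A. c x * coord (v x) i)" if "i \<in> I" for i
    unfolding coord_def by (rule l2_inner_sum_left) (auto intro: assms b_l2 that)
  hence "proj (\<lambda>\<alpha>. \<Sum>x\<in>A. c x * v x \<alpha>) \<alpha> = (\<Sum>j<r (tdeg \<alpha>). \<Sum>x\<in>A. c x * (coord (v x) (tdeg \<alpha>, j) * b (tdeg \<alpha>, j) \<alpha>))"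
    unfolding proj_def by (intro sum.cong refl) (simp add: I_def sum_distrib_right mult.assoc)
  also have "\<dots> = (\<Sum>x\<in>A. \<Sum>j<r (tdeg \<alpha>). c x * (coord (v x) (tdeg \<alpha>, j) * b (tdeg \<alpha>, j) \<alpha>))"
    by (rule sum.swap)
  finally show "proj (\<lambda>\<alpha>. \<Sum>x\<in>A. c x * v x \<alpha>) \<alpha> = (\<Sum>x\<in>A. c x * proj (v x) \<alpha>)"
    by (simp add: proj_def sum_distrib_left)
qed

definition poly_commutator :: "'d mpoly \<Rightarrow> 'd mpoly \<Rightarrow> (('d \<Rightarrow>\<^sub>0 nat) \<Rightarrow> complex) \<Rightarrow> ('d \<Rightarrow>\<^sub>0 nat) \<Rightarrow> complex" where
  "poly_commutator f1 f2 a = (\<lambda>\<alpha>. \<Sum>x\<in>Poly_Mapping.keys f1 \<times> Poly_Mapping.keys f2.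
     cnj (Poly_Mapping.lookup f1 (fst x)) * Poly_Mapping.lookup f2 (snd x) * monom_commutator (fst x) (snd x) a \<alpha>)"

text \<open>
  The commutator is conjugate linear in \<open>f1\<close> and linear in \<open>f2\<close>.
\<close>

lemma commutator_hfun:
  assumes a: "a \<in> V"
  shows "commutator (adjoint_on (hfun ` V) (compression (hfun ` V) f1)) (compression (hfun ` V) f2) (hfun a)
     = hfun (poly_commutator f1 f2 a)"
proof -
  let ?A = "\<lambda>\<beta>. cnj (Poly_Mapping.lookup f1 \<beta>)" and ?B = "Poly_Mapping.lookup f2"
  let ?K1 = "Poly_Mapping.keys f1" and ?K2 = "Poly_Mapping.keys f2"
  have a2: "a \<in> l2" by (rule V_l2[OF a])
  have V1: "proj (mult_coeff f2 a) \<in> V" "proj (mult_coeff_adj f1 a) \<in> V"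
    by (intro proj_V mult_coeff_l2 mult_coeff_adj_l2 a2)+
  have 1: "proj (mult_coeff_adj f1 (proj (mult_coeff f2 a))) =
     (\<lambda>\<alpha>. \<Sum>\<beta>\<in>?K1. \<Sum>\<gamma>\<in>?K2. ?A \<beta> * ?B \<gamma> * proj (backshift \<beta> (proj (shift \<gamma> a))) \<alpha>)"
  proof -
    have p: "proj (mult_coeff f2 a) = (\<lambda>\<alpha>. \<Sum>\<gamma>\<in>?K2. ?B \<gamma> * proj (shift \<gamma> a) \<alpha>)"
      unfolding mult_coeff_def by (rule proj_lincomb) (intro shift_l2 a2)
    have u: "backshift \<beta> (proj (mult_coeff f2 a)) = (\<lambda>\<alpha>. \<Sum>\<gamma>\<in>?K2. ?B \<gamma> * backshift \<beta> (proj (shift \<gamma> a)) \<alpha>)" for \<beta>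
      unfolding p by (rule ext) (simp add: backshift_def)
    have "proj (mult_coeff_adj f1 (proj (mult_coeff f2 a))) =
       (\<lambda>\<alpha>. \<Sum>\<beta>\<in>?K1. ?A \<beta> * proj (backshift \<beta> (proj (mult_coeff f2 a))) \<alpha>)"
      unfolding mult_coeff_adj_def by (rule proj_lincomb) (intro backshift_l2 V_l2 V1)
    also have "\<dots> = (\<lambda>\<alpha>. \<Sum>\<beta>\<in>?K1. ?A \<beta> * (\<Sum>\<gamma>\<in>?K2. ?B \<gamma> * proj (backshift \<beta> (proj (shift \<gamma> a))) \<alpha>))"
      unfolding u by (subst proj_lincomb) (auto intro: backshift_l2 proj_l2 shift_l2 a2)
    finally show ?thesis by (simp add: sum_distrib_left mult.assoc)
  qed
  have 2: "proj (mult_coeff f2 (proj (mult_coeff_adj f1 a))) =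
     (\<lambda>\<alpha>. \<Sum>\<beta>\<in>?K1. \<Sum>\<gamma>\<in>?K2. ?A \<beta> * ?B \<gamma> * proj (shift \<gamma> (proj (backshift \<beta> a))) \<alpha>)"
  proof -
    have p: "proj (mult_coeff_adj f1 a) = (\<lambda>\<alpha>. \<Sum>\<beta>\<in>?K1. ?A \<beta> * proj (backshift \<beta> a) \<alpha>)"
      unfolding mult_coeff_adj_def by (rule proj_lincomb) (intro backshift_l2 a2)
    have u: "shift \<gamma> (proj (mult_coeff_adj f1 a)) = (\<lambda>\<alpha>. \<Sum>\<beta>\<in>?K1. ?A \<beta> * shift \<gamma> (proj (backshift \<beta> a)) \<alpha>)" for \<gamma>
      unfolding p by (rule ext) (simp add: shift_def)
    have "proj (mult_coeff f2 (proj (mult_coeff_adj f1 a))) =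
       (\<lambda>\<alpha>. \<Sum>\<gamma>\<in>?K2. ?B \<gamma> * proj (shift \<gamma> (proj (mult_coeff_adj f1 a))) \<alpha>)"
      unfolding mult_coeff_def[of f2] by (rule proj_lincomb) (intro shift_l2 V_l2 V1)
    also have "\<dots> = (\<lambda>\<alpha>. \<Sum>\<gamma>\<in>?K2. ?B \<gamma> * (\<Sum>\<beta>\<in>?K1. ?A \<beta> * proj (shift \<gamma> (proj (backshift \<beta> a))) \<alpha>))"
      unfolding u by (subst proj_lincomb) (auto intro: backshift_l2 proj_l2 shift_l2 a2)
    also have "\<dots> = (\<lambda>\<alpha>. \<Sum>\<beta>\<in>?K1. \<Sum>\<gamma>\<in>?K2. ?A \<beta> * ?B \<gamma> * proj (shift \<gamma> (proj (backshift \<beta> a))) \<alpha>)"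
      by (rule ext, subst sum.swap) (simp add: sum_distrib_left mult_ac)
    finally show ?thesis .
  qed
  have "commutator (adjoint_on (hfun ` V) (compression (hfun ` V) f1)) (compression (hfun ` V) f2) (hfun a)
     = hfun (proj (mult_coeff_adj f1 (proj (mult_coeff f2 a)))) - hfun (proj (mult_coeff f2 (proj (mult_coeff_adj f1 a))))"
    using V1 a a2 V_l2 by (simp add: commutator_def compression_hfun adjoint_on_compression_hfun)
  also have "\<dots> = hfun (\<lambda>\<alpha>. proj (mult_coeff_adj f1 (proj (mult_coeff f2 a))) \<alpha> - proj (mult_coeff f2 (proj (mult_coeff_adj f1 a))) \<alpha>)"
    by (intro hfun_diff proj_l2 mult_coeff_l2 mult_coeff_adj_l2 a2)
  also have "(\<lambda>\<alpha>. proj (mult_coeff_adj f1 (proj (mult_coeff f2 a))) \<alpha> - proj (mult_coeff f2 (proj (mult_coeff_adj f1 a))) \<alpha>) = poly_commutator f1 f2 a"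
    unfolding 1 2 poly_commutator_def monom_commutator_def
    by (simp add: sum.cartesian_product case_prod_unfold right_diff_distrib sum_subtractf)
  finally show ?thesis .
qed

end

text \<open>
  The hypothesis on the bases that yields the trace formula: eventually the dimensions are constant,
  and the blocks of \<open>S\<^sub>\<beta>\<close> expand around the identity matrix.
\<close>

locale asymptotic_basis = graded_basis +
  fixes R n0 :: nat
  assumes r_eq: "\<And>n. n \<ge> n0 \<Longrightarrow> r n = R"
    and shift_matrix_expands: "\<And>\<beta> j' j. j' < R \<Longrightarrow> j < R \<Longrightarrow> \<exists>u B. expands2 u (if j' = j then 1 else 0) B \<and>
        (\<forall>n\<ge>n0. l2_inner (shift \<beta> (b (n, j))) (b (n + tdeg \<beta>, j')) = complex_of_real (u n))"
begin

lemma shift_matrix_expansion: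
  obtains u B where
    "\<And>\<beta> j' j. j' < R \<Longrightarrow> j < R \<Longrightarrow> expands2 (u \<beta> j' j) (if j' = j then 1 else 0) (B \<beta> j' j)"
    "\<And>\<beta> j' j n. j' < R \<Longrightarrow> j < R \<Longrightarrow> n \<ge> n0 \<Longrightarrow> shift_matrix \<beta> (n + tdeg \<beta>, j') (n, j) = complex_of_real (u \<beta> j' j n)"
proof -
  define Q where "Q = (\<lambda>\<beta> j' j y. expands2 (fst y) (if j' = j then 1 else 0) (snd y) \<and>
     (\<forall>n\<ge>n0. l2_inner (shift \<beta> (b (n, j))) (b (n + tdeg \<beta>, j')) = complex_of_real (fst y n)))"
  define Y where "Y = (\<lambda>\<beta> j' j. SOME y. Q \<beta> j' j y)"
  have Q: "Q \<beta> j' j (Y \<beta> j' j)" if j: "j' < R" "j < R" for \<beta> j' j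
  proof -
    obtain u B where "expands2 u (if j' = j then 1 else 0) B"
      "\<forall>n\<ge>n0. l2_inner (shift \<beta> (b (n, j))) (b (n + tdeg \<beta>, j')) = complex_of_real (u n)"
      using shift_matrix_expands[OF j, of \<beta>] by blast
    hence "Q \<beta> j' j (u, B)" by (simp add: Q_def)
    thus ?thesis unfolding Y_def by (rule someI)
  qed
  show ?thesis
  proof (rule that[of "\<lambda>\<beta> j' j. fst (Y \<beta> j' j)" "\<lambda>\<beta> j' j. snd (Y \<beta> j' j)"])
    fix \<beta> j' j assume j: "j' < R" "j < R"
    show "expands2 (fst (Y \<beta> j' j)) (if j' = j then 1 else 0) (snd (Y \<beta> j' j))"
      using Q[OF j, of \<beta>] unfolding Q_def by (rule conjunct1)
    fix n assume "n \<ge> n0"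
    thus "shift_matrix \<beta> (n + tdeg \<beta>, j') (n, j) = complex_of_real (fst (Y \<beta> j' j) n)"
      using Q[OF j, of \<beta>] unfolding Q_def shift_matrix_def by blast
  qed
qed

lemma level_eq: "n \<ge> n0 \<Longrightarrow> (\<Sum>l\<in>level n. f l) = (\<Sum>j<R. f (n, j))"
  by (simp add: sum_level r_eq)

text \<open>
  The index \<open>t\<close> is the degree through which the first product \<open>S\<^sub>\<beta>\<^sup>* S\<^sub>\<gamma>\<close> passes. With blocks
  \<open>1 + B\<^sub>\<beta>/t\<close> and \<open>1 + B\<^sub>\<gamma>/t\<close> both products are \<open>1 + (B\<^sub>\<gamma> + B\<^sub>\<beta>\<^sup>T)/t\<close> up to \<open>O(1 / t\<^sup>2)\<close>, so
  the constant terms and the terms of order \<open>1/t\<close> cancel in \<open>v\<close>.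
\<close>

lemma commutator_matrix_decay:
  assumes k: "k < R" and l: "l < R"
  shows "\<exists>K. \<forall>\<^sub>F t in sequentially. norm (commutator_matrix \<beta> \<gamma> (t - tdeg \<beta>, k) (t - tdeg \<gamma>, l)) \<le> K / (real t + 1)\<^sup>2"
proof -
  obtain u B where u: "\<And>\<beta> j' j. j' < R \<Longrightarrow> j < R \<Longrightarrow> expands2 (u \<beta> j' j) (if j' = j then 1 else 0) (B \<beta> j' j)"
    and su: "\<And>\<beta> j' j n. j' < R \<Longrightarrow> j < R \<Longrightarrow> n \<ge> n0 \<Longrightarrow> shift_matrix \<beta> (n + tdeg \<beta>, j') (n, j) = complex_of_real (u \<beta> j' j n)"
    using shift_matrix_expansion by blast
  let ?p = "tdeg \<beta>" and ?q = "tdeg \<gamma>"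
  define v where "v = (\<lambda>t. (\<Sum>j<R. u \<beta> j k (t - ?p) * u \<gamma> j l (t - ?q)) -
      (\<Sum>j<R. u \<gamma> k j (t - (?p + ?q)) * u \<beta> l j (t - (?p + ?q))))"
  have \<delta>: "(\<Sum>j<R. (if j = x then 1 else 0) * c j) = c x" "(\<Sum>j<R. (if x = j then 1 else 0) * c j) = c x"
       "(\<Sum>j<R. c j * (if j = x then 1 else 0)) = c x" "(\<Sum>j<R. c j * (if x = j then 1 else 0)) = c x"
       if "x < R" for x and c :: "nat \<Rightarrow> real"
  proof -
    have eq: "(if j = x then 1 else 0) * c j = (if j = x then c x else 0)" "(if x = j then 1 else 0) * c j = (if j = x then c x else 0)" for j
      by auto
    show "(\<Sum>j<R. (if j = x then 1 else 0) * c j) = c x" "(\<Sum>j<R. (if x = j then 1 else 0) * c j) = c x"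
      unfolding eq using that by simp_all
    thus "(\<Sum>j<R. c j * (if j = x then 1 else 0)) = c x" "(\<Sum>j<R. c j * (if x = j then 1 else 0)) = c x"
      by (simp_all only: mult.commute)
  qed
  have "expands2 v ((\<Sum>j<R. (if j = k then 1 else 0) * (if j = l then 1 else 0)) - (\<Sum>j<R. (if k = j then 1 else 0) * (if l = j then 1 else 0)))
     ((\<Sum>j<R. (if j = k then 1 else 0) * B \<gamma> j l + B \<beta> j k * (if j = l then 1 else 0)) -
      (\<Sum>j<R. (if k = j then 1 else 0) * B \<beta> l j + B \<gamma> k j * (if l = j then 1 else 0)))"
    unfolding v_def using k l by (intro expands2_diff expands2_sum expands2_mult expands2_shift_back u) auto
  hence v0: "expands2 v 0 0" using k l by (simp only: sum.distrib \<delta>) (simp add: eq_commute)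
  then obtain K where K: "\<And>t. \<bar>v t\<bar> \<le> K / (real t + 1)\<^sup>2" using expands2_zero_bound by blast
  have "\<forall>\<^sub>F t in sequentially. norm (commutator_matrix \<beta> \<gamma> (t - ?p, k) (t - ?q, l)) \<le> K / (real t + 1)\<^sup>2"
    using eventually_ge_at_top[of "n0 + ?p + ?q"]
  proof eventually_elim
    case (elim t)
    have s1: "shift_matrix \<beta> (t, j) (t - ?p, k) = complex_of_real (u \<beta> j k (t - ?p))" if "j < R" for j
      using su[OF that k, of "t - ?p" \<beta>] elim by simp
    have s2: "shift_matrix \<gamma> (t, j) (t - ?q, l) = complex_of_real (u \<gamma> j l (t - ?q))" if "j < R" for j
      using su[OF that l, of "t - ?q" \<gamma>] elim by simp
    have s3: "shift_matrix \<gamma> (t - ?p, k) (t - (?p + ?q), j) = complex_of_real (u \<gamma> k j (t - (?p + ?q)))" if "j < R" for j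
    proof -
      have "t - (?p + ?q) + ?q = t - ?p" using elim by simp
      thus ?thesis using su[OF k that, of "t - (?p + ?q)" \<gamma>] elim by simp
    qed
    have s4: "shift_matrix \<beta> (t - ?q, l) (t - (?p + ?q), j) = complex_of_real (u \<beta> l j (t - (?p + ?q)))" if "j < R" for j
    proof -
      have "t - (?p + ?q) + ?p = t - ?q" using elim by simp
      thus ?thesis using su[OF l that, of "t - (?p + ?q)" \<beta>] elim by simp
    qed
    have t: "t - ?p + ?p = t" "t - ?p - ?q = t - (?p + ?q)" "?q \<le> t - ?p" "t \<ge> n0" "t - (?p + ?q) \<ge> n0"
      using elim by auto
    have "commutator_matrix \<beta> \<gamma> (t - ?p, k) (t - ?q, l) = complex_of_real (v t)"
      unfolding commutator_matrix_def fst_conv t(1,2) level_eq[OF t(4)] level_eq[OF t(5)] v_def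
      using t(3) by (simp add: s1 s2 s3 s4)
    thus ?case using K[of t] by simp
  qed
  thus ?thesis by blast
qed

text \<open>
  The nonzero entries are determined by \<open>t\<close> and two indices bounded by the largest dimension, and
  \<open>\<Sum>t. 1 / (t + 1)\<^sup>2\<close> converges.
\<close>

lemma commutator_matrix_summable:
  "(\<lambda>(i, m). norm (commutator_matrix \<beta> \<gamma> i m)) summable_on (I \<times> I)"
proof -
  let ?p = "tdeg \<beta>" and ?q = "tdeg \<gamma>"
  define Rm where "Rm = R + (\<Sum>n<n0. r n)"
  have r_le: "r n \<le> Rm" for n
  proof (cases "n < n0")
    case True
    hence "r n \<le> (\<Sum>n<n0. r n)" by (intro member_le_sum) auto
    thus ?thesis by (simp add: Rm_def)
  qed (simp add: r_eq Rm_def)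
  have "\<exists>K. \<forall>t. (t - ?p, k) \<in> I \<longrightarrow> (t - ?q, l) \<in> I \<longrightarrow>
      norm (commutator_matrix \<beta> \<gamma> (t - ?p, k) (t - ?q, l)) \<le> K / (real t + 1)\<^sup>2" for k l
  proof -
    let ?f = "\<lambda>t. norm (commutator_matrix \<beta> \<gamma> (t - ?p, k) (t - ?q, l))"
    have "\<exists>K t0. \<forall>t\<ge>t0. (t - ?p, k) \<in> I \<longrightarrow> (t - ?q, l) \<in> I \<longrightarrow> ?f t \<le> K / (real t + 1)\<^sup>2"
    proof (cases "k < R \<and> l < R")
      case True
      thus ?thesis using commutator_matrix_decay[of k l \<beta> \<gamma>] unfolding eventually_sequentially by blast
    next
      case False
      have "\<forall>t\<ge>n0 + ?p + ?q. (t - ?p, k) \<notin> I \<or> (t - ?q, l) \<notin> I"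
        using False by (auto simp: I_def r_eq)
      thus ?thesis by blast
    qed
    then obtain K t0 where K: "\<And>t. t \<ge> t0 \<Longrightarrow> (t - ?p, k) \<in> I \<Longrightarrow> (t - ?q, l) \<in> I \<Longrightarrow> ?f t \<le> K / (real t + 1)\<^sup>2" by blast
    define K' where "K' = \<bar>K\<bar> + (\<Sum>t<t0. ?f t * (real t + 1)\<^sup>2)"
    have "?f t \<le> K' / (real t + 1)\<^sup>2" if "(t - ?p, k) \<in> I" "(t - ?q, l) \<in> I" for t
    proof (cases "t < t0")
      case True
      have "?f t * (real t + 1)\<^sup>2 \<le> (\<Sum>t<t0. ?f t * (real t + 1)\<^sup>2)"
        by (rule member_le_sum) (use True in auto)
      hence "?f t * (real t + 1)\<^sup>2 \<le> K'" by (simp add: K'_def)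
      thus ?thesis by (simp add: field_simps)
    next
      case False
      have "?f t \<le> K / (real t + 1)\<^sup>2" using K False that by simp
      also have "\<dots> \<le> K' / (real t + 1)\<^sup>2"
        by (intro divide_right_mono) (auto simp: K'_def intro!: add_increasing2 sum_nonneg)
      finally show ?thesis .
    qed
    thus ?thesis by blast
  qed
  then obtain K where K: "\<And>k l t. (t - ?p, k) \<in> I \<Longrightarrow> (t - ?q, l) \<in> I \<Longrightarrow>
      norm (commutator_matrix \<beta> \<gamma> (t - ?p, k) (t - ?q, l)) \<le> K k l / (real t + 1)\<^sup>2"
    by metis
  define C where "C = (\<Sum>k<Rm. \<Sum>l<Rm. \<bar>K k l\<bar>)"
  define S where "S = {(i, m)\<in>I \<times> I. fst i + ?p = fst m + ?q}"
  define \<phi> where "\<phi> = (\<lambda>(i :: nat \<times> nat, m :: nat \<times> nat). (fst i + ?p, snd i, snd m))"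
  have bound: "norm (commutator_matrix \<beta> \<gamma> i m) \<le> C / (real (fst i + ?p) + 1)\<^sup>2" if "(i, m) \<in> S" for i m
  proof -
    obtain n k n' l where im: "i = (n, k)" "m = (n', l)" by (cases i, cases m) auto
    have I: "(n, k) \<in> I" "(n', l) \<in> I" "n + ?p = n' + ?q" using that im by (auto simp: S_def)
    hence kl: "k < Rm" "l < Rm" using r_le[of n] r_le[of n'] by (auto simp: I_def)
    have n': "n + ?p - ?q = n'" using I(3) by simp
    have "\<bar>K k l\<bar> \<le> (\<Sum>l<Rm. \<bar>K k l\<bar>)"
      by (rule member_le_sum[of l "{..<Rm}" "\<lambda>l. \<bar>K k l\<bar>"]) (use kl in auto)
    also have "\<dots> \<le> C" unfolding C_def
      by (rule member_le_sum[of k "{..<Rm}" "\<lambda>k. \<Sum>l<Rm. \<bar>K k l\<bar>"]) (use kl in \<open>auto intro: sum_nonneg\<close>)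
    finally have KC: "K k l \<le> C" by simp
    have "norm (commutator_matrix \<beta> \<gamma> i m) \<le> K k l / (real (n + ?p) + 1)\<^sup>2"
      using K[of "n + ?p" k l, unfolded add_diff_cancel_right' n'] I(1,2) unfolding im by blast
    also have "\<dots> \<le> C / (real (n + ?p) + 1)\<^sup>2" using KC by (intro divide_right_mono) auto
    finally show ?thesis using im by simp
  qed
  have "C \<ge> 0" by (auto simp: C_def intro!: sum_nonneg)
  have g: "(\<lambda>(t, kl). C / (real t + 1)\<^sup>2) summable_on (UNIV \<times> ({..<Rm} \<times> {..<Rm}))"
  proof (rule summable_on_SigmaI)
    show "((\<lambda>y. case (t, y) of (t, kl) \<Rightarrow> C / (real t + 1)\<^sup>2) has_sum real (Rm * Rm) * (C / (real t + 1)\<^sup>2)) ({..<Rm} \<times> {..<Rm})" for t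
      by (rule has_sum_finiteI) auto
    have "summable (\<lambda>t. inverse (real (Suc t) ^ 2))"
      using inverse_power_summable[of 2, where 'a = real] by (subst summable_Suc_iff) simp
    hence "summable (\<lambda>t. real (Rm * Rm) * C * inverse (real (Suc t) ^ 2))" by (rule summable_mult)
    hence "summable (\<lambda>t. real (Rm * Rm) * (C / (real t + 1)\<^sup>2))"
      by (simp add: divide_inverse add.commute mult.assoc)
    thus "(\<lambda>t. real (Rm * Rm) * (C / (real t + 1)\<^sup>2)) summable_on UNIV"
      using \<open>C \<ge> 0\<close> by (subst summable_on_UNIV_nonneg_real_iff) auto
  qed (use \<open>C \<ge> 0\<close> in auto)
  have inj: "inj_on \<phi> S" by (auto simp: inj_on_def \<phi>_def S_def)
  have "\<phi> ` S \<subseteq> UNIV \<times> ({..<Rm} \<times> {..<Rm})"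
  proof
    fix y assume "y \<in> \<phi> ` S"
    then obtain n k n' l where "y = (n + ?p, k, l)" "k < r n" "l < r n'" by (auto simp: \<phi>_def S_def I_def)
    thus "y \<in> UNIV \<times> ({..<Rm} \<times> {..<Rm})" using r_le[of n] r_le[of n'] by auto
  qed
  with g have "(\<lambda>(t, kl). C / (real t + 1)\<^sup>2) summable_on (\<phi> ` S)" by (rule summable_on_subset_banach)
  hence "((\<lambda>(t, kl). C / (real t + 1)\<^sup>2) \<circ> \<phi>) summable_on S" by (subst (asm) summable_on_reindex[OF inj])
  hence "(\<lambda>(i, m). norm (commutator_matrix \<beta> \<gamma> i m)) summable_on S"
    by (rule summable_on_comparison_test) (use bound in \<open>auto simp: \<phi>_def\<close>)
  also have "?this \<longleftrightarrow> ?thesis"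
  proof (rule summable_on_cong_neutral)
    fix x assume x: "x \<in> I \<times> I - S"
    obtain i m where im: "x = (i, m)" by (rule prod.exhaust)
    have "commutator_matrix \<beta> \<gamma> i m = 0" by (rule commutator_matrix_eq_zero) (use x im in \<open>auto simp: S_def\<close>)
    thus "(case x of (i, m) \<Rightarrow> norm (commutator_matrix \<beta> \<gamma> i m)) = 0" by (simp add: im)
  qed (auto simp: S_def)
  finally show ?thesis .
qed

lemma has_matrix_monom_commutator: "has_matrix (monom_commutator \<beta> \<gamma>) (commutator_matrix \<beta> \<gamma>)"
  unfolding has_matrix_def using monom_commutator_V monom_commutator_has_sum commutator_matrix_summable by blast

text \<open>
  With \<open>\<tau> n\<close> the trace of \<open>S\<^sub>\<beta>\<^sup>* S\<^sub>\<gamma>\<close> on degree \<open>n\<close>, the trace of \<open>S\<^sub>\<gamma> S\<^sub>\<beta>\<^sup>*\<close> on degree \<open>n\<close> is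
  \<open>\<tau> (n - p)\<close>. The sum over \<open>n < m + p\<close> of the differences is the sum of the last \<open>p\<close> values of
  \<open>\<tau>\<close>, each of which tends to \<open>R\<close>.
\<close>

lemma commutator_matrix_trace:
  "((\<lambda>i. commutator_matrix \<beta> \<gamma> i i) has_sum (if tdeg \<beta> = tdeg \<gamma> then of_nat (tdeg \<beta> * R) else 0)) I"
proof (cases "tdeg \<beta> = tdeg \<gamma>")
  case False
  have "((\<lambda>i. commutator_matrix \<beta> \<gamma> i i) has_sum 0) I"
    by (rule has_sum_0) (use False in \<open>auto intro: commutator_matrix_eq_zero\<close>)
  thus ?thesis using False by simp
next
  case True
  let ?p = "tdeg \<beta>"
  obtain u B where u: "\<And>\<beta> j' j. j' < R \<Longrightarrow> j < R \<Longrightarrow> expands2 (u \<beta> j' j) (if j' = j then 1 else 0) (B \<beta> j' j)"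
    and su: "\<And>\<beta> j' j n. j' < R \<Longrightarrow> j < R \<Longrightarrow> n \<ge> n0 \<Longrightarrow> shift_matrix \<beta> (n + tdeg \<beta>, j') (n, j) = complex_of_real (u \<beta> j' j n)"
    using shift_matrix_expansion by blast
  define \<tau> where "\<tau> = (\<lambda>n. \<Sum>i\<in>level n. \<Sum>l\<in>level (n + ?p). cnj (shift_matrix \<beta> l i) * shift_matrix \<gamma> l i)"
  have \<tau>_lim: "\<tau> \<longlonglongrightarrow> of_nat R"
  proof -
    have "(\<lambda>n. \<Sum>j<R. \<Sum>j'<R. u \<beta> j' j n * u \<gamma> j' j n) \<longlonglongrightarrow>
        (\<Sum>j<R. \<Sum>j'<R. (if j' = j then 1 else 0) * (if j' = j then 1 else 0))"
      by (intro tendsto_sum tendsto_mult expands2_tendsto[OF u]) auto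
    also have "(\<Sum>j<R. \<Sum>j'<R. (if j' = j then 1 else 0) * (if j' = j then 1 else 0)) = (\<Sum>j<R. \<Sum>j'<R. if j' = j then 1 else (0::real))"
      by (intro sum.cong refl) auto
    also have "\<dots> = (\<Sum>j<R. 1)" by (intro sum.cong refl) simp
    also have "\<dots> = real R" by simp
    finally have "(\<lambda>n. complex_of_real (\<Sum>j<R. \<Sum>j'<R. u \<beta> j' j n * u \<gamma> j' j n)) \<longlonglongrightarrow> complex_of_real (real R)"
      by (rule tendsto_of_real)
    moreover have "\<forall>\<^sub>F n in sequentially. complex_of_real (\<Sum>j<R. \<Sum>j'<R. u \<beta> j' j n * u \<gamma> j' j n) = \<tau> n"
      using eventually_ge_at_top[of n0]
    proof eventually_elim
      case (elim n)
      have n': "n + ?p \<ge> n0" using elim by simp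
      have "shift_matrix \<gamma> (n + ?p, j') (n, j) = complex_of_real (u \<gamma> j' j n)" if "j' < R" "j < R" for j j'
        using su[OF that elim, of \<gamma>] True by simp
      thus ?case unfolding \<tau>_def level_eq[OF elim] level_eq[OF n'] using su[OF _ _ elim, of _ _ \<beta>] by simp
    qed
    ultimately show ?thesis by (simp add: tendsto_cong)
  qed
  have diag: "(\<Sum>j<r n. commutator_matrix \<beta> \<gamma> (n, j) (n, j)) = \<tau> n - (if ?p \<le> n then \<tau> (n - ?p) else 0)" for n
  proof -
    have "(\<Sum>j<r n. commutator_matrix \<beta> \<gamma> (n, j) (n, j)) = (\<Sum>i\<in>level n. commutator_matrix \<beta> \<gamma> i i)" by (simp add: sum_level)
    also have "\<dots> = (\<Sum>i\<in>level n. (\<Sum>l\<in>level (n + ?p). cnj (shift_matrix \<beta> l i) * shift_matrix \<gamma> l i) -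
        (if ?p \<le> n then \<Sum>l\<in>level (n - ?p). shift_matrix \<gamma> i l * cnj (shift_matrix \<beta> i l) else 0))"
      by (intro sum.cong refl) (simp add: commutator_matrix_def fst_level True)
    also have "\<dots> = \<tau> n - (\<Sum>i\<in>level n. if ?p \<le> n then \<Sum>l\<in>level (n - ?p). shift_matrix \<gamma> i l * cnj (shift_matrix \<beta> i l) else 0)"
      by (simp add: sum_subtractf \<tau>_def)
    also have "(\<Sum>i\<in>level n. if ?p \<le> n then \<Sum>l\<in>level (n - ?p). shift_matrix \<gamma> i l * cnj (shift_matrix \<beta> i l) else 0) = (if ?p \<le> n then \<tau> (n - ?p) else 0)"
    proof (cases "?p \<le> n")
      case le: True
      have "(\<Sum>i\<in>level n. \<Sum>l\<in>level (n - ?p). shift_matrix \<gamma> i l * cnj (shift_matrix \<beta> i l)) = (\<Sum>l\<in>level (n - ?p). \<Sum>i\<in>level n. shift_matrix \<gamma> i l * cnj (shift_matrix \<beta> i l))"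
        by (rule sum.swap)
      thus ?thesis using le by (simp add: \<tau>_def mult.commute)
    qed simp
    finally show ?thesis .
  qed
  have "(\<lambda>p. commutator_matrix \<beta> \<gamma> (fst p) (snd p)) summable_on (I \<times> I)"
    using commutator_matrix_summable[of \<beta> \<gamma>] unfolding case_prod_unfold by (rule abs_summable_summable)
  hence "(\<lambda>p. commutator_matrix \<beta> \<gamma> (fst p) (snd p)) summable_on ((\<lambda>i. (i, i)) ` I)"
    by (rule summable_on_subset_banach) auto
  hence "(\<lambda>i. commutator_matrix \<beta> \<gamma> i i) summable_on I"
    by (subst (asm) summable_on_reindex) (auto simp: inj_on_def o_def)
  then obtain c where c: "((\<lambda>i. commutator_matrix \<beta> \<gamma> i i) has_sum c) I" by (auto simp: summable_on_def)
  have "((\<lambda>n. \<Sum>j<r n. commutator_matrix \<beta> \<gamma> (n, j) (n, j)) has_sum c) UNIV"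
    using c unfolding I_def by (rule has_sum_SigmaD) (auto intro!: has_sum_finiteI)
  hence "(\<lambda>n. \<tau> n - (if ?p \<le> n then \<tau> (n - ?p) else 0)) sums c" unfolding diag by (rule has_sum_imp_sums)
  hence lim1: "(\<lambda>m. \<Sum>n<m + ?p. \<tau> n - (if ?p \<le> n then \<tau> (n - ?p) else 0)) \<longlonglongrightarrow> c"
    unfolding sums_def by (rule LIMSEQ_ignore_initial_segment)
  have "(\<Sum>n<m + ?p. \<tau> n - (if ?p \<le> n then \<tau> (n - ?p) else 0)) = (\<Sum>j<?p. \<tau> (m + j))" for m
  proof (induction m)
    case 0
    show ?case by simp
  next
    case (Suc m)
    have "(\<Sum>j<?p. \<tau> (Suc m + j)) + \<tau> m = (\<Sum>j<?p. \<tau> (m + j)) + \<tau> (m + ?p)"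
    proof -
      have "(\<Sum>j<Suc ?p. \<tau> (m + j)) = \<tau> m + (\<Sum>j<?p. \<tau> (Suc m + j))"
        by (subst sum.lessThan_Suc_shift) simp
      thus ?thesis by simp
    qed
    thus ?case using Suc by (simp add: algebra_simps)
  qed
  moreover have "(\<lambda>m. \<Sum>j<?p. \<tau> (m + j)) \<longlonglongrightarrow> (\<Sum>j<?p. of_nat R)"
    by (intro tendsto_sum LIMSEQ_ignore_initial_segment \<tau>_lim)
  ultimately have "(\<lambda>m. \<Sum>n<m + ?p. \<tau> n - (if ?p \<le> n then \<tau> (n - ?p) else 0)) \<longlonglongrightarrow> of_nat (?p * R)"
    by simp
  hence "c = of_nat (?p * R)" using lim1 LIMSEQ_unique by blast
  thus ?thesis using c True by simp
qed

theorem has_trace_on_commutator: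
  "has_trace_on (hfun ` V)
     (commutator (adjoint_on (hfun ` V) (compression (hfun ` V) f1)) (compression (hfun ` V) f2))
     (of_nat R * (\<Sum>\<beta>\<in>Poly_Mapping.keys f1. \<Sum>\<gamma>\<in>Poly_Mapping.keys f2.
        cnj (Poly_Mapping.lookup f1 \<beta>) * Poly_Mapping.lookup f2 \<gamma> * (if tdeg \<beta> = tdeg \<gamma> then of_nat (tdeg \<beta>) else 0)))"
proof (rule has_trace_on_hfun[where T = "poly_commutator f1 f2" and M = "\<lambda>i l. \<Sum>x\<in>Poly_Mapping.keys f1 \<times> Poly_Mapping.keys f2.
      cnj (Poly_Mapping.lookup f1 (fst x)) * Poly_Mapping.lookup f2 (snd x) * commutator_matrix (fst x) (snd x) i l",
      OF _ commutator_hfun])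
  let ?K = "Poly_Mapping.keys f1 \<times> Poly_Mapping.keys f2"
  let ?c = "\<lambda>x. cnj (Poly_Mapping.lookup f1 (fst x)) * Poly_Mapping.lookup f2 (snd x)"
  show "has_matrix (poly_commutator f1 f2) (\<lambda>i l. \<Sum>x\<in>?K. ?c x * commutator_matrix (fst x) (snd x) i l)"
  proof -
    have "poly_commutator f1 f2 = (\<lambda>a \<alpha>. \<Sum>x\<in>?K. ?c x * monom_commutator (fst x) (snd x) a \<alpha>)"
      by (intro ext) (simp add: poly_commutator_def)
    moreover have "has_matrix (\<lambda>a \<alpha>. \<Sum>x\<in>?K. ?c x * monom_commutator (fst x) (snd x) a \<alpha>) (\<lambda>i l. \<Sum>x\<in>?K. ?c x * commutator_matrix (fst x) (snd x) i l)"
      by (rule has_matrix_lincomb) (auto intro: has_matrix_monom_commutator)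
    ultimately show ?thesis by simp
  qed
  have "((\<lambda>i. \<Sum>x\<in>?K. ?c x * commutator_matrix (fst x) (snd x) i i) has_sum
     (\<Sum>x\<in>?K. ?c x * (if tdeg (fst x) = tdeg (snd x) then of_nat (tdeg (fst x) * R) else 0))) I"
    by (intro has_sum_sum_finite has_sum_cmult_right commutator_matrix_trace) auto
  also have "(\<Sum>x\<in>?K. ?c x * (if tdeg (fst x) = tdeg (snd x) then of_nat (tdeg (fst x) * R) else 0)) =
     of_nat R * (\<Sum>x\<in>?K. ?c x * (if tdeg (fst x) = tdeg (snd x) then of_nat (tdeg (fst x)) else 0))"
    unfolding sum_distrib_left by (intro sum.cong refl) auto
  finally show "((\<lambda>i. \<Sum>x\<in>?K. ?c x * commutator_matrix (fst x) (snd x) i i) has_sum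
     of_nat R * (\<Sum>\<beta>\<in>Poly_Mapping.keys f1. \<Sum>\<gamma>\<in>Poly_Mapping.keys f2.
        cnj (Poly_Mapping.lookup f1 \<beta>) * Poly_Mapping.lookup f2 \<gamma> * (if tdeg \<beta> = tdeg \<gamma> then of_nat (tdeg \<beta>) else 0))) I"
    by (simp add: sum.cartesian_product case_prod_unfold)
qed

end

section \<open>Monomials in the Bergman space of the disc\<close>

text \<open>
  Rotations of the plane are treated as orthogonal maps of \<open>real ^ 2\<close>, whose effect on Lebesgue
  measure is known.
\<close>

definition complex_of_vec :: "real ^ 2 \<Rightarrow> complex" where
  "complex_of_vec v = Complex (v $ 1) (v $ 2)"

definition vec_of_complex :: "complex \<Rightarrow> real ^ 2" where
  "vec_of_complex z = vector [Re z, Im z]"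

lemma vec_of_complex_inverse [simp]: "complex_of_vec (vec_of_complex z) = z"
  by (simp add: complex_of_vec_def vec_of_complex_def)

lemma complex_of_vec_inverse [simp]: "vec_of_complex (complex_of_vec v) = v"
  by (simp add: complex_of_vec_def vec_of_complex_def vec_eq_iff forall_2)

lemma linear_complex_of_vec: "linear complex_of_vec"
  by (rule linearI) (auto simp: complex_of_vec_def complex_eq_iff)

lemma linear_vec_of_complex: "linear vec_of_complex"
  by (rule linearI) (auto simp: vec_of_complex_def vec_eq_iff forall_2)

lemma norm_vec_of_complex: "norm (vec_of_complex z) = cmod z"
  by (simp add: norm_vec_def L2_set_def sum_2 vec_of_complex_def cmod_def)

lemma norm_complex_of_vec: "cmod (complex_of_vec v) = norm v"
  using norm_vec_of_complex[of "complex_of_vec v"] by simp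

lemma measurable_complex_of_vec [measurable]: "complex_of_vec \<in> borel_measurable borel"
  by (intro borel_measurable_continuous_onI linear_continuous_on)
     (simp add: linear_complex_of_vec linear_conv_bounded_linear[symmetric])

lemma vimage_box_complex_of_vec:
  "complex_of_vec -` box l u = box (vec_of_complex l) (vec_of_complex u)"
  by (auto simp: complex_of_vec_def vec_of_complex_def mem_box_cart forall_2 in_box_complex_iff)

lemma prod_Basis_real2: "(\<Prod>b\<in>(Basis :: (real ^ 2) set). v \<bullet> b) = (v $ 1) * (v $ 2)"
proof -
  have B: "(Basis :: (real ^ 2) set) = (\<lambda>i. axis i 1) ` UNIV" by (auto simp: Basis_vec_def)
  have inj: "inj (\<lambda>i :: 2. axis i (1::real))" by (auto simp: inj_on_def axis_eq_axis)
  have "(\<Prod>b\<in>(Basis :: (real ^ 2) set). v \<bullet> b) = (\<Prod>i\<in>UNIV. v \<bullet> axis i 1)"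
    unfolding B prod.reindex[OF inj] o_def ..
  thus ?thesis by (simp add: UNIV_2 inner_axis)
qed

lemma distr_complex_of_vec: "distr lborel borel complex_of_vec = lborel"
proof (rule lborel_eqI[symmetric])
  fix l u :: complex assume lu: "\<And>b. b \<in> Basis \<Longrightarrow> l \<bullet> b \<le> u \<bullet> b"
  have le: "Re l \<le> Re u" "Im l \<le> Im u" using lu[of 1] lu[of \<i>] by (auto simp: Basis_complex_def)
  have comp: "vec_of_complex l $ i \<le> vec_of_complex u $ i" for i
    using exhaust_2[of i] le by (auto simp: vec_of_complex_def)
  have "emeasure (distr lborel borel complex_of_vec) (box l u) = emeasure lborel (box (vec_of_complex l) (vec_of_complex u))"
    by (subst emeasure_distr) (auto simp: vimage_box_complex_of_vec)
  also have "\<dots> = ennreal (\<Prod>b\<in>Basis. (vec_of_complex u - vec_of_complex l) \<bullet> b)"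
    using comp by (subst emeasure_lborel_box) (auto simp: Basis_vec_def inner_axis)
  also have "(\<Prod>b\<in>Basis. (vec_of_complex u - vec_of_complex l) \<bullet> b) = (\<Prod>b\<in>Basis. (u - l) \<bullet> b)"
    unfolding prod_Basis_real2 by (simp add: Basis_complex_def vec_of_complex_def)
  finally show "emeasure (distr lborel borel complex_of_vec) (box l u) = ennreal (\<Prod>b\<in>Basis. (u - l) \<bullet> b)" .
qed simp

lemma distr_lborel_rotation:
  assumes u: "cmod u = 1"
  shows "distr lborel borel ((*) u) = (lborel :: complex measure)"
proof (rule lborel_eqI[symmetric])
  fix l m :: complex assume lm: "\<And>b. b \<in> Basis \<Longrightarrow> l \<bullet> b \<le> m \<bullet> b"
  define A where "A = complex_of_vec -` box l m"
  have A: "A = box (vec_of_complex l) (vec_of_complex m)" unfolding A_def by (rule vimage_box_complex_of_vec)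
  define g where "g = (\<lambda>v. vec_of_complex (cnj u * complex_of_vec v))"
  have "linear g"
  proof -
    have "linear ((*) (cnj u))" by (rule linearI) (auto simp: algebra_simps)
    hence "linear (vec_of_complex \<circ> ((*) (cnj u) \<circ> complex_of_vec))"
      by (intro linear_compose linear_complex_of_vec linear_vec_of_complex)
    thus ?thesis by (simp add: g_def o_def)
  qed
  hence g: "orthogonal_transformation g"
    unfolding orthogonal_transformation by (auto simp: g_def norm_vec_of_complex norm_mult u norm_complex_of_vec)
  have uu: "u * cnj u = 1" "cnj u * u = 1" using u complex_norm_square[of u] by (auto simp: mult.commute)
  have vimage: "complex_of_vec -` ((*) u -` box l m) = g ` A"
  proof (intro subset_antisym subsetI)
    fix v assume "v \<in> complex_of_vec -` ((*) u -` box l m)"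
    hence "vec_of_complex (u * complex_of_vec v) \<in> A" by (simp add: A_def)
    moreover have "g (vec_of_complex (u * complex_of_vec v)) = v"
      by (simp add: g_def mult.assoc[symmetric] uu)
    ultimately show "v \<in> g ` A" by force
  next
    fix v assume "v \<in> g ` A"
    then obtain w where "w \<in> A" "v = g w" by blast
    thus "v \<in> complex_of_vec -` ((*) u -` box l m)" by (simp add: g_def A_def mult.assoc[symmetric] uu)
  qed
  have meas: "(*) u -` box l m \<in> sets borel"
    using measurable_sets[of "(*) u" borel borel "box l m"] by simp
  have "emeasure (distr lborel borel ((*) u)) (box l m) = emeasure lborel ((*) u -` box l m)"
    by (subst emeasure_distr) auto
  also have "\<dots> = emeasure (distr lborel borel complex_of_vec) ((*) u -` box l m)"
    by (simp add: distr_complex_of_vec)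
  also have "\<dots> = emeasure lborel (g ` A)"
    using meas by (subst emeasure_distr) (auto simp: vimage)
  also have "\<dots> = emeasure lborel A"
  proof -
    have Al: "A \<in> lmeasurable" unfolding A by simp
    have gA: "g ` A \<in> sets borel"
      using measurable_sets[OF measurable_complex_of_vec meas] vimage by simp
    have "emeasure lebesgue (g ` A) = emeasure lebesgue A"
      using measure_orthogonal_image[OF g Al] measurable_orthogonal_image[OF g Al] Al
      by (simp add: emeasure_eq_measure2)
    thus ?thesis using gA by (simp add: A)
  qed
  also have "\<dots> = emeasure (distr lborel borel complex_of_vec) (box l m)"
    by (subst emeasure_distr) (auto simp: A_def)
  also have "\<dots> = ennreal (\<Prod>b\<in>Basis. (m - l) \<bullet> b)"
    unfolding distr_complex_of_vec using lm by (subst emeasure_lborel_box) auto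
  finally show "emeasure (distr lborel borel ((*) u)) (box l m) = ennreal (\<Prod>b\<in>Basis. (m - l) \<bullet> b)" .
qed simp

text \<open>
  The squared modulus is uniformly distributed on the disc, since the disc of radius \<open>sqrt x\<close> has
  area \<open>pi * x\<close>.
\<close>

lemma distr_cmod_square:
  "distr (density lborel (indicator (ball (0::complex) 1))) borel (\<lambda>w. (cmod w)\<^sup>2) =
   density lborel (\<lambda>t. ennreal pi * indicator {0..1} t)"
proof (rule measure_eqI_lessThan)
  have area: "emeasure lborel (ball (0::complex) t) = ennreal (pi * t\<^sup>2)" if "t \<ge> 0" for t
    using that by (simp add: emeasure_ball unit_ball_vol_2)
  have carea: "emeasure lborel (cball (0::complex) t) = ennreal (pi * t\<^sup>2)" if "t \<ge> 0" for t
    using that by (simp add: emeasure_cball unit_ball_vol_2)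
  have L: "emeasure (distr (density lborel (indicator (ball (0::complex) 1))) borel (\<lambda>w. (cmod w)\<^sup>2)) {x<..} =
      emeasure lborel (ball (0::complex) 1 \<inter> {w. (cmod w)\<^sup>2 > x})" for x
  proof -
    have "emeasure (distr (density lborel (indicator (ball (0::complex) 1))) borel (\<lambda>w. (cmod w)\<^sup>2)) {x<..} =
       emeasure (density lborel (indicator (ball (0::complex) 1))) {w. (cmod w)\<^sup>2 > x}"
      by (subst emeasure_distr) (auto simp: vimage_def)
    also have "\<dots> = emeasure lborel (ball (0::complex) 1 \<inter> {w. (cmod w)\<^sup>2 > x})"
      by (subst emeasure_density) (auto simp: indicator_inter_arith[symmetric] intro!: borel_measurable_indicator)
    finally show ?thesis .
  qed
  show "emeasure (distr (density lborel (indicator (ball (0::complex) 1))) borel (\<lambda>w. (cmod w)\<^sup>2)) {x<..} < \<infinity>" for x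
  proof -
    have "emeasure lborel (ball (0::complex) 1 \<inter> {w. (cmod w)\<^sup>2 > x}) \<le> emeasure lborel (ball (0::complex) 1)"
      by (rule emeasure_mono) auto
    also have "\<dots> < \<infinity>" by (simp add: area)
    finally show ?thesis unfolding L .
  qed
  fix x :: real
  have Rr: "emeasure (density lborel (\<lambda>t. ennreal pi * indicator {0..1} t)) {x<..} = ennreal pi * emeasure lborel ({0..1} \<inter> {x<..})"
  proof -
    have "emeasure (density lborel (\<lambda>t. ennreal pi * indicator {0..1} t)) {x<..} =
        (\<integral>\<^sup>+t. ennreal pi * indicator ({0..1} \<inter> {x<..}) t \<partial>lborel)"
      by (subst emeasure_density) (auto simp: indicator_inter_arith mult.assoc)
    also have "\<dots> = ennreal pi * emeasure lborel ({0..1} \<inter> {x<..})"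
      by (subst nn_integral_cmult_indicator) auto
    finally show ?thesis .
  qed
  consider "x < 0" | "0 \<le> x" "x < 1" | "x \<ge> 1" by linarith
  thus "emeasure (distr (density lborel (indicator (ball (0::complex) 1))) borel (\<lambda>w. (cmod w)\<^sup>2)) {x<..} =
     emeasure (density lborel (\<lambda>t. ennreal pi * indicator {0..1} t)) {x<..}"
  proof cases
    case 1
    have "ball (0::complex) 1 \<inter> {w. (cmod w)\<^sup>2 > x} = ball 0 1"
      using 1 by (auto intro: less_le_trans)
    moreover have "{0..1} \<inter> {x<..} = {0..1}" using 1 by auto
    ultimately show ?thesis unfolding L Rr by (simp add: area)
  next
    case 2
    have iff: "x < (cmod w)\<^sup>2 \<longleftrightarrow> sqrt x < cmod w" for w
      using real_sqrt_less_iff[of x "(cmod w)\<^sup>2"] by simp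
    have "ball (0::complex) 1 \<inter> {w. (cmod w)\<^sup>2 > x} = ball 0 1 - cball 0 (sqrt x)"
      by (intro set_eqI) (simp only: Int_iff Diff_iff mem_Collect_eq mem_cball dist_0_norm iff not_le)
    moreover have "emeasure lborel (ball (0::complex) 1 - cball 0 (sqrt x)) = emeasure lborel (ball (0::complex) 1) - emeasure lborel (cball (0::complex) (sqrt x))"
    proof (rule emeasure_Diff)
      have "sqrt x < 1" using 2 by simp
      thus "cball (0::complex) (sqrt x) \<subseteq> ball 0 1" by (auto simp del: real_sqrt_lt_1_iff)
    qed (use 2 in \<open>auto simp: carea\<close>)
    moreover have "{0..1} \<inter> {x<..} = {x<..1}" using 2 by auto
    ultimately show ?thesis unfolding L Rr using 2
      by (simp add: area carea ennreal_minus ennreal_mult[symmetric] algebra_simps)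
  next
    case 3
    have "ball (0::complex) 1 \<inter> {w. (cmod w)\<^sup>2 > x} = {}"
    proof (safe, simp_all)
      fix w :: complex assume "cmod w < 1" "x < (cmod w)\<^sup>2"
      moreover have "(cmod w)\<^sup>2 \<le> 1" using \<open>cmod w < 1\<close> by (simp add: abs_square_le_1)
      ultimately show False using 3 by simp
    qed
    moreover have "{0..1} \<inter> {x<..} = {}" using 3 by auto
    ultimately show ?thesis unfolding L Rr by simp
  qed
qed auto

lemma measurable_cnj [measurable]: "cnj \<in> borel_measurable borel"
  by (intro borel_measurable_continuous_onI continuous_intros)

lemma disc_monomial_integrable:
  "integrable lborel (\<lambda>w::complex. indicator (ball 0 1) w *\<^sub>R (w ^ k * cnj w ^ l))"
proof (rule integrableI_bounded_set_indicator[where B = 1])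
  show "emeasure lborel (ball (0::complex) 1) < \<infinity>" by (simp add: emeasure_ball)
  show "AE w in lborel. w \<in> ball (0::complex) 1 \<longrightarrow> norm (w ^ k * cnj w ^ l) \<le> 1"
    by (intro AE_I2) (auto simp: norm_mult norm_power intro!: mult_le_one power_le_one)
  show "(\<lambda>w::complex. w ^ k * cnj w ^ l) \<in> borel_measurable lborel" by measurable
qed simp

text \<open>
  A rotation by \<open>pi / (k - l)\<close> changes the sign of the integrand.
\<close>

lemma disc_monomial_orthogonal:
  assumes "k \<noteq> l"
  shows "(LINT w::complex|lborel. indicator (ball 0 1) w *\<^sub>R (w ^ k * cnj w ^ l)) = 0"
proof -
  define h where "h = (\<lambda>w::complex. indicator (ball 0 1) w *\<^sub>R (w ^ k * cnj w ^ l))"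
  define \<theta> where "\<theta> = pi / (real k - real l)"
  define u where "u = cis \<theta>"
  have kl: "real k - real l \<noteq> 0" using assms by simp
  have "u ^ k * cnj u ^ l = cis (real k * \<theta> + real l * (- \<theta>))"
    unfolding u_def cis_cnj Complex.DeMoivre cis_mult ..
  also have "real k * \<theta> + real l * (- \<theta>) = (real k - real l) * \<theta>" by (simp add: algebra_simps)
  also have "\<dots> = pi" using kl by (simp add: \<theta>_def)
  finally have ukl: "u ^ k * cnj u ^ l = -1" by simp
  have hm: "h \<in> borel_measurable borel" 
    using borel_measurable_integrable[OF disc_monomial_integrable] by (simp add: h_def)
  have hu: "h (u * w) = - h w" for w
  proof -
    have "h (u * w) = (u ^ k * cnj u ^ l) * h w"
      by (simp add: h_def power_mult_distrib norm_mult u_def indicator_def)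
    thus ?thesis by (simp add: ukl)
  qed
  have "integral\<^sup>L lborel h = integral\<^sup>L (distr lborel borel ((*) u)) h"
    by (simp add: distr_lborel_rotation u_def)
  also have "\<dots> = (LINT w|lborel. h (u * w))"
    by (rule integral_distr) (use hm in auto)
  also have "\<dots> = - integral\<^sup>L lborel h" by (simp add: hu)
  finally show ?thesis unfolding h_def by (simp add: eq_neg_iff_add_eq_0)
qed

lemma disc_monomial_norm:
  "(LINT w::complex|lborel. indicator (ball 0 1) w *\<^sub>R (w ^ k * cnj w ^ k)) = complex_of_real (pi / (real k + 1))"
proof -
  have "(LINT w::complex|lborel. indicator (ball 0 1) w *\<^sub>R (w ^ k * cnj w ^ k)) =
      (LINT w::complex|lborel. complex_of_real (indicator (ball 0 1) w * ((cmod w)\<^sup>2) ^ k))"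
    by (intro Bochner_Integration.integral_cong refl)
       (simp add: power_mult_distrib[symmetric] of_real_cmod_square scaleR_conv_of_real)
  also have "\<dots> = complex_of_real (LINT w::complex|lborel. indicator (ball 0 1) w * ((cmod w)\<^sup>2) ^ k)"
    by (rule integral_complex_of_real)
  also have "(LINT w::complex|lborel. indicator (ball 0 1) w * ((cmod w)\<^sup>2) ^ k) =
      (LINT w::complex|density lborel (\<lambda>w. ennreal (indicator (ball 0 1) w)). ((cmod w)\<^sup>2) ^ k)"
    by (subst integral_density) (auto intro!: borel_measurable_indicator)
  also have "\<dots> = (LINT w::complex|density lborel (indicator (ball 0 1)). ((cmod w)\<^sup>2) ^ k)"
    by (simp add: ennreal_indicator)
  also have "\<dots> = (LINT t|distr (density lborel (indicator (ball (0::complex) 1))) borel (\<lambda>w. (cmod w)\<^sup>2). t ^ k)"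
    by (subst integral_distr) auto
  also have "\<dots> = (LINT t|density lborel (\<lambda>t. ennreal (pi * indicator {0..1} t)). t ^ k)"
    unfolding distr_cmod_square by (simp add: ennreal_mult' ennreal_indicator)
  also have "\<dots> = (LINT t|lborel. pi * (t ^ k * indicator {0..1} t))"
    by (subst integral_density) (auto simp: mult_ac)
  also have "\<dots> = pi * (LINT t|lborel. t ^ k * indicator {0..1} t)" by simp
  also have "(LINT t|lborel. t ^ k * indicator {0..1} t) = 1 / (real k + 1)"
    by (subst integral_power) auto
  finally show ?thesis by simp
qed

text \<open>
  The derivatives of \<open>w ^ p\<close> and \<open>w ^ q\<close> have the inner product \<open>p\<^sup>2 / p\<close> if \<open>p = q > 0\<close>; all other
  inner products vanish.
\<close>

lemma bergman_inner_deriv_diag: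
  fixes f1 f2 :: "'d::finite mpoly"
  shows
  "bergman_inner (deriv (diag_restrict (mpoly_eval f2))) (deriv (diag_restrict (mpoly_eval f1))) =
     (\<Sum>\<beta>\<in>Poly_Mapping.keys f1. \<Sum>\<gamma>\<in>Poly_Mapping.keys f2.
        cnj (Poly_Mapping.lookup f1 \<beta>) * Poly_Mapping.lookup f2 \<gamma> * (if tdeg \<beta> = tdeg \<gamma> then of_nat (tdeg \<beta>) else 0))"
proof -
  have deriv: "deriv (diag_restrict (mpoly_eval p)) w =
      (\<Sum>\<alpha>\<in>Poly_Mapping.keys p. Poly_Mapping.lookup p \<alpha> * (of_nat (tdeg \<alpha>) * w ^ (tdeg \<alpha> - 1)))" for p :: "'d mpoly" and w
  proof -
    have "diag_restrict (mpoly_eval p) = (\<lambda>w. \<Sum>\<alpha>\<in>Poly_Mapping.keys p. Poly_Mapping.lookup p \<alpha> * w ^ tdeg \<alpha>)"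
      by (rule ext) (simp add: diag_restrict_def mpoly_eval_def monom_fun_diag)
    moreover have "((\<lambda>w. \<Sum>\<alpha>\<in>Poly_Mapping.keys p. Poly_Mapping.lookup p \<alpha> * w ^ tdeg \<alpha>) has_field_derivative
       (\<Sum>\<alpha>\<in>Poly_Mapping.keys p. Poly_Mapping.lookup p \<alpha> * (of_nat (tdeg \<alpha>) * w ^ (tdeg \<alpha> - 1)))) (at w)"
      by (auto intro!: derivative_eq_intros sum.cong)
    ultimately show ?thesis by (simp add: DERIV_imp_deriv)
  qed
  define J where "J = (\<lambda>k l. LINT w::complex|lborel. indicator (ball 0 1) w *\<^sub>R (w ^ k * cnj w ^ l))"
  let ?c = "\<lambda>\<beta> \<gamma>. cnj (Poly_Mapping.lookup f1 \<beta>) * Poly_Mapping.lookup f2 \<gamma>"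
  let ?K1 = "Poly_Mapping.keys f1" and ?K2 = "Poly_Mapping.keys f2"
  have "set_lebesgue_integral lborel (ball 0 1) (\<lambda>w. deriv (diag_restrict (mpoly_eval f2)) w * cnj (deriv (diag_restrict (mpoly_eval f1)) w))
    = (LINT w|lborel. (\<Sum>\<beta>\<in>?K1. \<Sum>\<gamma>\<in>?K2. ?c \<beta> \<gamma> * of_nat (tdeg \<beta> * tdeg \<gamma>) *
         (indicator (ball 0 1) w *\<^sub>R (w ^ (tdeg \<gamma> - 1) * cnj w ^ (tdeg \<beta> - 1)))))"
    unfolding set_lebesgue_integral_def
  proof (intro Bochner_Integration.integral_cong refl)
    fix w :: complex
    have "deriv (diag_restrict (mpoly_eval f2)) w * cnj (deriv (diag_restrict (mpoly_eval f1)) w) =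
       (\<Sum>\<beta>\<in>?K1. \<Sum>\<gamma>\<in>?K2. ?c \<beta> \<gamma> * of_nat (tdeg \<beta> * tdeg \<gamma>) * (w ^ (tdeg \<gamma> - 1) * cnj w ^ (tdeg \<beta> - 1)))"
      unfolding deriv cnj_sum sum_product by (subst sum.swap) (intro sum.cong refl, simp)
    thus "indicator (ball 0 1) w *\<^sub>R (deriv (diag_restrict (mpoly_eval f2)) w * cnj (deriv (diag_restrict (mpoly_eval f1)) w)) =
      (\<Sum>\<beta>\<in>?K1. \<Sum>\<gamma>\<in>?K2. ?c \<beta> \<gamma> * of_nat (tdeg \<beta> * tdeg \<gamma>) *
         (indicator (ball 0 1) w *\<^sub>R (w ^ (tdeg \<gamma> - 1) * cnj w ^ (tdeg \<beta> - 1))))"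
      by (simp only: scaleR_sum_right mult_scaleR_right)
  qed
  also have "\<dots> = (\<Sum>\<beta>\<in>?K1. \<Sum>\<gamma>\<in>?K2. ?c \<beta> \<gamma> * of_nat (tdeg \<beta> * tdeg \<gamma>) * J (tdeg \<gamma> - 1) (tdeg \<beta> - 1))"
    unfolding J_def
    by (simp only: Bochner_Integration.integral_sum Bochner_Integration.integrable_sum integrable_mult_right
        disc_monomial_integrable integral_mult_right_zero)
  finally have "bergman_inner (deriv (diag_restrict (mpoly_eval f2))) (deriv (diag_restrict (mpoly_eval f1))) =
    (\<Sum>\<beta>\<in>?K1. \<Sum>\<gamma>\<in>?K2. ?c \<beta> \<gamma> * (complex_of_real (1 / pi) * (of_nat (tdeg \<beta> * tdeg \<gamma>) * J (tdeg \<gamma> - 1) (tdeg \<beta> - 1))))"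
    unfolding bergman_inner_def by (simp only: sum_distrib_left mult_ac)
  also have "\<dots> = (\<Sum>\<beta>\<in>?K1. \<Sum>\<gamma>\<in>?K2. ?c \<beta> \<gamma> * (if tdeg \<beta> = tdeg \<gamma> then of_nat (tdeg \<beta>) else 0))"
  proof (intro sum.cong refl arg_cong2[of _ _ _ _ "(*)"])
    fix \<beta> \<gamma> :: "'d \<Rightarrow>\<^sub>0 nat"
    show "complex_of_real (1 / pi) * (of_nat (tdeg \<beta> * tdeg \<gamma>) * J (tdeg \<gamma> - 1) (tdeg \<beta> - 1)) = (if tdeg \<beta> = tdeg \<gamma> then of_nat (tdeg \<beta>) else 0)"
    proof (cases "tdeg \<beta> = 0 \<or> tdeg \<gamma> = 0")
      case True
      thus ?thesis by auto
    next
      case False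
      show ?thesis
      proof (cases "tdeg \<beta> = tdeg \<gamma>")
        case eq: True
        obtain k where k: "tdeg \<gamma> = Suc k" using False by (cases "tdeg \<gamma>") auto
        have "J k k = complex_of_real (pi / (real k + 1))" unfolding J_def by (rule disc_monomial_norm)
        moreover have "complex_of_real (1 / pi) * (of_nat (Suc k * Suc k) * complex_of_real (pi / (real k + 1))) = of_nat (Suc k)"
        proof -
          have "1 / pi * (S * S * (pi / S)) = S" if "S \<noteq> 0" for S :: real using that by simp
          moreover have "real (Suc k) = real k + 1" by simp
          ultimately have "1 / pi * (real (Suc k * Suc k) * (pi / (real k + 1))) = real (Suc k)"
            unfolding of_nat_mult by (metis of_nat_eq_0_iff nat.distinct(2))
          thus ?thesis by (metis of_real_mult of_real_of_nat_eq)
        qed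
        ultimately show ?thesis using eq k by simp
      next
        case neq: False
        hence "tdeg \<gamma> - 1 \<noteq> tdeg \<beta> - 1" using False by linarith
        hence "J (tdeg \<gamma> - 1) (tdeg \<beta> - 1) = 0" unfolding J_def by (rule disc_monomial_orthogonal)
        thus ?thesis using neq by simp
      qed
    qed
  qed
  finally show ?thesis .
qed

section \<open>The quotient module\<close>

definition ideal_coeffs :: "nat \<Rightarrow> (('d::finite \<Rightarrow>\<^sub>0 nat) \<Rightarrow> complex) set" where
  "ideal_coeffs N = Poly_Mapping.lookup ` ideal_power diag_ideal N"

definition quotient_coeffs :: "nat \<Rightarrow> (('d::finite \<Rightarrow>\<^sub>0 nat) \<Rightarrow> complex) set" where
  "quotient_coeffs N = {a \<in> l2. \<forall>g\<in>ideal_coeffs N. l2_inner a g = 0}"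

lemma ideal_coeffs_l2: "ideal_coeffs N \<subseteq> l2"
  by (auto simp: ideal_coeffs_def lookup_l2)

text \<open>
  Passing to the closure of the ideal does not change the orthogonal complement, by the continuity of
  the inner product.
\<close>

lemma quotient_module_eq:
  "(quotient_module N :: (complex ^ 'd::finite \<Rightarrow> complex) set) = hfun ` quotient_coeffs N"
proof (intro subset_antisym subsetI)
  let ?I = "hardy_of_mpoly ` (ideal_power diag_ideal N :: 'd mpoly set)"
  fix f :: "complex ^ 'd \<Rightarrow> complex"
  assume "f \<in> quotient_module N"
  hence f: "f \<in> hardy" "\<And>g. g \<in> hardy_closure ?I \<Longrightarrow> hardy_inner f g = 0"
    by (auto simp: quotient_module_def hardy_orth_compl_def)
  obtain a where a: "a \<in> l2" "f = hfun a" using f(1) by (auto simp: hardy_eq)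
  have "l2_inner a (Poly_Mapping.lookup p) = 0" if p: "p \<in> ideal_power diag_ideal N" for p :: "'d mpoly"
  proof -
    have "hardy_norm (hfun (Poly_Mapping.lookup p) - hfun (Poly_Mapping.lookup p)) = 0"
      by (simp add: hfun_diff lookup_l2 hardy_norm_hfun l2norm_def)
    hence "hfun (Poly_Mapping.lookup p) \<in> hardy_closure ?I"
      using p by (auto simp: hardy_closure_def hardy_eq lookup_l2 hardy_of_mpoly_eq intro!: bexI[of _ p])
    from f(2)[OF this] show ?thesis using a by (simp add: lookup_l2)
  qed
  thus "f \<in> hfun ` quotient_coeffs N" using a by (auto simp: quotient_coeffs_def ideal_coeffs_def)
next
  let ?I = "hardy_of_mpoly ` (ideal_power diag_ideal N :: 'd mpoly set)"
  fix f :: "complex ^ 'd \<Rightarrow> complex"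
  assume "f \<in> hfun ` quotient_coeffs N"
  then obtain a where a: "a \<in> l2" "f = hfun a" "\<And>p. p \<in> ideal_power diag_ideal N \<Longrightarrow> l2_inner a (Poly_Mapping.lookup p) = 0"
    by (auto simp: quotient_coeffs_def ideal_coeffs_def)
  have "hardy_inner f g = 0" if "g \<in> hardy_closure ?I" for g
  proof -
    obtain b where b: "b \<in> l2" "g = hfun b" using \<open>g \<in> hardy_closure ?I\<close> by (auto simp: hardy_closure_def hardy_eq)
    have "cmod (l2_inner a b) \<le> l2norm a * e" if e: "e > 0" for e
    proof -
      obtain p where p: "p \<in> ideal_power diag_ideal N" "hardy_norm (hfun b - hfun (Poly_Mapping.lookup p)) < e"
        using \<open>g \<in> hardy_closure ?I\<close> b e by (auto simp: hardy_closure_def hardy_of_mpoly_eq)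
      have "l2_inner a b = l2_inner a (\<lambda>\<alpha>. b \<alpha> - Poly_Mapping.lookup p \<alpha>)"
        using a b p by (simp add: l2_inner_diff_right lookup_l2)
      also have "cmod \<dots> \<le> l2norm a * l2norm (\<lambda>\<alpha>. b \<alpha> - Poly_Mapping.lookup p \<alpha>)"
        using a b by (intro l2_inner_Cauchy_Schwarz l2_diff lookup_l2)
      also have "\<dots> \<le> l2norm a * e"
        using p(2) b by (intro mult_left_mono) (auto simp: hfun_diff lookup_l2 l2_diff)
      finally show ?thesis .
    qed
    note * = this
    have "cmod (l2_inner a b) \<le> 0"
    proof (cases "l2norm a = 0")
      case False
      hence pos: "l2norm a > 0" using l2norm_nonneg[of a] by linarith
      show ?thesis
      proof (rule field_le_epsilon)
        fix e :: real assume "e > 0"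
        thus "cmod (l2_inner a b) \<le> 0 + e" using *[of "e / l2norm a"] pos by simp
      qed
    qed (use *[of 1] in simp)
    thus ?thesis using a b by simp
  qed
  thus "f \<in> quotient_module N" using a by (auto simp: quotient_module_def hardy_orth_compl_def hardy_eq)
qed

text \<open>
  The quotient module is graded because the powers of the ideal are.
\<close>

lemma quotient_coeffs_slice:
  fixes a :: "('d::finite \<Rightarrow>\<^sub>0 nat) \<Rightarrow> complex"
  assumes "a \<in> quotient_coeffs N"
  shows "slice n a \<in> quotient_coeffs N"
  unfolding quotient_coeffs_def ideal_coeffs_def
proof (intro CollectI conjI ballI slice_l2)
  fix g :: "('d \<Rightarrow>\<^sub>0 nat) \<Rightarrow> complex" assume "g \<in> Poly_Mapping.lookup ` ideal_power diag_ideal N"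
  then obtain q where q: "q \<in> ideal_power diag_ideal N" "g = Poly_Mapping.lookup q" by blast
  have "l2_inner (slice n a) g = cnj (pairing (\<lambda>\<alpha>. if tdeg \<alpha> = n then cnj (a \<alpha>) else 0) q)"
    unfolding q l2_inner_lookup slice_def by (simp add: if_distrib cong: if_cong)
  also have "\<dots> = l2_inner a (Poly_Mapping.lookup (homog_component n q))" by (simp add: l2_inner_lookup pairing_homog_component)
  also have "\<dots> = 0" using assms ideal_power_homog_component[OF q(1), of n] by (auto simp: quotient_coeffs_def ideal_coeffs_def)
  finally show "l2_inner (slice n a) g = 0" .
qed

lemma quotient_coeffs_slices:
  fixes a :: "('d::finite \<Rightarrow>\<^sub>0 nat) \<Rightarrow> complex"
  assumes "a \<in> l2" "\<And>n. slice n a \<in> quotient_coeffs N"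
  shows "a \<in> quotient_coeffs N"
  unfolding quotient_coeffs_def ideal_coeffs_def
proof (intro CollectI conjI ballI assms(1))
  fix g :: "('d \<Rightarrow>\<^sub>0 nat) \<Rightarrow> complex" assume "g \<in> Poly_Mapping.lookup ` ideal_power diag_ideal N"
  then obtain q where q: "q \<in> ideal_power diag_ideal N" "g = Poly_Mapping.lookup q" by blast
  let ?D = "tdeg ` Poly_Mapping.keys q"
  have "pairing (\<lambda>\<alpha>. cnj (a \<alpha>)) q = pairing (\<lambda>\<alpha>. \<Sum>n\<in>?D. cnj (slice n a \<alpha>)) q"
    unfolding pairing_def
  proof (intro sum.cong refl arg_cong2[of _ _ _ _ "(*)"])
    fix \<alpha> assume \<alpha>: "\<alpha> \<in> Poly_Mapping.keys q"
    have "(\<Sum>n\<in>?D. cnj (slice n a \<alpha>)) = (\<Sum>n\<in>?D. if n = tdeg \<alpha> then cnj (a \<alpha>) else 0)"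
      by (intro sum.cong refl) (auto simp: slice_def)
    thus "cnj (a \<alpha>) = (\<Sum>n\<in>?D. cnj (slice n a \<alpha>))" using \<alpha> by simp
  qed
  hence "l2_inner a g = (\<Sum>n\<in>?D. l2_inner (slice n a) g)"
    unfolding q l2_inner_lookup by (simp add: pairing_fun_sum)
  also have "\<dots> = 0" using assms(2) q by (intro sum.neutral) (auto simp: quotient_coeffs_def ideal_coeffs_def)
  finally show "l2_inner a g = 0" .
qed

lemma quotient_coeffs_lincomb:
  fixes v :: "'x \<Rightarrow> ('d::finite \<Rightarrow>\<^sub>0 nat) \<Rightarrow> complex"
  assumes "\<And>x. x \<in> A \<Longrightarrow> v x \<in> quotient_coeffs N"
  shows "(\<lambda>\<alpha>. \<Sum>x\<in>A. c x * v x \<alpha>) \<in> quotient_coeffs N"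
  unfolding quotient_coeffs_def
proof (intro CollectI conjI ballI)
  show "(\<lambda>\<alpha>. \<Sum>x\<in>A. c x * v x \<alpha>) \<in> l2" using assms by (intro l2_lincomb) (auto simp: quotient_coeffs_def)
  fix g :: "('d \<Rightarrow>\<^sub>0 nat) \<Rightarrow> complex" assume g: "g \<in> ideal_coeffs N"
  have "l2_inner (\<lambda>\<alpha>. \<Sum>x\<in>A. c x * v x \<alpha>) g = (\<Sum>x\<in>A. c x * l2_inner (v x) g)"
    by (rule l2_inner_sum_left) (use assms g ideal_coeffs_l2 in \<open>auto simp: quotient_coeffs_def\<close>)
  thus "l2_inner (\<lambda>\<alpha>. \<Sum>x\<in>A. c x * v x \<alpha>) g = 0" using assms g by (simp add: quotient_coeffs_def)
qed

definition quotient_homog :: "nat \<Rightarrow> nat \<Rightarrow> (('d::finite \<Rightarrow>\<^sub>0 nat) \<Rightarrow> complex) set" where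
  "quotient_homog N n = {a \<in> quotient_coeffs N. \<forall>\<alpha>. tdeg \<alpha> \<noteq> n \<longrightarrow> a \<alpha> = 0}"

definition orthonormal_family ::
  "(('d::finite \<Rightarrow>\<^sub>0 nat) \<Rightarrow> complex) set \<Rightarrow> nat \<Rightarrow> (nat \<Rightarrow> ('d \<Rightarrow>\<^sub>0 nat) \<Rightarrow> complex) \<Rightarrow> bool" where
  "orthonormal_family W m e \<longleftrightarrow> (\<forall>j<m. e j \<in> W) \<and> (\<forall>j<m. \<forall>k<m. l2_inner (e j) (e k) = (if j = k then 1 else 0))"

lemma quotient_homog_l2: "a \<in> quotient_homog N n \<Longrightarrow> a \<in> l2"
  by (simp add: quotient_homog_def quotient_coeffs_def)

lemma orthonormal_family_independent:
  assumes e: "orthonormal_family (quotient_homog N n) m e"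
    and c: "\<forall>\<alpha>\<in>homog n. (\<Sum>j<m. c j * e j \<alpha>) = 0" and k: "k < m"
  shows "c k = 0"
proof -
  have W: "e j \<in> quotient_homog N n" if "j < m" for j using e that by (simp add: orthonormal_family_def)
  have "(\<Sum>j<m. c j * e j \<alpha>) = 0" for \<alpha>
  proof (cases "tdeg \<alpha> = n")
    case False
    thus ?thesis using W by (intro sum.neutral) (auto simp: quotient_homog_def)
  qed (use c in auto)
  hence "0 = l2_inner (\<lambda>\<alpha>. \<Sum>j<m. c j * e j \<alpha>) (e k)" by simp
  also have "\<dots> = (\<Sum>j<m. c j * l2_inner (e j) (e k))"
    by (rule l2_inner_sum_left) (use W quotient_homog_l2 k in auto)
  also have "\<dots> = (\<Sum>j<m. if j = k then c k else 0)"
    by (intro sum.cong refl) (use e k in \<open>auto simp: orthonormal_family_def\<close>)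
  finally show ?thesis using k by simp
qed

lemma orthonormal_family_le_card_homog:
  fixes e :: "nat \<Rightarrow> ('d::finite \<Rightarrow>\<^sub>0 nat) \<Rightarrow> complex"
  assumes e: "orthonormal_family (quotient_homog N n) m e"
  shows "m \<le> card (homog n :: ('d \<Rightarrow>\<^sub>0 nat) set)"
proof (rule ccontr)
  assume "\<not> ?thesis"
  then obtain c where "\<exists>j\<in>{..<m}. c j \<noteq> 0" "\<forall>\<alpha>\<in>homog n. (\<Sum>j<m. c j * e j \<alpha>) = 0"
    using homogeneous_system_nontrivial_solution[of "homog n :: ('d \<Rightarrow>\<^sub>0 nat) set" "{..<m}" e] by auto
  thus False using orthonormal_family_independent[OF e] by auto
qed

text \<open>
  The upper bound for the dimension of the quotient module in high degrees. The conjugates of the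
  vectors annihilate the ideal power in the sense of \<open>annihilator_dependent\<close>.
\<close>

lemma orthonormal_family_le_multiplicity:
  fixes e :: "nat \<Rightarrow> ('d::finite \<Rightarrow>\<^sub>0 nat) \<Rightarrow> complex"
  assumes e: "orthonormal_family (quotient_homog (Suc M) n) m e" and "M \<le> n"
  shows "m \<le> card (homog M :: ('d \<Rightarrow>\<^sub>0 nat) set)"
proof (rule ccontr)
  assume less: "\<not> ?thesis"
  have "\<exists>c. (\<exists>j\<in>{..<m}. c j \<noteq> 0) \<and> (\<forall>\<alpha>\<in>homog n. (\<Sum>j<m. c j * cnj (e j \<alpha>)) = 0)"
  proof (rule annihilator_dependent[OF _ _ \<open>M \<le> n\<close>])
    fix j and q :: "'d mpoly"
    assume "j \<in> {..<m}" "q \<in> ideal_power diag_ideal (Suc M)"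
    hence "l2_inner (e j) (Poly_Mapping.lookup q) = 0"
      using e by (auto simp: orthonormal_family_def quotient_homog_def quotient_coeffs_def ideal_coeffs_def)
    thus "pairing (\<lambda>\<alpha>. cnj (e j \<alpha>)) q = 0" by (simp add: l2_inner_lookup)
  qed (use less in auto)
  then obtain c where c: "\<exists>j<m. c j \<noteq> 0" "\<forall>\<alpha>\<in>homog n. (\<Sum>j<m. c j * cnj (e j \<alpha>)) = 0" by auto
  have conj: "(\<Sum>j<m. cnj (c j) * e j \<alpha>) = cnj (\<Sum>j<m. c j * cnj (e j \<alpha>))" for \<alpha> by simp
  have "\<forall>\<alpha>\<in>homog n. (\<Sum>j<m. cnj (c j) * e j \<alpha>) = 0" unfolding conj using c(2) by simp
  thus False using orthonormal_family_independent[OF e, of "\<lambda>j. cnj (c j)"] c(1) by auto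
qed

lemma maximal_orthonormal_family_total:
  fixes e :: "nat \<Rightarrow> ('d::finite \<Rightarrow>\<^sub>0 nat) \<Rightarrow> complex"
  assumes e: "orthonormal_family (quotient_homog N n) m e"
    and max: "\<And>e' :: nat \<Rightarrow> ('d \<Rightarrow>\<^sub>0 nat) \<Rightarrow> complex. \<not> orthonormal_family (quotient_homog N n) (Suc m) e'"
    and f: "f \<in> quotient_homog N n" "\<And>j. j < m \<Longrightarrow> l2_inner f (e j) = 0"
  shows "f = (\<lambda>_. 0)"
proof (rule ccontr)
  assume nz: "f \<noteq> (\<lambda>_. 0)"
  have fl2: "f \<in> l2" by (rule quotient_homog_l2[OF f(1)])
  have norm: "l2norm f \<noteq> 0" using l2norm_eq_0[OF fl2] nz by auto
  define x where "x = (\<lambda>\<alpha>. complex_of_real (1 / l2norm f) * f \<alpha>)"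
  have x: "x \<in> quotient_homog N n"
    using f(1) quotient_coeffs_lincomb[of "{()}" "\<lambda>_. f" N "\<lambda>_. complex_of_real (1 / l2norm f)"]
    by (auto simp: quotient_homog_def x_def)
  have xx: "l2_inner x x = 1"
  proof -
    have "l2_inner x x = complex_of_real (1 / l2norm f) * (cnj (complex_of_real (1 / l2norm f)) * l2_inner f f)"
      unfolding x_def using fl2 by (simp only: l2_inner_scale_left l2_inner_scale_right l2_scale)
    also have "\<dots> = complex_of_real (1 / l2norm f) * (complex_of_real (1 / l2norm f) * complex_of_real ((l2norm f)\<^sup>2))"
      by (simp only: l2_inner_self complex_cnj_complex_of_real)
    also have "\<dots> = 1" using norm by (simp add: power2_eq_square)
    finally show ?thesis .
  qed
  have el2: "e j \<in> l2" if "j < m" for j using e that quotient_homog_l2 by (auto simp: orthonormal_family_def)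
  have xe: "l2_inner x (e j) = 0" if "j < m" for j
    unfolding x_def l2_inner_scale_left[OF fl2 el2[OF that]] f(2)[OF that] by simp
  have ex: "l2_inner (e j) x = 0" if "j < m" for j using xe[OF that] l2_inner_cnj[of "e j" x] by simp
  have "orthonormal_family (quotient_homog N n) (Suc m) (e(m := x))"
    using e x xx xe ex by (auto simp: orthonormal_family_def less_Suc_eq)
  thus False using max by blast
qed

text \<open>
  Used in the finitely many low degrees where the polynomial families need not be independent.
\<close>

lemma orthonormal_family_exists:
  "\<exists>m e. orthonormal_family (quotient_homog N n :: (('d::finite \<Rightarrow>\<^sub>0 nat) \<Rightarrow> complex) set) m e \<and>
     (\<forall>f\<in>quotient_homog N n. (\<forall>j<m. l2_inner f (e j) = 0) \<longrightarrow> f = (\<lambda>_. 0))"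
proof -
  define P where "P = (\<lambda>m. \<exists>e. orthonormal_family (quotient_homog N n :: (('d \<Rightarrow>\<^sub>0 nat) \<Rightarrow> complex) set) m e)"
  have "P 0" by (simp add: P_def orthonormal_family_def)
  moreover have bound: "\<forall>m. P m \<longrightarrow> m \<le> card (homog n :: ('d \<Rightarrow>\<^sub>0 nat) set)"
    using orthonormal_family_le_card_homog unfolding P_def by blast
  ultimately obtain m where m: "P m" "\<And>m'. P m' \<Longrightarrow> m' \<le> m"
    using Nat.ex_has_greatest_nat[of P 0 "card (homog n :: ('d \<Rightarrow>\<^sub>0 nat) set)"] by blast
  obtain e where e: "orthonormal_family (quotient_homog N n :: (('d \<Rightarrow>\<^sub>0 nat) \<Rightarrow> complex) set) m e"
    using m(1) unfolding P_def by blast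
  have "\<not> P (Suc m)" using m(2)[of "Suc m"] by auto
  hence "\<forall>f\<in>quotient_homog N n. (\<forall>j<m. l2_inner f (e j) = 0) \<longrightarrow> f = (\<lambda>_. 0)"
    using maximal_orthonormal_family_total[OF e] unfolding P_def by blast
  thus ?thesis using e by blast
qed

definition monom_vec :: "('d::finite \<Rightarrow>\<^sub>0 nat) \<Rightarrow> nat \<Rightarrow> ('d \<Rightarrow>\<^sub>0 nat) \<Rightarrow> complex" where
  "monom_vec k n \<alpha> = (if tdeg \<alpha> = n then complex_of_real (monom_val k \<alpha>) else 0)"

text \<open>
  As the coefficients are real, the inner product with a polynomial is the functional treated in
  \<open>ideal_power_diffdeg\<close>.
\<close>

lemma monom_vec_mem:
  assumes "tdeg k = M"
  shows "monom_vec k n \<in> quotient_homog (Suc M) n"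
proof -
  have "l2_inner (monom_vec k n) (Poly_Mapping.lookup q) = 0" if "q \<in> ideal_power diag_ideal (Suc M)" for q
  proof -
    have "(\<lambda>\<alpha>. cnj (monom_vec k n \<alpha>)) = (\<lambda>\<alpha>. if tdeg \<alpha> = n then complex_of_real (monom_val k \<alpha>) else 0)"
      by (auto simp: monom_vec_def)
    thus ?thesis using ideal_power_monom_val[OF that, of k n] assms by (simp add: l2_inner_lookup)
  qed
  moreover have "monom_vec k n \<in> l2"
    by (rule l2_finite_support[of "homog n"]) (auto simp: monom_vec_def)
  ultimately show ?thesis
    by (auto simp: quotient_homog_def quotient_coeffs_def ideal_coeffs_def monom_vec_def)
qed

lemma expands2_ratio_sqrt: "\<exists>b. expands2 (\<lambda>n. sqrt (real n ^ M / real (n + p) ^ M)) 1 b"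
proof -
  have "expands2 (\<lambda>n. 1 + real p * (1 / real n)) (1 + real p * 0) (0 + real p * 1)"
    by (intro expands2_add expands2_const expands2_cmult expands2_inverse_nat)
  hence "expands2 (\<lambda>n. 1 + real p * (1 / real n)) 1 (real p)" by simp
  from expands2_inverse[OF this] obtain b where "expands2 (\<lambda>n. 1 / (1 + real p * (1 / real n))) 1 b" by auto
  from expands2_power[OF this, of M] obtain b' where "expands2 (\<lambda>n. (1 / (1 + real p * (1 / real n))) ^ M) 1 b'" by auto
  from expands2_sqrt[OF this] have S: "expands2 (\<lambda>n. sqrt ((1 / (1 + real p * (1 / real n))) ^ M)) 1 (b' / 2)" by simp
  have "eventually (\<lambda>n. sqrt ((1 / (1 + real p * (1 / real n))) ^ M) = sqrt (real n ^ M / real (n + p) ^ M)) sequentially"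
    using eventually_gt_at_top[of 0]
  proof eventually_elim
    case (elim n)
    have "1 / (1 + real p * (1 / real n)) = real n / real (n + p)" using elim by (simp add: field_simps)
    thus ?case by (simp add: power_divide)
  qed
  from expands2_cong[OF this S] show ?thesis by blast
qed

text \<open>
  In degree \<open>n \<ge> n0\<close> the family \<open>E n\<close> is obtained from the vectors \<open>monom_vec k n\<close>,
  \<open>\<bar>k\<bar> = M\<close>, by Gram-Schmidt. It has \<open>R\<close> members, the largest possible number, hence is a basis. The
  block of \<open>S\<^sub>\<beta>\<close> is computed from the Gram matrices of these vectors and their shifts, which have the
  same limit as the Gram matrices without shift; so the block tends to the identity.
\<close>

theorem quotient_module_trace:
  fixes f1 f2 :: "'d::finite mpoly"
  shows "has_trace_on (quotient_module (Suc M))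
     (commutator (adjoint_on (quotient_module (Suc M)) (compression (quotient_module (Suc M)) f1))
        (compression (quotient_module (Suc M)) f2))
     (of_nat (card (homog M :: ('d \<Rightarrow>\<^sub>0 nat) set)) *
      (\<Sum>\<beta>\<in>Poly_Mapping.keys f1. \<Sum>\<gamma>\<in>Poly_Mapping.keys f2.
        cnj (Poly_Mapping.lookup f1 \<beta>) * Poly_Mapping.lookup f2 \<gamma> * (if tdeg \<beta> = tdeg \<gamma> then of_nat (tdeg \<beta>) else 0)))"
proof -
  define R where "R = card (homog M :: ('d \<Rightarrow>\<^sub>0 nat) set)"
  (* Sums of products of two monomials of degree M over the d - 1 dimensional simplex
     grow like the D-th power of n. *)
  define D where "D = M + M + (CARD('d) - 1)"
  obtain h where h: "bij_betw h {..<R} (homog M :: ('d \<Rightarrow>\<^sub>0 nat) set)"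
    using ex_bij_betw_nat_finite[OF finite_homog[of M, where 'd = 'd]] unfolding R_def atLeast0LessThan by blast
  have hM: "tdeg (h i) = M" if "i < R" for i using bij_betwE[OF h] that by auto
  let ?L = Poly_Mapping.lookup
  (* H 0 is the normalised Gram matrix in degree n and G is its limit. *)
  define H where "H = (\<lambda>\<beta> i j n. (\<Sum>\<alpha>\<in>homog n. monom_val (h i) (\<alpha> + \<beta>) * monom_val (h j) \<alpha>) / real n ^ D)"
  define G where "G = (\<lambda>i j. (\<Prod>x\<in>UNIV. fact (?L (h i) x + ?L (h j) x)) / (fact D :: real))"
  have H: "\<exists>b. expands2 (H \<beta> i j) (G i j) b" if "i < R" "j < R" for \<beta> i j
    using homog_sum_monom_val_expands2[of "h i" \<beta> "h j"] hM that unfolding H_def G_def D_def by simp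
  have Gsym: "G i j = G j i" for i j by (simp add: G_def add.commute)
  have "\<forall>i j. \<exists>b. i < R \<longrightarrow> j < R \<longrightarrow> expands2 (H 0 i j) (G i j) b" using H by blast
  then obtain B where B: "\<And>i j. i < R \<Longrightarrow> j < R \<Longrightarrow> expands2 (\<lambda>n. H 0 i j n) (G i j) (B i j)" by metis
  have pos: "(\<Sum>i<R. \<Sum>j<R. c i * c j * G i j) > 0" if "\<exists>i<R. c i \<noteq> 0" for c :: "nat \<Rightarrow> real"
  proof -
    define c' where "c' = (\<lambda>k. c (the_inv_into {..<R} h k))"
    have c': "c' (h i) = c i" if "i < R" for i
      using the_inv_into_f_f[OF bij_betw_imp_inj_on[OF h], of i] that by (simp add: c'_def)
    have "\<exists>k\<in>homog M. c' k \<noteq> 0" using that c' hM by (metis mem_homog)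
    from gram_limit_positive_definite[OF this]
    have "(\<Sum>i<R. \<Sum>j<R. c' (h i) * c' (h j) * (\<Prod>x\<in>UNIV. fact (?L (h i) x + ?L (h j) x))) > 0"
      by (simp only: sum.reindex_bij_betw[OF h, symmetric])
    also have "(\<Sum>i<R. \<Sum>j<R. c' (h i) * c' (h j) * (\<Prod>x\<in>UNIV. fact (?L (h i) x + ?L (h j) x))) =
       fact D * (\<Sum>i<R. \<Sum>j<R. c i * c j * G i j)"
      unfolding sum_distrib_left by (intro sum.cong refl) (simp add: c' G_def)
    finally show ?thesis by (simp add: zero_less_mult_iff)
  qed
  have Hsym: "H 0 i j n = H 0 j i n" for i j n by (simp add: H_def mult.commute)
  obtain t t0 t1 where t: "\<And>j l. expands2 (\<lambda>n. t n j l) (t0 j l) (t1 j l)"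
    and orth: "\<forall>\<^sub>F n in sequentially. \<forall>j<R. \<forall>k<R. (\<Sum>a<R. \<Sum>b<R. t n j a * t n k b * H 0 a b n) = (if j = k then 1 else 0)"
    using gram_schmidt_expands2[OF B Hsym pos] by blast
  obtain n1 where n1: "\<And>n j k. n \<ge> n1 \<Longrightarrow> j < R \<Longrightarrow> k < R \<Longrightarrow>
      (\<Sum>a<R. \<Sum>b<R. t n j a * t n k b * H 0 a b n) = (if j = k then 1 else 0)"
    using orth unfolding eventually_sequentially by blast
  have lim_orth: "(\<Sum>a<R. \<Sum>b<R. t0 j a * t0 k b * G a b) = (if j = k then 1 else 0)" if "j < R" "k < R" for j k
  proof (rule LIMSEQ_unique)
    show "(\<lambda>n. \<Sum>a<R. \<Sum>b<R. t n j a * t n k b * H 0 a b n) \<longlonglongrightarrow> (\<Sum>a<R. \<Sum>b<R. t0 j a * t0 k b * G a b)"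
      by (intro tendsto_sum tendsto_mult expands2_tendsto[OF t] expands2_tendsto[OF B]) auto
    show "(\<lambda>n. \<Sum>a<R. \<Sum>b<R. t n j a * t n k b * H 0 a b n) \<longlonglongrightarrow> (if j = k then 1 else 0)"
      using orth that by (intro tendsto_eventually) (auto elim: eventually_mono)
  qed
  (* From n1 on the family is orthonormal; M \<le> n is needed for the bound on the dimension
     and n > 0 for the normalisation. *)
  define n0 where "n0 = n1 + M + 1"
  define E where "E = (\<lambda>n j \<alpha>. \<Sum>a<R. complex_of_real (t n j a / sqrt (real n ^ D)) * monom_vec (h a) n \<alpha>)"
  have E_mem: "E n j \<in> quotient_homog (Suc M) n" for n j
  proof -
    have "monom_vec (h a) n \<in> quotient_homog (Suc M) n" if "a < R" for a by (rule monom_vec_mem[OF hM[OF that]])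
    hence m: "monom_vec (h a) n \<in> quotient_coeffs (Suc M)" "tdeg \<alpha> \<noteq> n \<Longrightarrow> monom_vec (h a) n \<alpha> = 0" if "a < R" for a \<alpha>
      using that by (auto simp: quotient_homog_def)
    show ?thesis unfolding E_def quotient_homog_def
      by (intro CollectI conjI quotient_coeffs_lincomb m allI impI sum.neutral) (auto simp: m(2))
  qed
  have E_real: "E n j \<alpha> = complex_of_real (\<Sum>a<R. t n j a / sqrt (real n ^ D) * monom_val (h a) \<alpha>)" if "tdeg \<alpha> = n" for n j \<alpha>
    using that by (simp add: E_def monom_vec_def)
  have inner_E: "l2_inner (E n j) (backshift \<beta> (E (n + tdeg \<beta>) k)) =
      complex_of_real (\<Sum>a<R. \<Sum>b<R. t n j a * t (n + tdeg \<beta>) k b * (H \<beta> b a n * sqrt (real n ^ D / real (n + tdeg \<beta>) ^ D)))"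
    if n: "n > 0" for n j k \<beta>
  proof -
    let ?n' = "n + tdeg \<beta>"
    let ?s = "sqrt (real n ^ D)" and ?s' = "sqrt (real ?n' ^ D)"
    have s: "?s > 0" "?s' > 0" "?s * ?s = real n ^ D" using n by auto
    have "l2_inner (E n j) (backshift \<beta> (E ?n' k)) = (\<Sum>\<alpha>\<in>homog n. E n j \<alpha> * cnj (E ?n' k (\<beta> + \<alpha>)))"
      by (subst l2_inner_homogeneous[of n]) (use E_mem[of ?n' k] in \<open>auto simp: backshift_def quotient_homog_def\<close>)
    also have "\<dots> = (\<Sum>\<alpha>\<in>homog n. complex_of_real ((\<Sum>a<R. t n j a / ?s * monom_val (h a) \<alpha>) * (\<Sum>b<R. t ?n' k b / ?s' * monom_val (h b) (\<alpha> + \<beta>))))"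
      by (intro sum.cong refl) (simp add: E_real add.commute)
    also have "\<dots> = complex_of_real (\<Sum>\<alpha>\<in>homog n. \<Sum>a<R. \<Sum>b<R. t n j a * t ?n' k b * (monom_val (h b) (\<alpha> + \<beta>) * monom_val (h a) \<alpha> / (?s * ?s')))"
      unfolding of_real_sum[symmetric] sum_product
      by (intro arg_cong[of _ _ complex_of_real] sum.cong refl) (simp add: field_simps)
    also have "(\<Sum>\<alpha>\<in>homog n. \<Sum>a<R. \<Sum>b<R. t n j a * t ?n' k b * (monom_val (h b) (\<alpha> + \<beta>) * monom_val (h a) \<alpha> / (?s * ?s'))) =
       (\<Sum>a<R. \<Sum>b<R. \<Sum>\<alpha>\<in>homog n. t n j a * t ?n' k b * (monom_val (h b) (\<alpha> + \<beta>) * monom_val (h a) \<alpha> / (?s * ?s')))"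
      by (subst sum.swap) (intro sum.cong refl sum.swap)
    also have "\<dots> = (\<Sum>a<R. \<Sum>b<R. t n j a * t ?n' k b * (H \<beta> b a n * sqrt (real n ^ D / real ?n' ^ D)))"
    proof (intro sum.cong refl)
      fix a b
      have "H \<beta> b a n * sqrt (real n ^ D / real ?n' ^ D) = (\<Sum>\<alpha>\<in>homog n. monom_val (h b) (\<alpha> + \<beta>) * monom_val (h a) \<alpha>) / (?s * ?s) * (?s / ?s')"
        unfolding H_def s(3) real_sqrt_divide ..
      also have "\<dots> = (\<Sum>\<alpha>\<in>homog n. monom_val (h b) (\<alpha> + \<beta>) * monom_val (h a) \<alpha>) / (?s * ?s')"
      proof -
        have cancel: "X / (x * x) * (x / y) = X / (x * y)" if "x \<noteq> 0" for X x y :: real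
          using that by (simp add: field_simps)
        show ?thesis by (rule cancel) (use s(1) in linarith)
      qed
      finally show "(\<Sum>\<alpha>\<in>homog n. t n j a * t ?n' k b * (monom_val (h b) (\<alpha> + \<beta>) * monom_val (h a) \<alpha> / (?s * ?s'))) =
          t n j a * t ?n' k b * (H \<beta> b a n * sqrt (real n ^ D / real ?n' ^ D))"
        by (simp add: sum_distrib_left sum_divide_distrib)
    qed
    finally show ?thesis .
  qed
  have E_orth: "orthonormal_family (quotient_homog (Suc M) n) R (E n)" if n: "n \<ge> n0" for n
    unfolding orthonormal_family_def
  proof (intro conjI allI impI E_mem)
    fix j k assume jk: "j < R" "k < R"
    have n': "n > 0" "n \<ge> n1" using n by (auto simp: n0_def)
    have "backshift 0 (E n k) = E n k" by (rule ext) (simp add: backshift_def)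
    hence "l2_inner (E n j) (E n k) = complex_of_real (\<Sum>a<R. \<Sum>b<R. t n j a * t n k b * H 0 b a n)"
      using inner_E[OF n'(1), of j 0 k] n'(1) by simp
    also have "(\<Sum>a<R. \<Sum>b<R. t n j a * t n k b * H 0 b a n) = (if j = k then 1 else 0)"
      using n1[OF n'(2) jk] by (simp add: Hsym)
    finally show "l2_inner (E n j) (E n k) = (if j = k then 1 else 0)" by simp
  qed
  have E_total: "f = (\<lambda>_. 0)" if "n \<ge> n0" "f \<in> quotient_homog (Suc M) n" "\<And>j. j < R \<Longrightarrow> l2_inner f (E n j) = 0" for n f
  proof (rule maximal_orthonormal_family_total[OF E_orth[OF that(1)] _ that(2,3)])
    fix e' :: "nat \<Rightarrow> ('d \<Rightarrow>\<^sub>0 nat) \<Rightarrow> complex"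
    show "\<not> orthonormal_family (quotient_homog (Suc M) n) (Suc R) e'"
      using orthonormal_family_le_multiplicity[of M n "Suc R" e'] that(1) by (auto simp: n0_def R_def)
  qed
  have "\<forall>n. \<exists>m e. orthonormal_family (quotient_homog (Suc M) n :: (('d \<Rightarrow>\<^sub>0 nat) \<Rightarrow> complex) set) m e \<and>
     (\<forall>f\<in>quotient_homog (Suc M) n. (\<forall>j<m. l2_inner f (e j) = 0) \<longrightarrow> f = (\<lambda>_. 0))"
    using orthonormal_family_exists by blast
  then obtain mm ee where ee: "\<And>n. orthonormal_family (quotient_homog (Suc M) n :: (('d \<Rightarrow>\<^sub>0 nat) \<Rightarrow> complex) set) (mm n) (ee n)"
    "\<And>n f. f \<in> quotient_homog (Suc M) n \<Longrightarrow> (\<forall>j<mm n. l2_inner f (ee n j) = 0) \<Longrightarrow> f = (\<lambda>_. 0)"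
    by metis
  define r where "r = (\<lambda>n. if n \<ge> n0 then R else mm n)"
  define b where "b = (\<lambda>(n, j). if n \<ge> n0 then E n j else ee n j)"
  have fam: "orthonormal_family (quotient_homog (Suc M) n) (r n) (\<lambda>j. b (n, j))" for n
    using E_orth[of n] ee(1)[of n] by (simp add: r_def b_def)
  have total: "f = (\<lambda>_. 0)" if "f \<in> quotient_homog (Suc M) n" "\<And>j. j < r n \<Longrightarrow> l2_inner f (b (n, j)) = 0" for n f
    using E_total[of n f] ee(2)[of f n] that by (cases "n \<ge> n0") (auto simp: r_def b_def)
  interpret asymptotic_basis "quotient_coeffs (Suc M) :: (('d \<Rightarrow>\<^sub>0 nat) \<Rightarrow> complex) set" "ideal_coeffs (Suc M)" r b R n0
  proof unfold_locales
    show "ideal_coeffs (Suc M) \<subseteq> (l2 :: (('d \<Rightarrow>\<^sub>0 nat) \<Rightarrow> complex) set)" by (rule ideal_coeffs_l2)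
    show "quotient_coeffs (Suc M) = {a \<in> l2. \<forall>g\<in>ideal_coeffs (Suc M). l2_inner a g = 0}" by (rule quotient_coeffs_def)
    show "a \<in> quotient_coeffs (Suc M) \<Longrightarrow> slice n a \<in> quotient_coeffs (Suc M)" for a :: "('d \<Rightarrow>\<^sub>0 nat) \<Rightarrow> complex" and n
      by (rule quotient_coeffs_slice)
    show "a \<in> l2 \<Longrightarrow> (\<And>n. slice n a \<in> quotient_coeffs (Suc M)) \<Longrightarrow> a \<in> quotient_coeffs (Suc M)" for a :: "('d \<Rightarrow>\<^sub>0 nat) \<Rightarrow> complex"
      by (rule quotient_coeffs_slices)
    show "j < r n \<Longrightarrow> b (n, j) \<in> quotient_coeffs (Suc M)" for n j
      using fam[of n] by (auto simp: orthonormal_family_def quotient_homog_def)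
    show "j < r n \<Longrightarrow> tdeg \<alpha> \<noteq> n \<Longrightarrow> b (n, j) \<alpha> = 0" for n j \<alpha>
      using fam[of n] by (auto simp: orthonormal_family_def quotient_homog_def)
    show "j < r n \<Longrightarrow> k < r n \<Longrightarrow> l2_inner (b (n, j)) (b (n, k)) = (if j = k then 1 else 0)" for n j k
      using fam[of n] by (auto simp: orthonormal_family_def)
    show "a \<in> quotient_coeffs (Suc M) \<Longrightarrow> (\<And>\<alpha>. tdeg \<alpha> \<noteq> n \<Longrightarrow> a \<alpha> = 0) \<Longrightarrow>
       (\<And>j. j < r n \<Longrightarrow> l2_inner a (b (n, j)) = 0) \<Longrightarrow> a = (\<lambda>_. 0)" for a n
      using total[of a n] by (auto simp: quotient_homog_def)
    show "n \<ge> n0 \<Longrightarrow> r n = R" for n by (simp add: r_def)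
    fix \<beta> :: "'d \<Rightarrow>\<^sub>0 nat" and j' j assume jj: "j' < R" "j < R"
    define u where "u = (\<lambda>n. \<Sum>a<R. \<Sum>b<R. t n j a * t (n + tdeg \<beta>) j' b * (H \<beta> b a n * sqrt (real n ^ D / real (n + tdeg \<beta>) ^ D)))"
    obtain q where q: "expands2 (\<lambda>n. sqrt (real n ^ D / real (n + tdeg \<beta>) ^ D)) 1 q" using expands2_ratio_sqrt by blast
    have "\<forall>a b. \<exists>c. a < R \<longrightarrow> b < R \<longrightarrow> expands2 (H \<beta> b a) (G b a) c" using H by blast
    then obtain C where C: "\<And>a b. a < R \<Longrightarrow> b < R \<Longrightarrow> expands2 (\<lambda>n. H \<beta> b a n) (G b a) (C a b)" by metis
    have "expands2 u (\<Sum>a<R. \<Sum>b<R. t0 j a * t0 j' b * (G b a * 1))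
      (\<Sum>a<R. \<Sum>b<R. (t0 j a * t0 j' b) * (G b a * q + C a b * 1) + (t0 j a * t1 j' b + t1 j a * t0 j' b) * (G b a * 1))"
      unfolding u_def by (intro expands2_sum expands2_mult t expands2_shift[OF t] C q) auto
    moreover have "(\<Sum>a<R. \<Sum>b<R. t0 j a * t0 j' b * (G b a * 1)) = (if j' = j then 1 else 0)"
      using lim_orth[OF jj(2,1)] by (simp add: Gsym eq_commute)
    ultimately have "expands2 u (if j' = j then 1 else 0)
      (\<Sum>a<R. \<Sum>b<R. (t0 j a * t0 j' b) * (G b a * q + C a b * 1) + (t0 j a * t1 j' b + t1 j a * t0 j' b) * (G b a * 1))"
      by simp
    moreover have "\<forall>n\<ge>n0. l2_inner (shift \<beta> (b (n, j))) (b (n + tdeg \<beta>, j')) = complex_of_real (u n)"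
    proof (intro allI impI)
      fix n assume n: "n \<ge> n0"
      have "l2_inner (shift \<beta> (b (n, j))) (b (n + tdeg \<beta>, j')) = l2_inner (shift \<beta> (E n j)) (E (n + tdeg \<beta>) j')"
        using n by (simp add: b_def)
      also have "\<dots> = l2_inner (E n j) (backshift \<beta> (E (n + tdeg \<beta>) j'))"
        by (rule l2_inner_shift) (use E_mem quotient_homog_l2 in blast)+
      also have "\<dots> = complex_of_real (u n)" unfolding u_def by (rule inner_E) (use n in \<open>simp add: n0_def\<close>)
      finally show "l2_inner (shift \<beta> (b (n, j))) (b (n + tdeg \<beta>, j')) = complex_of_real (u n)" .
    qed
    ultimately show "\<exists>u B. expands2 u (if j' = j then 1 else 0) B \<and>
        (\<forall>n\<ge>n0. l2_inner (shift \<beta> (b (n, j))) (b (n + tdeg \<beta>, j')) = complex_of_real (u n))" by blast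
  qed
  show ?thesis
    using has_trace_on_commutator[of f1 f2] unfolding quotient_module_eq[symmetric] R_def .
qed

section \<open>The trace formula\<close>

theorem theorem1p4:
  fixes f1 f2 :: "'d::finite mpoly" and N :: nat
  assumes "CARD('d) \<ge> 3" and "N \<ge> 1"
  shows "has_trace_on (quotient_module N)
           (commutator
             (adjoint_on (quotient_module N) (compression (quotient_module N) f1))
             (compression (quotient_module N) f2))
           (of_nat ((CARD('d) + N - 2) choose (CARD('d) - 1)) *
             bergman_inner (deriv (diag_restrict (mpoly_eval f2)))
                           (deriv (diag_restrict (mpoly_eval f1))))"
proof -
  obtain M where M: "N = Suc M" using assms(2) by (cases N) auto
  have "CARD('d) + N - 2 = M + (CARD('d) - 1)" using assms(1) by (simp add: M)
  hence card: "(CARD('d) + N - 2) choose (CARD('d) - 1) = card (homog M :: ('d \<Rightarrow>\<^sub>0 nat) set)"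
    by (simp add: card_homog)
  show ?thesis
    unfolding card bergman_inner_deriv_diag unfolding M by (rule quotient_module_trace)
qed

end
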